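(* Let $X$ be a real analytic manifold, let $\varepsilon>0$, and let $(\varphi_t)_{t\in(-\varepsilon,\varepsilon)}$ be a real analytic family of real analytic automorphisms of $X$ with $\varphi_0=\mathrm{id}_X$. Let $\xi(t)=\dot\varphi_t\circ\varphi_t^{-1}=\sum_{k\geqslant 0}\xi_kt^k$. Then the pull-back operator $\varphi_t^*$ acting on real analytic sections of the tensor bundles $(T_X^* )^{\otimes p}\otimes T_X^{\otimes q}$, $p,q\geqslant 0$, has the expansion in $t$ $$\varphi_t^*=\mathbb{I}+\sum_{k\geqslant 1}t^k\sum_{\lambda\vDash k}\ \prod_{j=1}^{l_\lambda}L_{|\lambda|_j^{-1}\,\xi_{\lambda_j-1}} ,$$ where $|\lambda|_j=\sum_{r=1}^j\lambda_r$. That is, for every real analytic section $\alpha$ of $(T_X^* )^{\otimes p}\otimes T_X^{\otimes q}$ and every $k\geqslant 1$, $$\frac1{k!}\frac{d^k}{dt^k}\Big|_{t=0}(\varphi_t^*\alpha)=\sum_{\lambda\vDash k}\left[\prod_{j=1}^{l_\lambda}L_{|\lambda|_j^{-1}\xi_{\lambda_j-1}}\right]\alpha ,$$ and at each point $x\in X$ the section $\varphi_t^*\alpha$ is the sum of the corresponding power series for $|t|$ small (depending on $x$).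
   Context: $\lambda\vDash k$ means that $\lambda=(\lambda_1,\dots,\lambda_{l_\lambda})$ is a composition of $k$: a tuple of positive integers with $\sum_{j=1}^{l_\lambda}\lambda_j=k$; $l_\lambda$ is its length. Products over ordered index sets are taken from left to right, so $\prod_{j=1}^{l}L_{\eta_j}=L_{\eta_1}\circ\cdots\circ L_{\eta_l}$. $L_\eta$ is the Lie derivative along the vector field $\eta$ acting on tensor sections. "Real analytic family" means that $(t,x)\mapsto\varphi_t(x)$ is real analytic; $\xi(t)$ is the associated time dependent vector field and $\xi_k$ are its Taylor coefficients in $t$ at $t=0$. $\varphi_t^*$ is the usual pull-back of mixed tensors by a diffeomorphism (contravariant factors are transported by $(d\varphi_t)^{-1}$). *)

theory Defs
  imports "HOL-Analysis.Analysis"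
begin

section \<open>Real analytic functions of \<open>n\<close> variables\<close>

text \<open>Points of n-space are the elements of \<^term>\<open>topspace (Euclidean_space n)\<close>, that is, functions
  \<^typ>\<open>nat \<Rightarrow> real\<close> vanishing at all indices \<open>\<ge> n\<close>; multi-indices are encoded in the same way.
  For real families \<open>has_sum\<close> means absolute convergence.\<close>

definition real_analytic_at :: "nat \<Rightarrow> ((nat \<Rightarrow> real) \<Rightarrow> real) \<Rightarrow> (nat \<Rightarrow> real) \<Rightarrow> bool" where
  "real_analytic_at n g a \<longleftrightarrow>
     (\<exists>(coef :: (nat \<Rightarrow> nat) \<Rightarrow> real) r. r > 0 \<and>
        (\<forall>z \<in> topspace (Euclidean_space n). (\<forall>i<n. \<bar>z i - a i\<bar> < r) \<longrightarrow>
           ((\<lambda>m. coef m * (\<Prod>i<n. (z i - a i) ^ m i)) has_sum g z) {m. \<forall>i\<ge>n. m i = 0}))"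

definition partial_deriv :: "nat \<Rightarrow> ((nat \<Rightarrow> real) \<Rightarrow> real) \<Rightarrow> (nat \<Rightarrow> real) \<Rightarrow> real" where
  "partial_deriv i g a = deriv (\<lambda>s. g (a(i := s))) (a i)"


section \<open>Real analytic manifolds\<close>

text \<open>A chart is a pair of its domain and its coordinate map; the coordinate map is only
  meaningful on the domain.\<close>

type_synonym 'a chart = "'a set \<times> ('a \<Rightarrow> nat \<Rightarrow> real)"

record 'a manifold =
  mtop :: "'a topology"
  mdim :: nat
  atlas :: "'a chart set"

definition real_analytic_manifold :: "'a manifold \<Rightarrow> bool" where
  "real_analytic_manifold M \<longleftrightarrow>
     Hausdorff_space (mtop M) \<and> second_countable (mtop M) \<and>
     (\<Union>(U, c) \<in> atlas M. U) = topspace (mtop M) \<and>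
     (\<forall>(U, c) \<in> atlas M.
        openin (mtop M) U \<and> openin (Euclidean_space (mdim M)) (c ` U) \<and>
        homeomorphic_map (subtopology (mtop M) U)
          (subtopology (Euclidean_space (mdim M)) (c ` U)) c) \<and>
     (\<forall>(U, c) \<in> atlas M. \<forall>(V, d) \<in> atlas M. \<forall>x \<in> U \<inter> V. \<forall>j < mdim M.
        real_analytic_at (mdim M) (\<lambda>z. d (inv_into U c z) j) (c x))"

text \<open>Functions are total; analyticity at \<open>x\<close> only concerns the values near \<open>x\<close>.\<close>

definition analytic_fun_at :: "'a manifold \<Rightarrow> ('a \<Rightarrow> real) \<Rightarrow> 'a \<Rightarrow> bool" where
  "analytic_fun_at M f x \<longleftrightarrow>
     (\<forall>(U, c) \<in> atlas M. x \<in> U \<longrightarrow> real_analytic_at (mdim M) (\<lambda>z. f (inv_into U c z)) (c x))"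

definition analytic_map :: "'a manifold \<Rightarrow> 'b manifold \<Rightarrow> ('a \<Rightarrow> 'b) \<Rightarrow> bool" where
  "analytic_map M N f \<longleftrightarrow>
     continuous_map (mtop M) (mtop N) f \<and>
     (\<forall>(U, c) \<in> atlas M. \<forall>(V, d) \<in> atlas N. \<forall>x \<in> U. f x \<in> V \<longrightarrow>
        (\<forall>j < mdim N. real_analytic_at (mdim M) (\<lambda>z. d (f (inv_into U c z)) j) (c x)))"

definition analytic_automorphism :: "'a manifold \<Rightarrow> ('a \<Rightarrow> 'a) \<Rightarrow> bool" where
  "analytic_automorphism M f \<longleftrightarrow>
     bij_betw f (topspace (mtop M)) (topspace (mtop M)) \<and>
     analytic_map M M f \<and> analytic_map M M (inv_into (topspace (mtop M)) f)"

text \<open>The product of an open interval with \<open>M\<close>; time is the last coordinate.\<close>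

definition interval_times :: "real \<Rightarrow> real \<Rightarrow> 'a manifold \<Rightarrow> (real \<times> 'a) manifold" where
  "interval_times a b M =
     \<lparr> mtop = prod_topology (top_of_set {a<..<b}) (mtop M),
       mdim = Suc (mdim M),
       atlas = (\<lambda>(U, c). ({a<..<b} \<times> U, \<lambda>(t, x). (c x)(mdim M := t))) ` atlas M \<rparr>"

definition analytic_family :: "'a manifold \<Rightarrow> real \<Rightarrow> (real \<Rightarrow> 'a \<Rightarrow> 'a) \<Rightarrow> bool" where
  "analytic_family M e \<phi> \<longleftrightarrow>
     (\<forall>t \<in> {-e<..<e}. analytic_automorphism M (\<phi> t)) \<and>
     analytic_map (interval_times (-e) e M) M (\<lambda>(t, x). \<phi> t x)"


section \<open>Tangent and cotangent spaces\<close>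

text \<open>Tangent vectors at \<open>x\<close> are the derivations at \<open>x\<close> of the algebra of functions that are
  analytic at \<open>x\<close>, extended by \<open>0\<close> to all other functions so that each derivation has one
  representative. The Leibniz rule forces a derivation to depend only on germs: a function
  vanishing near \<open>x\<close> is its own product with an indicator function that is \<open>0\<close> near \<open>x\<close>.\<close>

type_synonym 'a tvec = "('a \<Rightarrow> real) \<Rightarrow> real"
type_synonym 'a tcovec = "'a tvec \<Rightarrow> real"

definition tangent_space :: "'a manifold \<Rightarrow> 'a \<Rightarrow> 'a tvec set" where
  "tangent_space M x = {v.
     (\<forall>f g a b. analytic_fun_at M f x \<and> analytic_fun_at M g x \<longrightarrow>
        v (\<lambda>y. a * f y + b * g y) = a * v f + b * v g \<and>
        v (\<lambda>y. f y * g y) = f x * v g + g x * v f) \<and>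
     (\<forall>f. \<not> analytic_fun_at M f x \<longrightarrow> v f = 0)}"

definition cotangent_space :: "'a manifold \<Rightarrow> 'a \<Rightarrow> 'a tcovec set" where
  "cotangent_space M x = {\<omega>.
     (\<forall>v \<in> tangent_space M x. \<forall>w \<in> tangent_space M x. \<forall>a b.
        \<omega> (\<lambda>f. a * v f + b * w f) = a * \<omega> v + b * \<omega> w) \<and>
     (\<forall>v. v \<notin> tangent_space M x \<longrightarrow> \<omega> v = 0)}"

text \<open>The coordinate frame and coframe of a chart.\<close>

definition coord_vec :: "'a manifold \<Rightarrow> 'a chart \<Rightarrow> nat \<Rightarrow> 'a \<Rightarrow> 'a tvec" where
  "coord_vec M C i x = (\<lambda>f. if analytic_fun_at M f x
     then partial_deriv i (\<lambda>z. f (inv_into (fst C) (snd C) z)) (snd C x) else 0)"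

definition coord_covec :: "'a manifold \<Rightarrow> 'a chart \<Rightarrow> nat \<Rightarrow> 'a \<Rightarrow> 'a tcovec" where
  "coord_covec M C j x = (\<lambda>v. if v \<in> tangent_space M x then v (\<lambda>y. snd C y j) else 0)"

text \<open>The differential of a map, and the transport of covectors by its inverse.\<close>

definition push_vec :: "'a manifold \<Rightarrow> ('a \<Rightarrow> 'a) \<Rightarrow> 'a \<Rightarrow> 'a tvec \<Rightarrow> 'a tvec" where
  "push_vec M f x v = (\<lambda>g. if analytic_fun_at M g (f x) then v (\<lambda>y. g (f y)) else 0)"

definition push_covec :: "'a manifold \<Rightarrow> ('a \<Rightarrow> 'a) \<Rightarrow> 'a \<Rightarrow> 'a tcovec \<Rightarrow> 'a tcovec" where
  "push_covec M f x \<omega> = (\<lambda>w. if w \<in> tangent_space M (f x)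
     then \<omega> (inv_into (tangent_space M x) (push_vec M f x) w) else 0)"


section \<open>Tensor fields\<close>

text \<open>The fibre at \<open>x\<close> of the tensor bundle with \<open>p\<close> covariant and \<open>q\<close> contravariant factors is the
  space of multilinear forms in \<open>p\<close> tangent vectors and \<open>q\<close> covectors at \<open>x\<close>, both given as lists.
  Values at other arguments are irrelevant.\<close>

type_synonym 'a tensor_field = "'a \<Rightarrow> 'a tvec list \<Rightarrow> 'a tcovec list \<Rightarrow> real"

definition tensor_args ::
    "'a manifold \<Rightarrow> nat \<Rightarrow> nat \<Rightarrow> 'a \<Rightarrow> ('a tvec list \<times> 'a tcovec list) set" where
  "tensor_args M p q x = {(vs, ws). length vs = p \<and> set vs \<subseteq> tangent_space M x \<and>
                                    length ws = q \<and> set ws \<subseteq> cotangent_space M x}"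

definition multilinear_at :: "'a manifold \<Rightarrow> nat \<Rightarrow> nat \<Rightarrow> 'a \<Rightarrow>
    ('a tvec list \<Rightarrow> 'a tcovec list \<Rightarrow> real) \<Rightarrow> bool" where
  "multilinear_at M p q x T \<longleftrightarrow> (\<forall>(vs, ws) \<in> tensor_args M p q x.
     (\<forall>i<p. \<forall>u \<in> tangent_space M x. \<forall>v \<in> tangent_space M x. \<forall>a b.
        T (vs[i := (\<lambda>f. a * u f + b * v f)]) ws = a * T (vs[i := u]) ws + b * T (vs[i := v]) ws) \<and>
     (\<forall>j<q. \<forall>\<omega> \<in> cotangent_space M x. \<forall>\<theta> \<in> cotangent_space M x. \<forall>a b.
        T vs (ws[j := (\<lambda>v. a * \<omega> v + b * \<theta> v)]) = a * T vs (ws[j := \<omega>]) + b * T vs (ws[j := \<theta>])))"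

definition multi_indices :: "nat \<Rightarrow> nat \<Rightarrow> nat list set" where
  "multi_indices n p = {I. length I = p \<and> set I \<subseteq> {..<n}}"

definition tensor_component ::
    "'a manifold \<Rightarrow> 'a chart \<Rightarrow> 'a tensor_field \<Rightarrow> nat list \<Rightarrow> nat list \<Rightarrow> 'a \<Rightarrow> real" where
  "tensor_component M C \<alpha> I J y =
     \<alpha> y (map (\<lambda>i. coord_vec M C i y) I) (map (\<lambda>j. coord_covec M C j y) J)"

definition analytic_tensor_field :: "'a manifold \<Rightarrow> nat \<Rightarrow> nat \<Rightarrow> 'a tensor_field \<Rightarrow> bool" where
  "analytic_tensor_field M p q \<alpha> \<longleftrightarrow>
     (\<forall>x \<in> topspace (mtop M). multilinear_at M p q x (\<alpha> x)) \<and>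
     (\<forall>C \<in> atlas M. \<forall>x \<in> fst C. \<forall>I \<in> multi_indices (mdim M) p. \<forall>J \<in> multi_indices (mdim M) q.
        analytic_fun_at M (tensor_component M C \<alpha> I J) x)"

definition pullback :: "'a manifold \<Rightarrow> ('a \<Rightarrow> 'a) \<Rightarrow> 'a tensor_field \<Rightarrow> 'a tensor_field" where
  "pullback M f \<alpha> = (\<lambda>x vs ws. \<alpha> (f x) (map (push_vec M f x) vs) (map (push_covec M f x) ws))"


section \<open>Lie derivatives\<close>

type_synonym 'a vector_field = "'a \<Rightarrow> 'a tvec"

definition chart_partial :: "'a chart \<Rightarrow> nat \<Rightarrow> ('a \<Rightarrow> real) \<Rightarrow> 'a \<Rightarrow> real" where
  "chart_partial C k f y = partial_deriv k (\<lambda>z. f (inv_into (fst C) (snd C) z)) (snd C y)"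

definition field_component :: "'a chart \<Rightarrow> 'a vector_field \<Rightarrow> nat \<Rightarrow> 'a \<Rightarrow> real" where
  "field_component C \<eta> k y = \<eta> y (\<lambda>z. snd C z k)"

text \<open>The component with lower indices \<open>I\<close> and upper indices \<open>J\<close> of the Lie derivative: with
  summation over repeated indices this is
  \<open>\<eta>\<^sup>k \<partial>\<^sub>k \<alpha>(I;J) + \<Sum>\<^sub>r (\<partial>\<^bsub>I r\<^esub> \<eta>\<^sup>k) \<alpha>(I[r := k];J) - \<Sum>\<^sub>s (\<partial>\<^sub>k \<eta>\<^bsup>J s\<^esup>) \<alpha>(I;J[s := k])\<close>,
  hence \<open>\<eta>f\<close> on functions and the bracket \<open>[\<eta>, Y]\<close> on vector fields.\<close>

definition lie_component :: "'a manifold \<Rightarrow> 'a chart \<Rightarrow> 'a vector_field \<Rightarrow> 'a tensor_field \<Rightarrow>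
    nat list \<Rightarrow> nat list \<Rightarrow> 'a \<Rightarrow> real" where
  "lie_component M C \<eta> \<alpha> I J y =
     (\<Sum>k<mdim M. field_component C \<eta> k y * chart_partial C k (tensor_component M C \<alpha> I J) y)
   + (\<Sum>r<length I. \<Sum>k<mdim M.
        chart_partial C (I ! r) (field_component C \<eta> k) y * tensor_component M C \<alpha> (I[r := k]) J y)
   - (\<Sum>s<length J. \<Sum>k<mdim M.
        chart_partial C k (field_component C \<eta> (J ! s)) y * tensor_component M C \<alpha> I (J[s := k]) y)"

text \<open>The tensor with these components; it does not depend on the chart around \<open>x\<close>.\<close>

definition lie_deriv :: "'a manifold \<Rightarrow> 'a vector_field \<Rightarrow> 'a tensor_field \<Rightarrow> 'a tensor_field" where
  "lie_deriv M \<eta> \<alpha> = (\<lambda>x vs ws.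
     let C = (SOME C. C \<in> atlas M \<and> x \<in> fst C) in
     \<Sum>I \<in> multi_indices (mdim M) (length vs). \<Sum>J \<in> multi_indices (mdim M) (length ws).
       lie_component M C \<eta> \<alpha> I J x *
       (\<Prod>r<length vs. (vs ! r) (\<lambda>y. snd C y (I ! r))) *
       (\<Prod>s<length ws. (ws ! s) (coord_vec M C (J ! s) x)))"


section \<open>The vector field of a family and products of Lie derivatives\<close>

text \<open>The time dependent field \<open>\<xi>(t) = (d/dt \<phi>\<^sub>t) \<circ> \<phi>\<^sub>t\<inverse>\<close>: the derivation \<open>\<xi>(t)(x)\<close> is the velocity
  at \<open>s = t\<close> of the curve \<open>s \<mapsto> \<phi>\<^sub>s(\<phi>\<^sub>t\<inverse>(x))\<close>.\<close>

definition velocity_field :: "'a manifold \<Rightarrow> (real \<Rightarrow> 'a \<Rightarrow> 'a) \<Rightarrow> real \<Rightarrow> 'a vector_field" where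
  "velocity_field M \<phi> t x = (\<lambda>f. if analytic_fun_at M f x
     then deriv (\<lambda>s. f (\<phi> s (inv_into (topspace (mtop M)) (\<phi> t) x))) t else 0)"

definition velocity_coeff :: "'a manifold \<Rightarrow> (real \<Rightarrow> 'a \<Rightarrow> 'a) \<Rightarrow> nat \<Rightarrow> 'a vector_field" where
  "velocity_coeff M \<phi> k x = (\<lambda>f. (deriv ^^ k) (\<lambda>t. velocity_field M \<phi> t x f) 0 / fact k)"

definition scale_field :: "real \<Rightarrow> 'a vector_field \<Rightarrow> 'a vector_field" where
  "scale_field a \<eta> = (\<lambda>x f. a * \<eta> x f)"

definition compositions :: "nat \<Rightarrow> nat list set" where
  "compositions k = {l. (\<forall>m \<in> set l. 0 < m) \<and> sum_list l = k}"

lemma finite_compositions: "finite (compositions k)"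
proof (rule finite_subset)
  have "length l \<le> sum_list l" if "\<forall>m \<in> set l. 0 < m" for l :: "nat list"
    using that by (induction l) auto
  then show "compositions k \<subseteq> {l. set l \<subseteq> {..k} \<and> length l \<le> k}"
    using member_le_sum_list by (force simp: compositions_def)
qed (simp add: finite_lists_length_le)

text \<open>With list positions starting at \<open>0\<close>, the partial sum at position \<open>j\<close> includes entry \<open>j\<close>.
  The factor at position \<open>0\<close> is the outermost operator.\<close>

definition lie_product ::
    "'a manifold \<Rightarrow> (real \<Rightarrow> 'a \<Rightarrow> 'a) \<Rightarrow> nat list \<Rightarrow> 'a tensor_field \<Rightarrow> 'a tensor_field" where
  "lie_product M \<phi> l \<alpha> =
     foldr (\<lambda>j. lie_deriv M (scale_field (inverse (real (sum_list (take (Suc j) l))))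
                                         (velocity_coeff M \<phi> (l ! j - 1))))
       [0..<length l] \<alpha>"

end

theory Submission
  imports Defs
begin

text \<open>Fix a point \<open>x\<close> and put \<open>F(t) = (\<phi>\<^sub>t\<^sup>*\<alpha>)(x)\<close>. Differentiating the chart expression of the pullback gives
  \<open>d/dt \<phi>\<^sub>t\<^sup>*\<alpha> = \<phi>\<^sub>t\<^sup>* L\<^bsub>\<xi>(t)\<^esub> \<alpha>\<close>; since the left-hand side does not mention charts, this also shows that the
  coordinate formula for \<open>L\<^bsub>\<xi>(t)\<^esub> \<alpha>\<close>, and hence that for its Taylor coefficients \<open>L\<^bsub>\<xi>\<^sub>k\<^esub> \<alpha>\<close>, is the same in all charts.
  The function \<open>G(s, t) = (\<phi>\<^sub>t\<^sup>* L\<^bsub>\<xi>(s)\<^esub> \<alpha>)(x)\<close> is analytic in two variables, and \<open>F'(t) = G(t, t)\<close>. Comparing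
  coefficients, \<open>(k + 1) [t\<^bsup>k+1\<^esup>] \<phi>\<^sub>t\<^sup>*\<alpha> = \<Sum>\<^bsub>i\<le>k\<^esub> [t\<^bsup>k-i\<^esup>] \<phi>\<^sub>t\<^sup>* L\<^bsub>\<xi>\<^sub>i\<^esub> \<alpha>\<close>, which unfolds to the sum over compositions.
  Joint analyticity of \<open>\<xi>\<close> requires that of \<open>(t, y) \<mapsto> \<phi>\<^sub>t\<inverse>(y)\<close>, an inverse function theorem proved by a
  contraction in a Banach algebra of normally convergent power series.\<close>

section \<open>Normally convergent power series in several variables\<close>

text \<open>The order of the product and its weights reflect where
  \<open>\<phi>\<^sub>t\<^sup>*\<close> stands in the differential equation: it is applied after the
  Lie derivative. Each step of the recursion therefore lets a Lie derivative act directly on the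
  tensor field. That factor is the rightmost one, belongs to the last entry of the composition and
  carries the full sum \<open>k + 1\<close>; the coefficient of lower degree supplies the factors
  before it. The recursion can be repeated only if the Lie derivative is again an analytic tensor
  field. Here lies an obstacle: \<open>lie_deriv\<close> selects a chart at every point separately,
  so nothing is known about its components near a point before the formula is known to agree in all
  charts. The other obstacle is that an automorphism has an analytic inverse only for each fixed
  \<open>t\<close>. Joint analyticity is needed near \<open>t = 0\<close> alone, where
  \<open>\<phi>\<^sub>0 = id\<close> makes the equation for the inverse a small perturbation of the
  identity. Weighted l1 norms of coefficients are submultiplicative, which reduces composition and
  contraction of series to estimates of numbers.\<close>

definition multi_idx :: "nat \<Rightarrow> (nat \<Rightarrow> nat) set" where
  "multi_idx n = {m. \<forall>i\<ge>n. m i = 0}"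

definition mdeg :: "nat \<Rightarrow> (nat \<Rightarrow> nat) \<Rightarrow> nat" where
  "mdeg n m = (\<Sum>i<n. m i)"

definition mpow :: "nat \<Rightarrow> (nat \<Rightarrow> real) \<Rightarrow> (nat \<Rightarrow> nat) \<Rightarrow> real" where
  "mpow n u m = (\<Prod>i<n. u i ^ m i)"

definition cube :: "nat \<Rightarrow> (nat \<Rightarrow> real) \<Rightarrow> real \<Rightarrow> (nat \<Rightarrow> real) set" where
  "cube n a r = {z. (\<forall>i\<ge>n. z i = 0) \<and> (\<forall>i<n. \<bar>z i - a i\<bar> \<le> r)}"

text \<open>The norm is the weighted l1 norm of the coefficients at radius \<open>r\<close>; it
  dominates the supremum on the closed cube. Only an upper bound \<open>N\<close> is recorded, so no
  canonical choice of coefficients has to be made.\<close>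

definition bseries :: "nat \<Rightarrow> (nat \<Rightarrow> real) \<Rightarrow> real \<Rightarrow> real \<Rightarrow> ((nat \<Rightarrow> real) \<Rightarrow> real) \<Rightarrow> bool" where
  "bseries n a r N g \<longleftrightarrow> r > 0 \<and> (\<exists>c.
     (\<lambda>m. \<bar>c m\<bar> * r ^ mdeg n m) summable_on multi_idx n \<and>
     infsum (\<lambda>m. \<bar>c m\<bar> * r ^ mdeg n m) (multi_idx n) \<le> N \<and>
     (\<forall>z \<in> cube n a r. ((\<lambda>m. c m * mpow n (\<lambda>i. z i - a i) m) has_sum g z) (multi_idx n)))"

lemma bseries_pos: "bseries n a r N g \<Longrightarrow> r > 0"
  by (simp add: bseries_def)

lemma bseriesE:
  assumes "bseries n a r N g"
  obtains c where "(\<lambda>m. \<bar>c m\<bar> * r ^ mdeg n m) summable_on multi_idx n"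
     "infsum (\<lambda>m. \<bar>c m\<bar> * r ^ mdeg n m) (multi_idx n) \<le> N"
     "\<And>z. z \<in> cube n a r \<Longrightarrow> ((\<lambda>m. c m * mpow n (\<lambda>i. z i - a i) m) has_sum g z) (multi_idx n)"
  using assms unfolding bseries_def by blast

lemma bseriesI:
  assumes "r > 0" "(\<lambda>m. \<bar>c m\<bar> * r ^ mdeg n m) summable_on multi_idx n"
     "infsum (\<lambda>m. \<bar>c m\<bar> * r ^ mdeg n m) (multi_idx n) \<le> N"
     "\<And>z. z \<in> cube n a r \<Longrightarrow> ((\<lambda>m. c m * mpow n (\<lambda>i. z i - a i) m) has_sum g z) (multi_idx n)"
  shows "bseries n a r N g"
  unfolding bseries_def using assms by blast

lemma mpow_le:
  assumes "\<And>i. i < n \<Longrightarrow> \<bar>u i\<bar> \<le> r"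
  shows "\<bar>mpow n u m\<bar> \<le> r ^ mdeg n m"
proof -
  have "\<bar>mpow n u m\<bar> = (\<Prod>i<n. \<bar>u i\<bar> ^ m i)"
    by (simp add: mpow_def abs_prod power_abs)
  also have "\<dots> \<le> (\<Prod>i<n. r ^ m i)"
    using assms by (intro prod_mono) (auto intro: power_mono)
  finally show ?thesis by (simp add: mdeg_def power_sum)
qed

lemma mpow_add: "mpow n u (\<lambda>i. m i + m' i) = mpow n u m * mpow n u m'"
  by (simp add: mpow_def power_add prod.distrib)

lemma mdeg_add: "mdeg n (\<lambda>i. m i + m' i) = mdeg n m + mdeg n m'"
  by (simp add: mdeg_def sum.distrib)

section \<open>Regrouping, completeness and multiplication of normally convergent series\<close>

lemma summable_on_bounded_real:
  fixes f g :: "'b \<Rightarrow> real"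
  assumes "g summable_on A" "\<And>x. x \<in> A \<Longrightarrow> \<bar>f x\<bar> \<le> g x"
  shows "f summable_on A"
proof -
  have "(\<lambda>x. norm (f x)) summable_on A"
    by (rule summable_on_comparison_test[OF assms(1)]) (use assms(2) in auto)
  then show ?thesis by (rule abs_summable_summable)
qed

lemma abs_infsum_le:
  fixes f g :: "'b \<Rightarrow> real"
  assumes "g summable_on A" "\<And>x. x \<in> A \<Longrightarrow> \<bar>f x\<bar> \<le> g x"
  shows "\<bar>infsum f A\<bar> \<le> infsum g A"
proof -
  have "f summable_on A" using assms by (rule summable_on_bounded_real)
  then have "norm (infsum f A) \<le> infsum g A"
    by (rule norm_infsum_le[OF has_sum_infsum has_sum_infsum[OF assms(1)]]) (simp add: assms(2))
  then show ?thesis by simp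
qed

text \<open>Several indices may carry the same exponent. Fibring \<open>K\<close> over the exponents
  and summing each fibre first produces the coefficients of a power series, and the triangle
  inequality in each fibre keeps the norm below the sum \<open>S\<close> of the whole family. Most
  constructions of new series go through this lemma.\<close>

lemma bseries_regroup:
  fixes e :: "'k \<Rightarrow> nat \<Rightarrow> nat"
  assumes r: "r > 0" and e: "\<And>k. k \<in> K \<Longrightarrow> e k \<in> multi_idx n"
    and S: "((\<lambda>k. \<bar>c k\<bar> * r ^ mdeg n (e k)) has_sum S) K" and SN: "S \<le> N"
    and g: "\<And>z. z \<in> cube n a r \<Longrightarrow> ((\<lambda>k. c k * mpow n (\<lambda>i. z i - a i) (e k)) has_sum g z) K"
  shows "bseries n a r N g"
proof -
  define K' where "K' = Sigma (multi_idx n) (\<lambda>m. {k \<in> K. e k = m})"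
  have bij: "bij_betw snd K' K"
    by (auto simp: K'_def bij_betw_def inj_on_def image_iff e)
  have reindex: "((\<lambda>(m, k). f k m) has_sum s) K'" if "((\<lambda>k. f k (e k)) has_sum s) K"
    for f :: "'k \<Rightarrow> _ \<Rightarrow> real" and s
  proof -
    have "((\<lambda>x. f (snd x) (e (snd x))) has_sum s) K'"
      using has_sum_reindex_bij_betw[OF bij, of "\<lambda>k. f k (e k)"] that by simp
    then show ?thesis
      by (rule has_sum_cong[THEN iffD1, rotated]) (auto simp: K'_def)
  qed
  define C where "C m = infsum c {k \<in> K. e k = m}" for m
  define D where "D m = infsum (\<lambda>k. \<bar>c k\<bar>) {k \<in> K. e k = m}" for m
  have S': "((\<lambda>(m, k). \<bar>c k\<bar> * r ^ mdeg n m) has_sum S) K'"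
    using reindex[of "\<lambda>k m. \<bar>c k\<bar> * r ^ mdeg n m"] S by simp
  have absc: "(\<lambda>k. \<bar>c k\<bar>) summable_on {k \<in> K. e k = m}" for m
  proof (cases "m \<in> multi_idx n")
    case True
    have "(\<lambda>k. \<bar>c k\<bar> * r ^ mdeg n m) summable_on {k \<in> K. e k = m}"
      using summable_on_SigmaD1[of "\<lambda>m k. \<bar>c k\<bar> * r ^ mdeg n m" "multi_idx n" "\<lambda>m. {k \<in> K. e k = m}" m]
        S' True by (auto simp: K'_def summable_on_def)
    then show ?thesis using r by (simp add: summable_on_cmult_left')
  next
    case False
    then have "{k \<in> K. e k = m} = {}" using e by auto
    then show ?thesis by (simp only: summable_on_empty)
  qed
  have c_sum: "c summable_on {k \<in> K. e k = m}" for m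
    using absc[of m] by (rule summable_on_bounded_real) auto
  have CD: "\<bar>C m\<bar> \<le> D m" for m
    unfolding C_def D_def by (rule abs_infsum_le[OF absc]) auto
  have D: "((\<lambda>m. D m * r ^ mdeg n m) has_sum S) (multi_idx n)"
    unfolding D_def
  proof (rule has_sum_SigmaD[OF S'[unfolded K'_def]])
    fix m assume "m \<in> multi_idx n"
    show "((\<lambda>k. case (m, k) of (m, k) \<Rightarrow> \<bar>c k\<bar> * r ^ mdeg n m) has_sum
        (\<Sum>\<^sub>\<infinity>k\<in>{k \<in> K. e k = m}. \<bar>c k\<bar>) * r ^ mdeg n m) {k \<in> K. e k = m}"
      using absc[of m] by (simp add: has_sum_cmult_left)
  qed
  have Csum: "(\<lambda>m. \<bar>C m\<bar> * r ^ mdeg n m) summable_on multi_idx n"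
    by (rule summable_on_bounded_real[OF has_sum_imp_summable[OF D]])
       (use CD r in \<open>auto intro!: mult_right_mono simp: abs_mult\<close>)
  have "infsum (\<lambda>m. \<bar>C m\<bar> * r ^ mdeg n m) (multi_idx n) \<le> infsum (\<lambda>m. D m * r ^ mdeg n m) (multi_idx n)"
    by (rule infsum_mono[OF Csum has_sum_imp_summable[OF D]]) (use CD r in \<open>auto intro!: mult_right_mono\<close>)
  also have "\<dots> = S" using D by (rule infsumI)
  finally have Cle: "infsum (\<lambda>m. \<bar>C m\<bar> * r ^ mdeg n m) (multi_idx n) \<le> N" using SN by simp
  have "((\<lambda>m. C m * mpow n (\<lambda>i. z i - a i) m) has_sum g z) (multi_idx n)" if z: "z \<in> cube n a r" for z
    unfolding C_def
  proof (rule has_sum_SigmaD)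
    show "((\<lambda>(m, k). c k * mpow n (\<lambda>i. z i - a i) m) has_sum g z)
        (Sigma (multi_idx n) (\<lambda>m. {k \<in> K. e k = m}))"
      using reindex[of "\<lambda>k m. c k * mpow n (\<lambda>i. z i - a i) m"] g[OF z] by (simp add: K'_def)
    fix m assume "m \<in> multi_idx n"
    show "((\<lambda>k. case (m, k) of (m, k) \<Rightarrow> c k * mpow n (\<lambda>i. z i - a i) m) has_sum
        infsum c {k \<in> K. e k = m} * mpow n (\<lambda>i. z i - a i) m) {k \<in> K. e k = m}"
      using c_sum[of m] by (simp add: has_sum_cmult_left)
  qed
  then show ?thesis using r Csum Cle by (intro bseriesI)
qed

lemma bseries_cong:
  assumes "bseries n a r N g" "\<And>z. z \<in> cube n a r \<Longrightarrow> g z = g' z"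
  shows "bseries n a r N g'"
proof -
  obtain c where c: "(\<lambda>m. \<bar>c m\<bar> * r ^ mdeg n m) summable_on multi_idx n"
     "infsum (\<lambda>m. \<bar>c m\<bar> * r ^ mdeg n m) (multi_idx n) \<le> N"
     "\<And>z. z \<in> cube n a r \<Longrightarrow> ((\<lambda>m. c m * mpow n (\<lambda>i. z i - a i) m) has_sum g z) (multi_idx n)"
    using assms(1) by (rule bseriesE) (rule that)
  show ?thesis
    by (rule bseriesI[OF bseries_pos[OF assms(1)] c(1,2)]) (simp add: c(3) assms(2)[symmetric])
qed

lemma bseries_mono:
  assumes "bseries n a r N g" "N \<le> N'"
  shows "bseries n a r N' g"
proof -
  obtain c where c: "(\<lambda>m. \<bar>c m\<bar> * r ^ mdeg n m) summable_on multi_idx n"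
     "infsum (\<lambda>m. \<bar>c m\<bar> * r ^ mdeg n m) (multi_idx n) \<le> N"
     "\<And>z. z \<in> cube n a r \<Longrightarrow> ((\<lambda>m. c m * mpow n (\<lambda>i. z i - a i) m) has_sum g z) (multi_idx n)"
    using assms(1) by (rule bseriesE) (rule that)
  show ?thesis
    by (rule bseriesI[OF bseries_pos[OF assms(1)] c(1) order_trans[OF c(2) assms(2)] c(3)])
qed

lemma bseries_abs_le:
  assumes "bseries n a r N g" "z \<in> cube n a r"
  shows "\<bar>g z\<bar> \<le> N"
proof -
  obtain c where c: "(\<lambda>m. \<bar>c m\<bar> * r ^ mdeg n m) summable_on multi_idx n"
     "infsum (\<lambda>m. \<bar>c m\<bar> * r ^ mdeg n m) (multi_idx n) \<le> N"
     "\<And>z. z \<in> cube n a r \<Longrightarrow> ((\<lambda>m. c m * mpow n (\<lambda>i. z i - a i) m) has_sum g z) (multi_idx n)"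
    using assms(1) by (rule bseriesE) (rule that)
  have "\<bar>infsum (\<lambda>m. c m * mpow n (\<lambda>i. z i - a i) m) (multi_idx n)\<bar>
     \<le> infsum (\<lambda>m. \<bar>c m\<bar> * r ^ mdeg n m) (multi_idx n)"
    using c(1)
  proof (rule abs_infsum_le)
    fix m
    show "\<bar>c m * mpow n (\<lambda>i. z i - a i) m\<bar> \<le> \<bar>c m\<bar> * r ^ mdeg n m"
      using mpow_le[of n "\<lambda>i. z i - a i" r m] assms(2)
      by (auto simp: abs_mult cube_def intro!: mult_left_mono)
  qed
  with c(2) show ?thesis by (simp add: infsumI[OF c(3)[OF assms(2)]])
qed

text \<open>Completeness: if the norm bounds \<open>N k\<close> are summable, the coefficients of
  all \<open>g k\<close> together form one absolutely summable family over
  \<open>A \<times> multi_idx n\<close>, which is then regrouped by exponent.\<close>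

lemma bseries_has_sum:
  fixes g :: "'k \<Rightarrow> (nat \<Rightarrow> real) \<Rightarrow> real"
  assumes r: "r > 0" and g: "\<And>k. k \<in> A \<Longrightarrow> bseries n a r (N k) (g k)"
    and N: "(N has_sum S) A"
    and f: "\<And>z. z \<in> cube n a r \<Longrightarrow> ((\<lambda>k. g k z) has_sum f z) A"
  shows "bseries n a r S f"
proof -
  define P where "P k c \<longleftrightarrow> (\<lambda>m. \<bar>c m\<bar> * r ^ mdeg n m) summable_on multi_idx n \<and>
     infsum (\<lambda>m. \<bar>c m\<bar> * r ^ mdeg n m) (multi_idx n) \<le> N k \<and>
     (\<forall>z \<in> cube n a r. ((\<lambda>m. c m * mpow n (\<lambda>i. z i - a i) m) has_sum g k z) (multi_idx n))" for k c
  have "\<exists>c. P k c" if "k \<in> A" for k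
    using g[OF that] by (simp add: bseries_def P_def)
  then obtain c where P: "\<forall>k\<in>A. P k (c k)" using bchoice[of A P] by blast
  have c: "(\<lambda>m. \<bar>c k m\<bar> * r ^ mdeg n m) summable_on multi_idx n"
     "infsum (\<lambda>m. \<bar>c k m\<bar> * r ^ mdeg n m) (multi_idx n) \<le> N k"
     "z \<in> cube n a r \<Longrightarrow> ((\<lambda>m. c k m * mpow n (\<lambda>i. z i - a i) m) has_sum g k z) (multi_idx n)"
    if "k \<in> A" for k z
    using P that by (simp_all add: P_def)
  define R where "R k = infsum (\<lambda>m. \<bar>c k m\<bar> * r ^ mdeg n m) (multi_idx n)" for k
  have R0: "R k \<ge> 0" for k unfolding R_def using r by (intro infsum_nonneg) auto
  have Rs: "R summable_on A"
    by (rule summable_on_bounded_real[OF has_sum_imp_summable[OF N]]) (use c(2) R0 in \<open>auto simp: R_def\<close>)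
  have Rle: "infsum R A \<le> S"
    using infsum_mono[OF Rs has_sum_imp_summable[OF N]] c(2) infsumI[OF N] by (auto simp: R_def)
  define h where "h x = (case x of (k, m) \<Rightarrow> \<bar>c k m\<bar> * r ^ mdeg n m)" for x
  have h1: "((\<lambda>m. h (k, m)) has_sum R k) (multi_idx n)" if "k \<in> A" for k
    using c(1)[OF that] by (auto simp: h_def R_def)
  have hs: "h summable_on (A \<times> multi_idx n)"
    by (rule summable_on_SigmaI[OF h1 Rs]) (use r in \<open>auto simp: h_def\<close>)
  have hsum: "(h has_sum infsum R A) (A \<times> multi_idx n)"
    by (rule has_sum_SigmaI[OF h1 _ hs]) (use Rs in auto)
  show ?thesis
  proof (rule bseries_regroup[where K = "A \<times> multi_idx n" and e = snd and c = "\<lambda>(k, m). c k m" and S = "infsum R A"])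
    show "((\<lambda>k. \<bar>case k of (k, m) \<Rightarrow> c k m\<bar> * r ^ mdeg n (snd k)) has_sum infsum R A) (A \<times> multi_idx n)"
      by (rule has_sum_cong[THEN iffD1, OF _ hsum]) (auto simp: h_def)
    fix z assume z: "z \<in> cube n a r"
    let ?t = "\<lambda>k. (case k of (k, m) \<Rightarrow> c k m) * mpow n (\<lambda>i. z i - a i) (snd k)"
    have ts: "?t summable_on (A \<times> multi_idx n)"
    proof (rule summable_on_bounded_real[OF hs])
      fix x :: "'k \<times> (nat \<Rightarrow> nat)"
      obtain k m where x: "x = (k, m)" by (cases x)
      show "\<bar>?t x\<bar> \<le> h x"
        using mpow_le[of n "\<lambda>i. z i - a i" r m] z
        by (auto simp: abs_mult cube_def h_def x intro!: mult_left_mono)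
    qed
    show "(?t has_sum f z) (A \<times> multi_idx n)"
      by (rule has_sum_SigmaI[OF _ f[OF z] ts]) (use c(3) z in auto)
  qed (use r Rle in \<open>auto\<close>)
qed

lemma bseries_const: "r > 0 \<Longrightarrow> \<bar>b\<bar> \<le> N \<Longrightarrow> bseries n a r N (\<lambda>_. b)"
  by (rule bseries_regroup[where K = "{()}" and e = "\<lambda>_ _. 0" and c = "\<lambda>_. b" and S = "\<bar>b\<bar>"])
     (auto simp: multi_idx_def mdeg_def mpow_def intro: has_sum_finiteI)

lemma bseries_coord0:
  assumes "r > 0" "j < n"
  shows "bseries n a r r (\<lambda>z. z j - a j)"
proof -
  have [simp]: "(if i = j then Suc 0 else 0) = 0 \<longleftrightarrow> i \<noteq> j" for i by auto
  have "mpow n u ((\<lambda>_. 0)(j := 1)) = u j" for u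
    using assms(2) prod.delta[of "{..<n}" j "\<lambda>i. u i"]
    by (simp add: mpow_def fun_upd_def if_distrib[where f="\<lambda>k. _ ^ k"] cong: if_cong)
  moreover have "mdeg n ((\<lambda>_. 0)(j := 1)) = 1"
    using assms(2) by (simp add: mdeg_def fun_upd_def)
  ultimately show ?thesis using assms
    by (intro bseries_regroup[where K = "{()}" and e = "\<lambda>_. (\<lambda>_. 0)(j := 1)" and c = "\<lambda>_. 1" and S = r])
       (auto simp: multi_idx_def intro!: has_sum_finiteI)
qed

lemma bseries_add:
  assumes "bseries n a r N f" "bseries n a r N' g"
  shows "bseries n a r (N + N') (\<lambda>z. f z + g z)"
proof (rule bseries_has_sum[where A = "{True, False}" and N = "\<lambda>b. if b then N else N'"
    and g = "\<lambda>b. if b then f else g"])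
  show "r > 0" using assms(1) by (rule bseries_pos)
qed (use assms in \<open>auto intro!: has_sum_finiteI\<close>)

lemma bseries_cmult:
  assumes "bseries n a r N f"
  shows "bseries n a r (\<bar>b\<bar> * N) (\<lambda>z. b * f z)"
proof -
  obtain c where c: "(\<lambda>m. \<bar>c m\<bar> * r ^ mdeg n m) summable_on multi_idx n"
     "infsum (\<lambda>m. \<bar>c m\<bar> * r ^ mdeg n m) (multi_idx n) \<le> N"
     "\<And>z. z \<in> cube n a r \<Longrightarrow> ((\<lambda>m. c m * mpow n (\<lambda>i. z i - a i) m) has_sum f z) (multi_idx n)"
    using assms by (rule bseriesE) (rule that)
  have "((\<lambda>m. \<bar>b\<bar> * (\<bar>c m\<bar> * r ^ mdeg n m)) has_sum \<bar>b\<bar> * infsum (\<lambda>m. \<bar>c m\<bar> * r ^ mdeg n m) (multi_idx n)) (multi_idx n)"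
    using c(1) by (intro has_sum_cmult_right) auto
  moreover have "((\<lambda>m. b * (c m * mpow n (\<lambda>i. z i - a i) m)) has_sum b * f z) (multi_idx n)"
    if "z \<in> cube n a r" for z
    using c(3)[OF that] by (intro has_sum_cmult_right) auto
  ultimately show ?thesis using bseries_pos[OF assms] c(2)
    by (intro bseries_regroup[where K = "multi_idx n" and e = "\<lambda>m. m" and c = "\<lambda>m. b * c m"])
       (auto simp: abs_mult mult.assoc mult_left_mono)
qed

text \<open>The Cauchy product is not written out. Multiplying \<open>g\<close> by a single monomial
  merely shifts its exponents, and \<open>f\<close> is a normally convergent sum of monomials, so
  completeness does the rest.\<close>

lemma bseries_mult:
  assumes f: "bseries n a r N f" and g: "bseries n a r N' g"
  shows "bseries n a r (N * N') (\<lambda>z. f z * g z)"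
proof -
  have r: "r > 0" using f by (rule bseries_pos)
  obtain c where c: "(\<lambda>m. \<bar>c m\<bar> * r ^ mdeg n m) summable_on multi_idx n"
     "infsum (\<lambda>m. \<bar>c m\<bar> * r ^ mdeg n m) (multi_idx n) \<le> N"
     "\<And>z. z \<in> cube n a r \<Longrightarrow> ((\<lambda>m. c m * mpow n (\<lambda>i. z i - a i) m) has_sum f z) (multi_idx n)"
    using f by (rule bseriesE) (rule that)
  define S where "S = infsum (\<lambda>m. \<bar>c m\<bar> * r ^ mdeg n m) (multi_idx n)"
  \<comment> \<open>Evaluation at the centre gives the sign of the bound. The centre is truncated
    because \<open>a\<close> is not assumed to vanish from index \<open>n\<close> on.\<close>
  have N': "N' \<ge> 0"
    using bseries_abs_le[OF g, of "\<lambda>i. if i < n then a i else 0"] r by (auto simp: cube_def)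
  have mon: "bseries n a r (r ^ mdeg n m) (\<lambda>z. mpow n (\<lambda>i. z i - a i) m)" if "m \<in> multi_idx n" for m
    using that r by (intro bseries_regroup[where K = "{()}" and e = "\<lambda>_. m" and c = "\<lambda>_. 1" and S = "r ^ mdeg n m"])
       (auto intro!: has_sum_finiteI)
  have shift: "bseries n a r (r ^ mdeg n m * N') (\<lambda>z. mpow n (\<lambda>i. z i - a i) m * g z)"
    if m: "m \<in> multi_idx n" for m
  proof -
    obtain d where d: "(\<lambda>m. \<bar>d m\<bar> * r ^ mdeg n m) summable_on multi_idx n"
       "infsum (\<lambda>m. \<bar>d m\<bar> * r ^ mdeg n m) (multi_idx n) \<le> N'"
       "\<And>z. z \<in> cube n a r \<Longrightarrow> ((\<lambda>m. d m * mpow n (\<lambda>i. z i - a i) m) has_sum g z) (multi_idx n)"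
      using g by (rule bseriesE) (rule that)
    have "((\<lambda>k. r ^ mdeg n m * (\<bar>d k\<bar> * r ^ mdeg n k)) has_sum
        r ^ mdeg n m * infsum (\<lambda>m. \<bar>d m\<bar> * r ^ mdeg n m) (multi_idx n)) (multi_idx n)"
      using d(1) by (intro has_sum_cmult_right) auto
    moreover have "((\<lambda>k. mpow n (\<lambda>i. z i - a i) m * (d k * mpow n (\<lambda>i. z i - a i) k)) has_sum
        mpow n (\<lambda>i. z i - a i) m * g z) (multi_idx n)" if "z \<in> cube n a r" for z
      using d(3)[OF that] by (intro has_sum_cmult_right) auto
    ultimately show ?thesis using r d(2) m
      by (intro bseries_regroup[where K = "multi_idx n" and e = "\<lambda>k i. m i + k i" and c = d])
         (auto simp: multi_idx_def mdeg_add mpow_add power_add mult_ac)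
  qed
  have "bseries n a r (S * N') (\<lambda>z. f z * g z)"
  proof (rule bseries_has_sum[OF r, where A = "multi_idx n"])
    fix m assume "m \<in> multi_idx n"
    from bseries_cmult[OF shift[OF this], of "c m"]
    show "bseries n a r ((\<bar>c m\<bar> * r ^ mdeg n m) * N') (\<lambda>z. (c m * mpow n (\<lambda>i. z i - a i) m) * g z)"
      by (simp add: mult.assoc)
  next
    show "((\<lambda>m. (\<bar>c m\<bar> * r ^ mdeg n m) * N') has_sum S * N') (multi_idx n)"
      unfolding S_def using c(1) by (intro has_sum_cmult_left) auto
    fix z assume "z \<in> cube n a r"
    from c(3)[OF this] show "((\<lambda>m. (c m * mpow n (\<lambda>i. z i - a i) m) * g z) has_sum f z * g z) (multi_idx n)"
      by (intro has_sum_cmult_left)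
  qed
  then show ?thesis by (rule bseries_mono) (use c(2) N' in \<open>simp add: S_def mult_right_mono\<close>)
qed

lemma bseries_diff:
  assumes "bseries n a r N f" "bseries n a r N' g"
  shows "bseries n a r (N + N') (\<lambda>z. f z - g z)"
  using bseries_add[OF assms(1) bseries_cmult[OF assms(2), of "-1"]] by simp

lemma bseries_power:
  assumes "bseries n a r N f"
  shows "bseries n a r (N ^ k) (\<lambda>z. f z ^ k)"
proof (induction k)
  case 0
  show ?case using bseries_const[OF bseries_pos[OF assms], of 1 1] by simp
next
  case (Suc k)
  then show ?case using bseries_mult[OF assms Suc] by simp
qed

lemma bseries_prod:
  assumes "r > 0" "finite A" "\<And>k. k \<in> A \<Longrightarrow> bseries n a r (N k) (f k)"
  shows "bseries n a r (prod N A) (\<lambda>z. \<Prod>k\<in>A. f k z)"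
  using assms(2,3)
proof (induction A)
  case empty
  show ?case using bseries_const[OF assms(1), of 1 1] by simp
next
  case (insert k A)
  then show ?case using bseries_mult[of n a r "N k" "f k" "prod N A" "\<lambda>z. \<Prod>k\<in>A. f k z"] by simp
qed

lemma bseries_sum:
  assumes "r > 0" "finite A" "\<And>k. k \<in> A \<Longrightarrow> bseries n a r (N k) (f k)"
  shows "bseries n a r (sum N A) (\<lambda>z. \<Sum>k\<in>A. f k z)"
  using assms(2,3)
proof (induction A)
  case empty
  show ?case using bseries_const[OF assms(1), of 0 0] by simp
next
  case (insert k A)
  then show ?case using bseries_add[of n a r "N k" "f k" "sum N A" "\<lambda>z. \<Sum>k\<in>A. f k z"] by simp
qed

text \<open>Norms being submultiplicative, the power series of the outer function may be evaluated at
  functions instead of numbers.\<close>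

lemma bseries_compose:
  assumes g: "bseries k b \<rho> N g"
    and f: "\<And>j. j < k \<Longrightarrow> bseries n a r \<rho> (\<lambda>z. f z j - b j)"
    and f0: "\<And>z j. z \<in> cube n a r \<Longrightarrow> j \<ge> k \<Longrightarrow> f z j = 0" and r: "r > 0"
  shows "bseries n a r N (\<lambda>z. g (f z))"
proof -
  obtain c where c: "(\<lambda>m. \<bar>c m\<bar> * \<rho> ^ mdeg k m) summable_on multi_idx k"
     "infsum (\<lambda>m. \<bar>c m\<bar> * \<rho> ^ mdeg k m) (multi_idx k) \<le> N"
     "\<And>z. z \<in> cube k b \<rho> \<Longrightarrow> ((\<lambda>m. c m * mpow k (\<lambda>i. z i - b i) m) has_sum g z) (multi_idx k)"
    using g by (rule bseriesE) (rule that)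
  have fz: "f z \<in> cube k b \<rho>" if "z \<in> cube n a r" for z
    using f0[OF that] bseries_abs_le[OF f that] by (auto simp: cube_def)
  have "bseries n a r (infsum (\<lambda>m. \<bar>c m\<bar> * \<rho> ^ mdeg k m) (multi_idx k)) (\<lambda>z. g (f z))"
  proof (rule bseries_has_sum[OF r, where A = "multi_idx k"])
    fix m assume "m \<in> multi_idx k"
    have "bseries n a r (\<Prod>i<k. \<rho> ^ m i) (\<lambda>z. \<Prod>i<k. (f z i - b i) ^ m i)"
      by (rule bseries_prod[OF r]) (auto intro: bseries_power f)
    then have "bseries n a r (\<rho> ^ mdeg k m) (\<lambda>z. mpow k (\<lambda>i. f z i - b i) m)"
      by (simp add: mpow_def mdeg_def power_sum)
    from bseries_cmult[OF this, of "c m"]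
    show "bseries n a r (\<bar>c m\<bar> * \<rho> ^ mdeg k m) (\<lambda>z. c m * mpow k (\<lambda>i. f z i - b i) m)" .
  next
    fix z assume "z \<in> cube n a r"
    from c(3)[OF fz[OF this]]
    show "((\<lambda>m. c m * mpow k (\<lambda>i. f z i - b i) m) has_sum g (f z)) (multi_idx k)" .
  qed (use c(1) in auto)
  then show ?thesis using c(2) by (rule bseries_mono)
qed

section \<open>Change of centre and radius\<close>

lemma bseries_coord:
  assumes "r > 0" "j < n" "\<bar>a j - b\<bar> + r \<le> N"
  shows "bseries n a r N (\<lambda>z. z j - b)"
proof -
  have "bseries n a r (r + \<bar>a j - b\<bar>) (\<lambda>z. (z j - a j) + (a j - b))"
    using assms by (intro bseries_add bseries_coord0 bseries_const) auto
  then have "bseries n a r (r + \<bar>a j - b\<bar>) (\<lambda>z. z j - b)" by simp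
  then show ?thesis by (rule bseries_mono) (use assms(3) in simp)
qed

text \<open>Recentring is a composition: seen from the new centre, the function
  \<open>z i - a i\<close> has norm at most \<open>\<bar>b i - a i\<bar> + s\<close>.\<close>

lemma bseries_translate:
  assumes "bseries n a r N g" "s > 0" "\<And>i. i < n \<Longrightarrow> \<bar>b i - a i\<bar> + s \<le> r"
  shows "bseries n b s N g"
proof -
  have "bseries n b s N (\<lambda>z. g (\<lambda>i. if i < n then z i else 0))"
    by (rule bseries_compose[OF assms(1)]) (use assms in \<open>auto intro!: bseries_coord\<close>)
  then show ?thesis
  proof (rule bseries_cong)
    fix z assume "z \<in> cube n b s"
    then have "(\<lambda>i. if i < n then z i else 0) = z" by (auto simp: cube_def fun_eq_iff)
    then show "g (\<lambda>i. if i < n then z i else 0) = g z" by (simp only:)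
  qed
qed

lemma bseries_radius_mono:
  assumes "bseries n a r N g" "0 < s" "s \<le> r"
  shows "bseries n a s N g"
  by (rule bseries_translate[OF assms(1,2)]) (use assms(3) in auto)

text \<open>A quantitative Schwarz lemma. Without a constant term every monomial has degree at least
  1 and loses a factor of at least \<open>s / r\<close> when the radius shrinks from
  \<open>r\<close> to \<open>s\<close>.\<close>

lemma bseries_shrink0:
  assumes g: "bseries n a r N g" and s: "0 < s" "s \<le> r"
    and a: "\<And>i. i \<ge> n \<Longrightarrow> a i = 0" and g0: "g a = 0"
  shows "bseries n a s (N * (s / r)) g"
proof -
  have r: "r > 0" using g by (rule bseries_pos)
  obtain c where c: "(\<lambda>m. \<bar>c m\<bar> * r ^ mdeg n m) summable_on multi_idx n"
     "infsum (\<lambda>m. \<bar>c m\<bar> * r ^ mdeg n m) (multi_idx n) \<le> N"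
     "\<And>z. z \<in> cube n a r \<Longrightarrow> ((\<lambda>m. c m * mpow n (\<lambda>i. z i - a i) m) has_sum g z) (multi_idx n)"
    using g by (rule bseriesE) (rule that)
  have acube: "a \<in> cube n a r" using a r by (auto simp: cube_def)
  define K where "K = multi_idx n - {\<lambda>_. 0}"
  have K: "K \<subseteq> multi_idx n" by (auto simp: K_def)
  have deg: "mdeg n m > 0" if m: "m \<in> K" for m
  proof -
    obtain i where i: "m i \<noteq> 0" using m by (auto simp: K_def fun_eq_iff)
    then have "i < n" using m by (cases "i < n") (auto simp: K_def multi_idx_def)
    then have "m i \<le> mdeg n m" unfolding mdeg_def by (intro member_le_sum) auto
    then show ?thesis using i by simp
  qed
  \<comment> \<open>\<open>mpow_le\<close> with radius 0 bounds the monomial by a positive power of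
    0.\<close>
  have zero: "mpow n (\<lambda>i. a i - a i) m = 0" if "m \<in> K" for m
    using mpow_le[of n "\<lambda>i. a i - a i" 0 m] deg[OF that] by (simp add: power_0_left)
  have c0: "c (\<lambda>_. 0) = 0"
  proof -
    have "((\<lambda>m. c m * mpow n (\<lambda>i. a i - a i) m) has_sum c (\<lambda>_. 0)) {\<lambda>_. 0}"
      by (rule has_sum_finiteI) (auto simp: mpow_def)
    then have "((\<lambda>m. c m * mpow n (\<lambda>i. a i - a i) m) has_sum c (\<lambda>_. 0)) (multi_idx n)"
      by (rule has_sum_cong_neutral[THEN iffD1, rotated -1])
         (use zero in \<open>auto simp: K_def multi_idx_def\<close>)
    then show ?thesis using c(3)[OF acube] g0 has_sum_unique by metis
  qed
  have sr: "0 \<le> s / r" "s / r \<le> 1" using s r by auto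
  have cb: "\<bar>c m\<bar> * s ^ mdeg n m \<le> (\<bar>c m\<bar> * r ^ mdeg n m) * (s / r)" if "m \<in> K" for m
  proof -
    have "s ^ mdeg n m = r ^ mdeg n m * (s / r) ^ mdeg n m"
      using r by (simp add: power_divide)
    also have "(s / r) ^ mdeg n m \<le> (s / r) ^ 1"
      using sr deg[OF that] by (intro power_decreasing) auto
    finally have "s ^ mdeg n m \<le> r ^ mdeg n m * (s / r)"
      using r by (simp add: mult_left_mono)
    then have "\<bar>c m\<bar> * s ^ mdeg n m \<le> \<bar>c m\<bar> * (r ^ mdeg n m * (s / r))"
      by (rule mult_left_mono) simp
    then show ?thesis by (simp only: mult.assoc)
  qed
  have cK: "(\<lambda>m. \<bar>c m\<bar> * r ^ mdeg n m) summable_on K"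
    using c(1) K by (rule summable_on_subset_banach)
  then have cK': "(\<lambda>m. (\<bar>c m\<bar> * r ^ mdeg n m) * (s / r)) summable_on K"
    by (intro summable_on_cmult_left)
  have sK: "(\<lambda>m. \<bar>c m\<bar> * s ^ mdeg n m) summable_on K"
    by (rule summable_on_bounded_real[OF cK']) (use cb s in auto)
  have "infsum (\<lambda>m. \<bar>c m\<bar> * s ^ mdeg n m) K \<le> infsum (\<lambda>m. (\<bar>c m\<bar> * r ^ mdeg n m) * (s / r)) K"
    by (rule infsum_mono[OF sK cK']) (use cb in auto)
  also have "\<dots> = infsum (\<lambda>m. \<bar>c m\<bar> * r ^ mdeg n m) K * (s / r)"
    by (rule infsum_cmult_left) (use cK in auto)
  also have "\<dots> \<le> N * (s / r)"
  proof (rule mult_right_mono[OF _ sr(1)])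
    have "infsum (\<lambda>m. \<bar>c m\<bar> * r ^ mdeg n m) K \<le> infsum (\<lambda>m. \<bar>c m\<bar> * r ^ mdeg n m) (multi_idx n)"
      by (rule infsum_mono2[OF cK c(1) K]) (use r in auto)
    then show "infsum (\<lambda>m. \<bar>c m\<bar> * r ^ mdeg n m) K \<le> N" using c(2) by (rule order_trans)
  qed
  finally have le: "infsum (\<lambda>m. \<bar>c m\<bar> * s ^ mdeg n m) K \<le> N * (s / r)" .
  show ?thesis
  proof (rule bseries_regroup[where K = K and e = "\<lambda>m. m" and c = c, OF s(1) _ _ le])
    fix z assume "z \<in> cube n a s"
    then have "z \<in> cube n a r" using s by (force simp: cube_def)
    from c(3)[OF this] show "((\<lambda>m. c m * mpow n (\<lambda>i. z i - a i) m) has_sum g z) K"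
      by (rule has_sum_cong_neutral[THEN iffD1, rotated -1]) (auto simp: K_def c0)
  qed (use K sK in auto)
qed

section \<open>Partial derivatives of real analytic functions\<close>

abbreviation euc :: "nat \<Rightarrow> (nat \<Rightarrow> real) set" where
  "euc n \<equiv> topspace (Euclidean_space n)"

lemma euc_iff: "z \<in> euc n \<longleftrightarrow> (\<forall>i\<ge>n. z i = 0)"
  by (simp add: topspace_Euclidean_space)

lemma cube_iff: "z \<in> cube n a r \<longleftrightarrow> z \<in> euc n \<and> (\<forall>i<n. \<bar>z i - a i\<bar> \<le> r)"
  by (simp add: cube_def euc_iff)

lemma cube_mono: "z \<in> cube n a s \<Longrightarrow> s \<le> r \<Longrightarrow> z \<in> cube n a r"
  by (force simp: cube_def)

lemma cube_cube:
  assumes "z \<in> cube n a s" "w \<in> cube n z t" "s + t \<le> r"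
  shows "w \<in> cube n a r"
proof -
  have "\<bar>w i - a i\<bar> \<le> r" if "i < n" for i
  proof -
    have "\<bar>w i - z i\<bar> \<le> t" "\<bar>z i - a i\<bar> \<le> s" using assms that by (auto simp: cube_iff)
    then show ?thesis using assms(3) by arith
  qed
  then show ?thesis using assms(2) by (simp add: cube_iff)
qed

lemma center_in_cube: "a \<in> euc n \<Longrightarrow> r \<ge> 0 \<Longrightarrow> a \<in> cube n a r"
  by (simp add: cube_iff)

text \<open>For the forward direction the given series is evaluated at the corner
  \<open>a i + r / 2\<close> of a smaller cube. Summability of a real family is absolute, and at the
  corner absolute summability is finiteness of the weighted norm at radius
  \<open>r / 2\<close>.\<close>

lemma real_analytic_at_bseries:
  "real_analytic_at n g a \<longleftrightarrow> (\<exists>r N. bseries n a r N g)"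
proof
  assume "real_analytic_at n g a"
  then obtain coef r where r: "r > 0" and c: "\<And>z. z \<in> euc n \<Longrightarrow> (\<forall>i<n. \<bar>z i - a i\<bar> < r) \<Longrightarrow>
      ((\<lambda>m. coef m * mpow n (\<lambda>i. z i - a i) m) has_sum g z) (multi_idx n)"
    unfolding real_analytic_at_def mpow_def multi_idx_def by blast
  define s where "s = r / 2"
  have s: "0 < s" "s < r" using r by (auto simp: s_def)
  define z where "z i = (if i < n then a i + s else 0)" for i
  have "z \<in> euc n" by (simp add: z_def euc_iff)
  moreover have "\<forall>i<n. \<bar>z i - a i\<bar> < r" using s by (simp add: z_def)
  ultimately have "(\<lambda>m. coef m * mpow n (\<lambda>i. z i - a i) m) summable_on multi_idx n"
    using c has_sum_imp_summable by blast
  then have "(\<lambda>m. norm (coef m * mpow n (\<lambda>i. z i - a i) m)) summable_on multi_idx n"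
    by (rule summable_on_iff_abs_summable_on_real[THEN iffD1])
  moreover have "norm (coef m * mpow n (\<lambda>i. z i - a i) m) = \<bar>coef m\<bar> * s ^ mdeg n m" for m
    using s by (simp add: z_def mpow_def abs_mult mdeg_def power_sum abs_prod)
  ultimately have "(\<lambda>m. \<bar>coef m\<bar> * s ^ mdeg n m) summable_on multi_idx n" by simp
  from bseriesI[OF s(1) this order_refl] have "bseries n a s (infsum (\<lambda>m. \<bar>coef m\<bar> * s ^ mdeg n m) (multi_idx n)) g"
  proof this
    fix z assume "z \<in> cube n a s"
    then show "((\<lambda>m. coef m * mpow n (\<lambda>i. z i - a i) m) has_sum g z) (multi_idx n)"
      using s by (intro c) (force simp: cube_iff)+
  qed
  then show "\<exists>r N. bseries n a r N g" by blast
next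
  assume "\<exists>r N. bseries n a r N g"
  then obtain r N where b: "bseries n a r N g" by blast
  obtain c where c: "(\<lambda>m. \<bar>c m\<bar> * r ^ mdeg n m) summable_on multi_idx n"
     "infsum (\<lambda>m. \<bar>c m\<bar> * r ^ mdeg n m) (multi_idx n) \<le> N"
     "\<And>z. z \<in> cube n a r \<Longrightarrow> ((\<lambda>m. c m * mpow n (\<lambda>i. z i - a i) m) has_sum g z) (multi_idx n)"
    using b by (rule bseriesE) (rule that)
  have "((\<lambda>m. c m * (\<Prod>i<n. (z i - a i) ^ m i)) has_sum g z) {m. \<forall>i\<ge>n. m i = 0}"
    if "z \<in> euc n" "\<forall>i<n. \<bar>z i - a i\<bar> < r" for z
  proof -
    have "z \<in> cube n a r" using that by (force simp: cube_iff)
    from c(3)[OF this] show ?thesis by (simp only: mpow_def multi_idx_def)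
  qed
  then show "real_analytic_at n g a"
    unfolding real_analytic_at_def using bseries_pos[OF b] by blast
qed

lemma real_analytic_atE:
  assumes "real_analytic_at n g a"
  obtains r N where "r > 0" "bseries n a r N g"
  using assms bseries_pos unfolding real_analytic_at_bseries by blast

lemma bseries_imp_real_analytic: "bseries n a r N g \<Longrightarrow> real_analytic_at n g a"
  unfolding real_analytic_at_bseries by blast

lemma real_analytic_at_cong:
  assumes "real_analytic_at n f a" "r > 0" "\<And>z. z \<in> cube n a r \<Longrightarrow> f z = g z"
  shows "real_analytic_at n g a"
proof -
  obtain s N where s: "s > 0" "bseries n a s N f" using assms(1) by (rule real_analytic_atE)
  have "bseries n a (min r s) N f" by (rule bseries_radius_mono[OF s(2)]) (use s assms(2) in auto)
  then have "bseries n a (min r s) N g"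
    by (rule bseries_cong) (rule assms(3), erule cube_mono, simp)
  then show ?thesis by (rule bseries_imp_real_analytic)
qed

text \<open>The property is demanded for all smaller radii too, so the minimum of finitely many
  radii serves every index.\<close>

lemma finite_uniform_radius:
  fixes P :: "'k \<Rightarrow> real \<Rightarrow> bool"
  assumes "finite J" "\<And>j. j \<in> J \<Longrightarrow> \<exists>s>0. \<forall>s'. 0 < s' \<and> s' \<le> s \<longrightarrow> P j s'"
  shows "\<exists>s>0. \<forall>j\<in>J. \<forall>s'. 0 < s' \<and> s' \<le> s \<longrightarrow> P j s'"
  using assms
proof (induction J)
  case empty
  show ?case by (rule exI[of _ 1]) simp
next
  case (insert j J)
  obtain s where s: "s > 0" "\<forall>j\<in>J. \<forall>s'. 0 < s' \<and> s' \<le> s \<longrightarrow> P j s'"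
    using insert.IH insert.prems by blast
  obtain t where t: "t > 0" "\<forall>s'. 0 < s' \<and> s' \<le> t \<longrightarrow> P j s'" using insert.prems by blast
  show ?case by (rule exI[of _ "min s t"]) (use s t in auto)
qed

lemma real_analytic_at_family:
  assumes "finite J" "\<And>j. j \<in> J \<Longrightarrow> real_analytic_at n (f j) a"
  obtains r N where "r > 0" "\<And>j. j \<in> J \<Longrightarrow> bseries n a r (N j) (f j)"
proof -
  have "\<exists>s>0. \<forall>j\<in>J. \<forall>s'. 0 < s' \<and> s' \<le> s \<longrightarrow> (\<exists>N. bseries n a s' N (f j))"
  proof (rule finite_uniform_radius[OF assms(1)])
    fix j assume "j \<in> J"
    with assms(2) obtain r N where r: "r > 0" "bseries n a r N (f j)" by (blast elim: real_analytic_atE)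
    show "\<exists>s>0. \<forall>s'. 0 < s' \<and> s' \<le> s \<longrightarrow> (\<exists>N. bseries n a s' N (f j))"
      using r bseries_radius_mono[OF r(2)] by blast
  qed
  then obtain s where s: "s > 0" "\<forall>j\<in>J. \<exists>N. bseries n a s N (f j)" by auto
  then obtain N where "\<forall>j\<in>J. bseries n a s (N j) (f j)" using bchoice[OF s(2)] by blast
  with s(1) that show thesis by blast
qed

text \<open>By \<open>bseries_shrink0\<close> the norm decreases at least linearly with the radius
  and so falls below any given \<open>\<rho>\<close>.\<close>

lemma real_analytic_at_small:
  assumes "real_analytic_at n f a" "a \<in> euc n" "f a = 0" "\<rho> > 0"
  shows "\<exists>s>0. \<forall>s'. 0 < s' \<and> s' \<le> s \<longrightarrow> bseries n a s' \<rho> f"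
proof -
  obtain r N where r: "r > 0" "bseries n a r N f" using assms(1) by (rule real_analytic_atE)
  have N: "N \<ge> 0" using bseries_abs_le[OF r(2), of a] assms(2) r(1) by (simp add: center_in_cube)
  \<comment> \<open>\<open>N + 1\<close> instead of \<open>N\<close> keeps the quotient meaningful
    when \<open>N = 0\<close>.\<close>
  define s where "s = min r (\<rho> * r / (N + 1))"
  have s: "s > 0" using r N assms(4) by (simp add: s_def)
  have "bseries n a s' \<rho> f" if "0 < s'" "s' \<le> s" for s'
  proof -
    have "bseries n a s' (N * (s' / r)) f"
      by (rule bseries_shrink0[OF r(2)]) (use that assms in \<open>auto simp: s_def euc_iff\<close>)
    moreover have "N * (s' / r) \<le> \<rho>"
    proof -
      have "s' \<le> \<rho> * r / (N + 1)" using that by (simp add: s_def)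
      then have "s' * (N + 1) \<le> \<rho> * r" using N by (simp add: pos_le_divide_eq)
      moreover have "s' * N \<le> s' * (N + 1)" using that by simp
      ultimately have "N * s' \<le> \<rho> * r" by (simp add: mult.commute)
      then show ?thesis using r(1) by (simp add: pos_divide_le_eq)
    qed
    ultimately show ?thesis by (rule bseries_mono)
  qed
  with s show ?thesis by blast
qed

lemma real_analytic_at_diff_const:
  assumes "real_analytic_at n f a"
  shows "real_analytic_at n (\<lambda>z. f z - b) a"
proof -
  obtain r N where r: "r > 0" "bseries n a r N f" using assms by (rule real_analytic_atE)
  show ?thesis
    by (rule bseries_imp_real_analytic[OF bseries_diff[OF r(2) bseries_const[OF r(1) order_refl]]])
qed

text \<open>A map that vanishes at its centre has arbitrarily small norm on small cubes, so the
  composition theorem for bounded series applies.\<close>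

lemma real_analytic_at_compose:
  assumes g: "real_analytic_at k g (f a)"
    and f: "\<And>j. j < k \<Longrightarrow> real_analytic_at n (\<lambda>z. f z j) a"
    and a: "a \<in> euc n" and r0: "r0 > 0"
    and f0: "\<And>z. z \<in> cube n a r0 \<Longrightarrow> f z \<in> euc k"
  shows "real_analytic_at n (\<lambda>z. g (f z)) a"
proof -
  obtain \<rho> N where \<rho>: "\<rho> > 0" "bseries k (f a) \<rho> N g" using g by (rule real_analytic_atE)
  have "\<exists>s>0. \<forall>j\<in>{..<k}. \<forall>s'. 0 < s' \<and> s' \<le> s \<longrightarrow> bseries n a s' \<rho> (\<lambda>z. f z j - f a j)"
    by (rule finite_uniform_radius, simp, rule real_analytic_at_small)
       (use f a \<rho>(1) real_analytic_at_diff_const in auto)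
  then obtain s where s: "s > 0" "\<forall>j\<in>{..<k}. \<forall>s'. 0 < s' \<and> s' \<le> s \<longrightarrow> bseries n a s' \<rho> (\<lambda>z. f z j - f a j)"
    by blast
  have "bseries n a (min s r0) N (\<lambda>z. g (f z))"
  proof (rule bseries_compose[OF \<rho>(2)])
    fix j assume "j < k"
    then show "bseries n a (min s r0) \<rho> (\<lambda>z. f z j - f a j)" using s r0 by auto
  next
    fix z j assume z: "z \<in> cube n a (min s r0)" and "j \<ge> k"
    have "z \<in> cube n a r0" using z by (rule cube_mono) simp
    then show "f z j = 0" using f0 \<open>j \<ge> k\<close> by (simp add: euc_iff)
  qed (use s r0 in auto)
  then show ?thesis by (rule bseries_imp_real_analytic)
qed

lemma real_analytic_at_const: "real_analytic_at n (\<lambda>_. b) a"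
  by (rule bseries_imp_real_analytic[OF bseries_const[OF zero_less_one order_refl]])

lemma real_analytic_at_coord: "j < n \<Longrightarrow> real_analytic_at n (\<lambda>z. z j) a"
  using bseries_coord[OF zero_less_one, of j n a 0, OF _ order_refl]
  by (simp add: bseries_imp_real_analytic)

lemma real_analytic_at_binary:
  assumes "real_analytic_at n f a" "real_analytic_at n g a"
  obtains r N N' where "r > 0" "bseries n a r N f" "bseries n a r N' g"
proof -
  obtain r N where r: "r > 0" "bseries n a r N f" using assms(1) by (rule real_analytic_atE)
  obtain s N' where s: "s > 0" "bseries n a s N' g" using assms(2) by (rule real_analytic_atE)
  have "bseries n a (min r s) N f" by (rule bseries_radius_mono[OF r(2)]) (use r s in auto)
  moreover have "bseries n a (min r s) N' g" by (rule bseries_radius_mono[OF s(2)]) (use r s in auto)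
  ultimately show thesis using r s that[of "min r s"] by auto
qed

lemma real_analytic_at_add:
  assumes "real_analytic_at n f a" "real_analytic_at n g a"
  shows "real_analytic_at n (\<lambda>z. f z + g z) a"
  using assms by (rule real_analytic_at_binary) (blast intro: bseries_imp_real_analytic bseries_add)

lemma real_analytic_at_diff:
  assumes "real_analytic_at n f a" "real_analytic_at n g a"
  shows "real_analytic_at n (\<lambda>z. f z - g z) a"
  using assms by (rule real_analytic_at_binary) (blast intro: bseries_imp_real_analytic bseries_diff)

lemma real_analytic_at_mult:
  assumes "real_analytic_at n f a" "real_analytic_at n g a"
  shows "real_analytic_at n (\<lambda>z. f z * g z) a"
  using assms by (rule real_analytic_at_binary) (blast intro: bseries_imp_real_analytic bseries_mult)

lemma real_analytic_at_sum:
  assumes "\<And>k. k \<in> A \<Longrightarrow> real_analytic_at n (f k) a"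
  shows "real_analytic_at n (\<lambda>z. \<Sum>k\<in>A. f k z) a"
  using assms
proof (induction A rule: infinite_finite_induct)
  case (insert x F)
  then show ?case by (simp add: real_analytic_at_add)
qed (simp_all add: real_analytic_at_const)

lemma real_analytic_at_prod:
  assumes "\<And>k. k \<in> A \<Longrightarrow> real_analytic_at n (f k) a"
  shows "real_analytic_at n (\<lambda>z. \<Prod>k\<in>A. f k z) a"
  using assms
proof (induction A rule: infinite_finite_induct)
  case (insert x F)
  then show ?case by (simp add: real_analytic_at_mult)
qed (simp_all add: real_analytic_at_const)

section \<open>Neighbouring points and continuity\<close>

lemma real_analytic_at_near:
  assumes "real_analytic_at n g a"
  shows "\<exists>r>0. \<forall>b. (\<forall>i<n. \<bar>b i - a i\<bar> \<le> r) \<longrightarrow> real_analytic_at n g b"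
proof -
  obtain r N where r: "r > 0" "bseries n a r N g" using assms by (rule real_analytic_atE)
  have "real_analytic_at n g b" if "\<forall>i<n. \<bar>b i - a i\<bar> \<le> r / 2" for b
    by (rule bseries_imp_real_analytic[OF bseries_translate[OF r(2), of "r / 2"]])
       (use r(1) that in \<open>auto simp: field_simps\<close>)
  then show ?thesis using r(1) by (intro exI[of _ "r / 2"]) auto
qed

text \<open>\<open>bseries_shrink0\<close> is applied at the very radius \<open>s\<close> that
  measures the distance of \<open>z\<close>; the supremum bound at that radius is
  \<open>(N / r) * s\<close>.\<close>

lemma real_analytic_at_Lipschitz:
  assumes "real_analytic_at n g a" "a \<in> euc n"
  obtains C r where "r > 0" "C \<ge> 0" "\<And>s z. 0 \<le> s \<Longrightarrow> s \<le> r \<Longrightarrow> z \<in> cube n a s \<Longrightarrow> \<bar>g z - g a\<bar> \<le> C * s"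
proof -
  have "real_analytic_at n (\<lambda>z. g z - g a) a" by (rule real_analytic_at_diff_const[OF assms(1)])
  then obtain r N where r: "r > 0" "bseries n a r N (\<lambda>z. g z - g a)" by (rule real_analytic_atE)
  have N: "N \<ge> 0" using bseries_abs_le[OF r(2), of a] assms(2) r(1) by (simp add: center_in_cube)
  have "\<bar>g z - g a\<bar> \<le> (N / r) * s" if "0 \<le> s" "s \<le> r" "z \<in> cube n a s" for s z
  \<comment> \<open>A bounded series has positive radius, so the degenerate cube is treated
    apart.\<close>
  proof (cases "s = 0")
    case True
    have "z = a"
    proof
      fix i show "z i = a i" using that assms(2) True by (cases "i < n") (auto simp: cube_iff euc_iff)
    qed
    then show ?thesis using True by simp
  next
    case False
    have "bseries n a s (N * (s / r)) (\<lambda>z. g z - g a)"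
      by (rule bseries_shrink0[OF r(2)]) (use that assms False in \<open>auto simp: euc_iff\<close>)
    from bseries_abs_le[OF this that(3)] show ?thesis by simp
  qed
  then show thesis using that[of r "N / r"] r(1) N by simp
qed

lemma real_analytic_at_tendsto:
  assumes g: "real_analytic_at n g a" and a: "a \<in> euc n"
    and lim: "\<And>i. i < n \<Longrightarrow> ((\<lambda>t. \<gamma> t i) \<longlongrightarrow> a i) F" and ev: "\<forall>\<^sub>F t in F. \<gamma> t \<in> euc n"
  shows "((\<lambda>t. g (\<gamma> t)) \<longlongrightarrow> g a) F"
proof (rule tendstoI)
  fix e :: real assume e: "e > 0"
  obtain C r where C: "r > 0" "C \<ge> 0" "\<And>s z. 0 \<le> s \<Longrightarrow> s \<le> r \<Longrightarrow> z \<in> cube n a s \<Longrightarrow> \<bar>g z - g a\<bar> \<le> C * s"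
    using g a by (rule real_analytic_at_Lipschitz) (rule that)
  \<comment> \<open>The 2 makes the final inequality strict, and \<open>C + 1\<close> allows for
    \<open>C = 0\<close>.\<close>
  define s where "s = min r (e / (2 * (C + 1)))"
  have s: "s > 0" "s \<le> r" using C e by (auto simp: s_def)
  have "s \<le> e / (2 * (C + 1))" by (simp add: s_def)
  then have "s * (2 * (C + 1)) \<le> e" using C(2) by (subst (asm) pos_le_divide_eq) auto
  moreover have "C * s * 2 \<le> s * (2 * (C + 1))" using s(1) by (simp add: algebra_simps)
  ultimately have Cs: "C * s < e" using e by simp
  have "\<forall>\<^sub>F t in F. \<forall>i\<in>{..<n}. dist (\<gamma> t i) (a i) < s"
    using lim s(1) by (intro eventually_ball_finite) (auto dest: tendstoD)
  then show "\<forall>\<^sub>F t in F. dist (g (\<gamma> t)) (g a) < e"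
    using ev
  proof eventually_elim
    case (elim t)
    then have "\<gamma> t \<in> cube n a s" by (force simp: cube_iff dist_real_def)
    from C(3)[OF _ s(2) this] s(1) Cs show ?case by (simp add: dist_real_def)
  qed
qed

section \<open>Divided differences and partial derivatives\<close>

lemma mdeg_lower:
  assumes "i < n" "m i > 0"
  shows "mdeg n m = Suc (mdeg n (m(i := m i - 1)))"
proof -
  have "mdeg n m = m i + sum m ({..<n} - {i})"
    unfolding mdeg_def using assms(1) by (intro sum.remove) auto
  moreover have "mdeg n (m(i := m i - 1)) = (m i - 1) + sum (m(i := m i - 1)) ({..<n} - {i})"
    unfolding mdeg_def using assms(1) by (subst sum.remove[of _ i]) auto
  moreover have "sum (m(i := m i - 1)) ({..<n} - {i}) = sum m ({..<n} - {i})"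
    by (rule sum.cong) auto
  ultimately show ?thesis using assms(2) by simp
qed

lemma mpow_remove:
  assumes "i < n"
  shows "mpow n u m = u i ^ m i * (\<Prod>j\<in>{..<n} - {i}. u j ^ m j)"
  unfolding mpow_def using assms by (intro prod.remove) auto

lemma mpow_lower:
  assumes "i < n" "m i > 0"
  shows "mpow n u m = u i * mpow n u (m(i := m i - 1))"
proof -
  have "(\<Prod>j\<in>{..<n} - {i}. u j ^ (m(i := m i - 1)) j) = (\<Prod>j\<in>{..<n} - {i}. u j ^ m j)"
    by (rule prod.cong) auto
  then show ?thesis using assms by (simp add: mpow_remove[OF assms(1)] power_eq_if)
qed

text \<open>The terms divisible by \<open>z i - a i\<close> are separated from the others.\<close>

lemma bseries_divided_difference:
  assumes b: "bseries n a r N g" and i: "i < n"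
  obtains q where "bseries n a r (N / r) q"
    "\<And>z. z \<in> cube n a r \<Longrightarrow> g z = g (z(i := a i)) + (z i - a i) * q z"
proof -
  have r: "r > 0" using b by (rule bseries_pos)
  obtain c where c: "(\<lambda>m. \<bar>c m\<bar> * r ^ mdeg n m) summable_on multi_idx n"
     "infsum (\<lambda>m. \<bar>c m\<bar> * r ^ mdeg n m) (multi_idx n) \<le> N"
     "\<And>z. z \<in> cube n a r \<Longrightarrow> ((\<lambda>m. c m * mpow n (\<lambda>i. z i - a i) m) has_sum g z) (multi_idx n)"
    using b by (rule bseriesE) (rule that)
  define K where "K = {m \<in> multi_idx n. m i > 0}"
  define e where "e m = (m :: nat \<Rightarrow> nat)(i := m i - 1)" for m
  define q where "q z = infsum (\<lambda>m. c m * mpow n (\<lambda>i. z i - a i) (e m)) K" for z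
  have K: "K \<subseteq> multi_idx n" by (auto simp: K_def)
  have deg: "mdeg n m = Suc (mdeg n (e m))" if "m \<in> K" for m
    using that mdeg_lower[OF i, of m] by (simp add: K_def e_def)
  have pow: "mpow n u m = u i * mpow n u (e m)" if "m \<in> K" for m u
    using that mpow_lower[OF i, of m u] by (simp add: K_def e_def)
  have cK: "(\<lambda>m. \<bar>c m\<bar> * r ^ mdeg n m) summable_on K"
    using c(1) K by (rule summable_on_subset_banach)
  have "infsum (\<lambda>m. \<bar>c m\<bar> * r ^ mdeg n m) K \<le> infsum (\<lambda>m. \<bar>c m\<bar> * r ^ mdeg n m) (multi_idx n)"
    by (rule infsum_mono2[OF cK c(1) K]) (use r in auto)
  then have le: "infsum (\<lambda>m. \<bar>c m\<bar> * r ^ mdeg n m) K \<le> N" using c(2) by (rule order_trans)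
  have S: "((\<lambda>m. \<bar>c m\<bar> * r ^ mdeg n (e m)) has_sum infsum (\<lambda>m. \<bar>c m\<bar> * r ^ mdeg n m) K * (1 / r)) K"
  proof (rule has_sum_cong[THEN iffD1, OF _ has_sum_cmult_left[OF has_sum_infsum[OF cK]]])
    fix m assume "m \<in> K"
    then show "\<bar>c m\<bar> * r ^ mdeg n m * (1 / r) = \<bar>c m\<bar> * r ^ mdeg n (e m)"
      using r by (simp add: deg)
  qed
  have eK: "e m \<in> multi_idx n" if "m \<in> K" for m
    using that i by (auto simp: K_def e_def multi_idx_def)
  have qs: "((\<lambda>m. c m * mpow n (\<lambda>i. z i - a i) (e m)) has_sum q z) K" if z: "z \<in> cube n a r" for z
  proof -
    have "(\<lambda>m. c m * mpow n (\<lambda>i. z i - a i) (e m)) summable_on K"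
    proof (rule summable_on_bounded_real[OF has_sum_imp_summable[OF S]])
      fix m
      have "\<bar>mpow n (\<lambda>i. z i - a i) (e m)\<bar> \<le> r ^ mdeg n (e m)"
        by (rule mpow_le) (use z in \<open>auto simp: cube_def\<close>)
      then show "\<bar>c m * mpow n (\<lambda>i. z i - a i) (e m)\<bar> \<le> \<bar>c m\<bar> * r ^ mdeg n (e m)"
        unfolding abs_mult by (rule mult_left_mono) simp
    qed
    then show ?thesis unfolding q_def by (rule has_sum_infsum)
  qed
  have bq: "bseries n a r (N / r) q"
  proof (rule bseries_regroup[OF r eK S _ qs])
    show "infsum (\<lambda>m. \<bar>c m\<bar> * r ^ mdeg n m) K * (1 / r) \<le> N / r"
      using le r by (simp add: divide_right_mono)
  qed
  have "g z = g (z(i := a i)) + (z i - a i) * q z" if z: "z \<in> cube n a r" for z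
  proof -
    have z': "z(i := a i) \<in> cube n a r" using z i r by (auto simp: cube_def)
    have eq: "c m * mpow n (\<lambda>j. (z(i := a i)) j - a j) m = c m * mpow n (\<lambda>i. z i - a i) m"
      if "m \<in> multi_idx n - K" for m
    proof -
      have [simp]: "m i = 0" using that by (simp add: K_def)
      have "(\<Prod>j\<in>{..<n} - {i}. ((z(i := a i)) j - a j) ^ m j) = (\<Prod>j\<in>{..<n} - {i}. (z j - a j) ^ m j)"
        by (rule prod.cong) auto
      then show ?thesis by (simp add: mpow_remove[OF i])
    qed
    have "((\<lambda>m. c m * mpow n (\<lambda>j. (z(i := a i)) j - a j) m) has_sum g (z(i := a i))) (multi_idx n)"
      by (rule c(3)[OF z'])
    \<comment> \<open>At \<open>z(i := a i)\<close> every term from \<open>K\<close> contains the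
      factor 0, and the terms outside \<open>K\<close> do not involve variable \<open>i\<close>.
      Hence the value of \<open>g\<close> with variable \<open>i\<close> frozen is the part of the
      series at \<open>z\<close> outside \<open>K\<close>.\<close>
    then have "((\<lambda>m. c m * mpow n (\<lambda>i. z i - a i) m) has_sum g (z(i := a i))) (multi_idx n - K)"
    proof (rule has_sum_cong_neutral[THEN iffD1, rotated -1])
      fix m assume "m \<in> multi_idx n - (multi_idx n - K)"
      then have "m \<in> K" by blast
      from pow[OF this, of "\<lambda>j. (z(i := a i)) j - a j"]
      show "c m * mpow n (\<lambda>j. (z(i := a i)) j - a j) m = 0" by simp
    qed (use eq in auto)
    moreover have "((\<lambda>m. c m * mpow n (\<lambda>i. z i - a i) m) has_sum (z i - a i) * q z) K"
    proof (rule has_sum_cong[THEN iffD1, OF _ has_sum_cmult_right[OF qs[OF z]]])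
      fix m assume "m \<in> K"
      from pow[OF this, of "\<lambda>j. z j - a j"]
      show "(z i - a i) * (c m * mpow n (\<lambda>i. z i - a i) (e m)) = c m * mpow n (\<lambda>i. z i - a i) m"
        by simp
    qed
    ultimately have "((\<lambda>m. c m * mpow n (\<lambda>i. z i - a i) m) has_sum g (z(i := a i)) + (z i - a i) * q z)
        ((multi_idx n - K) \<union> K)"
      by (rule has_sum_Un_disjoint) auto
    moreover have "(multi_idx n - K) \<union> K = multi_idx n" using K by blast
    ultimately show ?thesis using c(3)[OF z] has_sum_unique by metis
  qed
  with bq show thesis by (rule that)
qed

lemma real_analytic_at_divided_difference:
  assumes "real_analytic_at n g a" "i < n"
  obtains q r where "r > 0" "real_analytic_at n q a"
    "\<And>z. z \<in> cube n a r \<Longrightarrow> g z = g (z(i := a i)) + (z i - a i) * q z"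
proof -
  obtain r N where r: "r > 0" "bseries n a r N g" using assms(1) by (rule real_analytic_atE)
  show thesis
    by (rule bseries_divided_difference[OF r(2) assms(2)])
       (use that r(1) bseries_imp_real_analytic in blast)
qed

text \<open>At a zero of \<open>u\<close> the difference quotient of the product is the difference
  quotient of \<open>u\<close> times \<open>v\<close>, so continuity of \<open>v\<close> suffices.
  This is how divided differences become derivatives.\<close>

lemma has_derivative_mult_at_zero:
  fixes u v :: "real \<Rightarrow> real"
  assumes u: "(u has_real_derivative D) (at t)" "u t = 0" and v: "(v \<longlongrightarrow> v t) (at t)"
  shows "((\<lambda>s. u s * v s) has_real_derivative D * v t) (at t)"
proof -
  have "((\<lambda>s. (u s - u t) / (s - t)) \<longlongrightarrow> D) (at t)"
    using u(1) by (simp add: has_field_derivative_iff)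
  from tendsto_mult[OF this v] have "((\<lambda>s. (u s - u t) / (s - t) * v s) \<longlongrightarrow> D * v t) (at t)" .
  then show ?thesis by (simp add: has_field_derivative_iff u(2))
qed

lemma fun_upd_euc: "a \<in> euc n \<Longrightarrow> i < n \<Longrightarrow> a(i := s) \<in> euc n"
  by (auto simp: euc_iff)

lemma fun_upd_cube: "a \<in> euc n \<Longrightarrow> i < n \<Longrightarrow> \<bar>s - a i\<bar> \<le> r \<Longrightarrow> a(i := s) \<in> cube n a r"
  by (auto simp: cube_iff euc_iff)

lemma real_analytic_at_tendsto_line:
  assumes "real_analytic_at n q a" "a \<in> euc n" "i < n"
  shows "((\<lambda>s. q (a(i := s))) \<longlongrightarrow> q a) (at (a i))"
proof (rule real_analytic_at_tendsto[OF assms(1,2)])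
  fix j assume "j < n"
  show "((\<lambda>s. (a(i := s)) j) \<longlongrightarrow> a j) (at (a i))"
    by (cases "j = i") auto
qed (use assms fun_upd_euc in auto)

lemma has_real_derivative_partial_aux:
  assumes q: "real_analytic_at n q a" and a: "a \<in> euc n" and i: "i < n" and r: "r > 0"
    and h: "\<And>z. z \<in> cube n a r \<Longrightarrow> g z = g (z(i := a i)) + (z i - a i) * q z"
  shows "((\<lambda>s. g (a(i := s))) has_real_derivative q a) (at (a i))"
proof -
  have "((\<lambda>s. (s - a i) * q (a(i := s))) has_real_derivative 1 * q (a(i := a i))) (at (a i))"
    by (rule has_derivative_mult_at_zero)
       (use real_analytic_at_tendsto_line[OF q a i] in \<open>auto intro!: derivative_eq_intros\<close>)
  from DERIV_add[OF DERIV_const[of "g a"] this]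
  have d: "((\<lambda>s. g a + (s - a i) * q (a(i := s))) has_real_derivative q a) (at (a i))"
    by simp
  have "\<forall>\<^sub>F s in nhds (a i). g a + (s - a i) * q (a(i := s)) = g (a(i := s))"
    unfolding eventually_nhds_metric
  proof (intro exI[of _ r] conjI allI impI r)
    fix s assume "dist s (a i) < r"
    then have "a(i := s) \<in> cube n a r" by (intro fun_upd_cube a i) (simp add: dist_real_def)
    from h[OF this] show "g a + (s - a i) * q (a(i := s)) = g (a(i := s))" by simp
  qed
  from DERIV_cong_ev[OF refl this refl] d show ?thesis by simp
qed

lemma real_analytic_at_has_partial:
  assumes g: "real_analytic_at n g a" and a: "a \<in> euc n" and i: "i < n"
  shows "((\<lambda>s. g (a(i := s))) has_real_derivative partial_deriv i g a) (at (a i))"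
proof -
  obtain q r where "r > 0" "real_analytic_at n q a"
    "\<And>z. z \<in> cube n a r \<Longrightarrow> g z = g (z(i := a i)) + (z i - a i) * q z"
    using g i by (rule real_analytic_at_divided_difference) (rule that)
  then have "((\<lambda>s. g (a(i := s))) has_real_derivative q a) (at (a i))"
    using has_real_derivative_partial_aux a i by blast
  then show ?thesis unfolding partial_deriv_def by (simp add: DERIV_imp_deriv)
qed

lemma partial_derivI:
  "((\<lambda>s. g (a(i := s))) has_real_derivative D) (at (a i)) \<Longrightarrow> partial_deriv i g a = D"
  unfolding partial_deriv_def by (rule DERIV_imp_deriv)

text \<open>The increment in direction \<open>i\<close> becomes an extra variable; the partial derivative is the
  divided difference in that variable at increment \<open>0\<close>.\<close>

lemma real_analytic_at_partial:
  assumes g: "real_analytic_at n g a" and a: "a \<in> euc n" and i: "i < n"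
  shows "real_analytic_at n (partial_deriv i g) a"
proof -
  define f where "f w = (\<lambda>j. if j < n then w j + (if j = i then w n else 0) else 0)" for w :: "nat \<Rightarrow> real"
  have an: "a n = 0" using a by (simp add: euc_iff)
  have fa: "f a = a" using a by (auto simp: f_def fun_eq_iff an euc_iff)
  have a': "a \<in> euc (Suc n)" using a by (simp add: euc_iff)
  have "real_analytic_at (Suc n) (\<lambda>w. g (f w)) a"
  proof (rule real_analytic_at_compose[where f = f and k = n, OF _ _ a' zero_less_one])
    show "real_analytic_at n g (f a)" by (simp add: fa g)
    fix j assume "j < n"
    then have "real_analytic_at (Suc n) (\<lambda>w. w j + (if j = i then 1 else 0) * w n) a"
      by (intro real_analytic_at_add real_analytic_at_mult real_analytic_at_coord real_analytic_at_const) auto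
    moreover have "(\<lambda>w. f w j) = (\<lambda>w. w j + (if j = i then 1 else 0) * w n)"
      using \<open>j < n\<close> by (auto simp: f_def fun_eq_iff)
    ultimately show "real_analytic_at (Suc n) (\<lambda>w. f w j) a" by simp
  qed (simp add: f_def euc_iff)
  then obtain q r where r: "r > 0" and q: "real_analytic_at (Suc n) q a"
    and h: "\<And>w. w \<in> cube (Suc n) a r \<Longrightarrow> g (f w) = g (f (w(n := a n))) + (w n - a n) * q w"
    by (rule real_analytic_at_divided_difference[of "Suc n" _ a n]) auto
  \<comment> \<open>The identity is to hold on a cube, so \<open>q\<close> must be continuous at all
    nearby points and not only at \<open>a\<close>.\<close>
  obtain r' where r': "r' > 0" and near: "\<forall>b. (\<forall>j<Suc n. \<bar>b j - a j\<bar> \<le> r') \<longrightarrow> real_analytic_at (Suc n) q b"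
    using real_analytic_at_near[OF q] by blast
  have *: "partial_deriv i g z = q z" if z: "z \<in> cube n a (min r r')" for z
  proof (rule partial_derivI)
    have zE: "z \<in> euc n" "z \<in> euc (Suc n)" and zn: "z n = 0" using z by (auto simp: cube_iff euc_iff)
    have zz: "z(n := 0) = z" using zn by (simp add: fun_upd_idem)
    have "\<bar>z j - a j\<bar> \<le> r'" if "j < Suc n" for j
      using z that r' by (cases "j = n") (auto simp: cube_iff zn an)
    then have qz: "real_analytic_at (Suc n) q z" using near by blast
    have fz: "f (z(n := s)) = z(i := z i + s)" for s
      using zE(1) i by (auto simp: f_def fun_eq_iff euc_iff)
    have "((\<lambda>s. s * q (z(n := s))) has_real_derivative 1 * q (z(n := 0))) (at 0)"
      by (rule has_derivative_mult_at_zero)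
         (use real_analytic_at_tendsto_line[OF qz zE(2), of n] zz zn in \<open>auto intro!: derivative_eq_intros\<close>)
    from DERIV_add[OF DERIV_const[of "g z"] this]
    have d: "((\<lambda>s. g z + s * q (z(n := s))) has_real_derivative q (z(n := 0))) (at 0)"
      by simp
    have "\<forall>\<^sub>F s in nhds 0. g z + s * q (z(n := s)) = g (z(i := z i + s))"
      unfolding eventually_nhds_metric
    proof (intro exI[of _ r] conjI allI impI r)
      fix s :: real assume s: "dist s 0 < r"
      have "z(n := s) \<in> cube (Suc n) a r"
        using z s by (auto simp: cube_iff an dist_real_def less_Suc_eq euc_iff)
      from h[OF this] show "g z + s * q (z(n := s)) = g (z(i := z i + s))"
        using fz[of s] fz[of 0] by (simp add: an)
    qed
    from DERIV_cong_ev[OF refl this refl] d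
    have "((\<lambda>s. g (z(i := z i + s))) has_real_derivative q (z(n := 0))) (at 0)" by simp
    then have "((\<lambda>s. g (z(i := s + z i))) has_real_derivative q (z(n := 0))) (at 0)"
      by (simp add: add.commute)
    then have "((\<lambda>s. g (z(i := s))) has_real_derivative q (z(n := 0))) (at (0 + z i))"
      by (simp only: DERIV_shift)
    then have "((\<lambda>s. g (z(i := s))) has_real_derivative q (z(n := 0))) (at (z i))"
      by simp
    then show "((\<lambda>s. g (z(i := s))) has_real_derivative q z) (at (z i))" by (simp only: zz)
  qed
  \<comment> \<open>Coordinate \<open>n\<close> vanishes on \<open>euc n\<close>, so composing with
    the identity restricts \<open>q\<close> to increment 0.\<close>
  have "real_analytic_at n q a"
  proof (rule real_analytic_at_compose[where f = "\<lambda>z. z", OF q _ a zero_less_one])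
    fix j assume j: "j < Suc n"
    show "real_analytic_at n (\<lambda>z. z j) a"
    proof (cases "j < n")
      case False
      then have "j = n" using j by simp
      show ?thesis
        by (rule real_analytic_at_cong[OF real_analytic_at_const[of n 0] zero_less_one])
           (simp add: cube_iff euc_iff \<open>j = n\<close>)
    qed (rule real_analytic_at_coord)
  qed (simp add: cube_iff euc_iff)
  then show ?thesis
    by (rule real_analytic_at_cong[where r = "min r r'"]) (use r r' * in auto)
qed

text \<open>Hadamard's lemma. Freezing the coordinates at \<open>a\<close> one after another writes
  \<open>g z - g a\<close> as a telescoping sum of divided differences. The chain rule and the
  expansion of derivations in a frame both rest on it.\<close>

lemma real_analytic_at_hadamard:
  assumes g: "real_analytic_at n g a" and a: "a \<in> euc n"
  obtains q r where "r > 0" "\<And>i. i < n \<Longrightarrow> real_analytic_at n (q i) a"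
    "\<And>z. z \<in> cube n a r \<Longrightarrow> g z = g a + (\<Sum>i<n. (z i - a i) * q i z)"
    "\<And>i. i < n \<Longrightarrow> q i a = partial_deriv i g a"
proof -
  have ex: "\<exists>q r. r > 0 \<and> (\<forall>i<k. real_analytic_at n (q i) a) \<and>
     (\<forall>z \<in> cube n a r. g z = g (\<lambda>i. if i < k then a i else z i) + (\<Sum>i<k. (z i - a i) * q i z))"
    if "k \<le> n" for k
    using that
  proof (induction k)
    case 0
    show ?case by (intro exI[of _ "\<lambda>_ _. 0"] exI[of _ 1]) simp
  next
    case (Suc k)
    then obtain q r where r: "r > 0" and q: "\<forall>i<k. real_analytic_at n (q i) a"
      and h: "\<forall>z \<in> cube n a r. g z = g (\<lambda>i. if i < k then a i else z i) + (\<Sum>i<k. (z i - a i) * q i z)"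
      by auto
    have "real_analytic_at n (\<lambda>z. g (\<lambda>i. if i < k then a i else z i)) a"
    proof (rule real_analytic_at_compose[where f = "\<lambda>z i. if i < k then a i else z i" and k = n, OF _ _ a zero_less_one])
      have "(\<lambda>i. if i < k then a i else a i) = a" by auto
      then show "real_analytic_at n g (\<lambda>i. if i < k then a i else a i)" using g by simp
      fix j assume "j < n"
      then show "real_analytic_at n (\<lambda>z. if j < k then a j else z j) a"
        by (cases "j < k") (simp_all add: real_analytic_at_const real_analytic_at_coord)
    qed (use a Suc.prems in \<open>auto simp: cube_iff euc_iff\<close>)
    then obtain p s where s: "s > 0" and p: "real_analytic_at n p a"
      and hp: "\<And>z. z \<in> cube n a s \<Longrightarrow> g (\<lambda>i. if i < k then a i else z i) =
         g (\<lambda>i. if i < k then a i else (z(k := a k)) i) + (z k - a k) * p z"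
      by (rule real_analytic_at_divided_difference[of n _ a k]) (use Suc.prems in auto)
    have "g z = g (\<lambda>i. if i < Suc k then a i else z i) + (\<Sum>i<Suc k. (z i - a i) * (q(k := p)) i z)"
      if z: "z \<in> cube n a (min r s)" for z
    proof -
      have z1: "z \<in> cube n a r" "z \<in> cube n a s" using z cube_mono by auto
      have "(\<lambda>i. if i < k then a i else (z(k := a k)) i) = (\<lambda>i. if i < Suc k then a i else z i)"
        by (auto simp: fun_eq_iff less_Suc_eq)
      then have "g z = g (\<lambda>i. if i < Suc k then a i else z i) + (z k - a k) * p z + (\<Sum>i<k. (z i - a i) * q i z)"
        using h z1(1) hp[OF z1(2)] by simp
      then show ?thesis by simp
    qed
    moreover have "\<forall>i<Suc k. real_analytic_at n ((q(k := p)) i) a" using q p by (auto simp: less_Suc_eq)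
    ultimately show ?case using r s by (intro exI[of _ "q(k := p)"] exI[of _ "min r s"]) auto
  qed
  obtain q r where r: "r > 0" and q: "\<And>i. i < n \<Longrightarrow> real_analytic_at n (q i) a"
    and h: "\<And>z. z \<in> cube n a r \<Longrightarrow> g z = g (\<lambda>i. if i < n then a i else z i) + (\<Sum>i<n. (z i - a i) * q i z)"
    using ex[of n] by auto
  have h': "g z = g a + (\<Sum>i<n. (z i - a i) * q i z)" if "z \<in> cube n a r" for z
  proof -
    have "(\<lambda>i. if i < n then a i else z i) = a" using that a by (auto simp: fun_eq_iff cube_iff euc_iff)
    then show ?thesis using h[OF that] by simp
  qed
  have pd: "q i a = partial_deriv i g a" if i: "i < n" for i
  proof (rule partial_derivI[symmetric])
    have "((\<lambda>s. (s - a i) * q i (a(i := s))) has_real_derivative 1 * q i (a(i := a i))) (at (a i))"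
      by (rule has_derivative_mult_at_zero)
         (use real_analytic_at_tendsto_line[OF q[OF i] a i] in \<open>auto intro!: derivative_eq_intros\<close>)
    from DERIV_add[OF DERIV_const[of "g a"] this]
    have d: "((\<lambda>s. g a + (s - a i) * q i (a(i := s))) has_real_derivative q i a) (at (a i))"
      by simp
    have "\<forall>\<^sub>F s in nhds (a i). g a + (s - a i) * q i (a(i := s)) = g (a(i := s))"
      unfolding eventually_nhds_metric
    proof (intro exI[of _ r] conjI allI impI r)
      fix s assume "dist s (a i) < r"
      then have "a(i := s) \<in> cube n a r" by (intro fun_upd_cube a i) (simp add: dist_real_def)
      from h'[OF this] have "g (a(i := s)) = g a + (\<Sum>j<n. ((a(i := s)) j - a j) * q j (a(i := s)))" .
      also have "(\<Sum>j<n. ((a(i := s)) j - a j) * q j (a(i := s))) = (\<Sum>j<n. if j = i then (s - a i) * q i (a(i := s)) else 0)"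
        by (rule sum.cong) auto
      also have "\<dots> = (s - a i) * q i (a(i := s))" using i by simp
      finally show "g a + (s - a i) * q i (a(i := s)) = g (a(i := s))" by (rule sym)
    qed
    from DERIV_cong_ev[OF refl this refl] d
    show "((\<lambda>s. g (a(i := s))) has_real_derivative q i a) (at (a i))" by simp
  qed
  show thesis by (rule that[OF r q h' pd])
qed

text \<open>Along the curve each Hadamard summand is a differentiable factor that vanishes at
  \<open>t\<close> times a continuous one, so \<open>has_derivative_mult_at_zero\<close> applies to
  it.\<close>

lemma real_analytic_at_chain:
  assumes g: "real_analytic_at n g (\<gamma> t)" and \<gamma>: "\<And>i. i < n \<Longrightarrow> ((\<lambda>s. \<gamma> s i) has_real_derivative D i) (at t)"
    and ev: "\<forall>\<^sub>F s in nhds t. \<gamma> s \<in> euc n"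
  shows "((\<lambda>s. g (\<gamma> s)) has_real_derivative (\<Sum>i<n. D i * partial_deriv i g (\<gamma> t))) (at t)"
proof -
  have a: "\<gamma> t \<in> euc n" using ev by (rule eventually_nhds_x_imp_x)
  obtain q r where r: "r > 0" and q: "\<And>i. i < n \<Longrightarrow> real_analytic_at n (q i) (\<gamma> t)"
    and h: "\<And>z. z \<in> cube n (\<gamma> t) r \<Longrightarrow> g z = g (\<gamma> t) + (\<Sum>i<n. (z i - \<gamma> t i) * q i z)"
    and pd: "\<And>i. i < n \<Longrightarrow> q i (\<gamma> t) = partial_deriv i g (\<gamma> t)"
    using g a by (rule real_analytic_at_hadamard) (rule that)
  have lim: "((\<lambda>s. \<gamma> s i) \<longlongrightarrow> \<gamma> t i) (at t)" if "i < n" for i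
    using DERIV_isCont[OF \<gamma>[OF that]] by (simp add: isCont_def)
  have ev': "\<forall>\<^sub>F s in at t. \<gamma> s \<in> euc n" using ev by (auto simp: eventually_at_filter elim: eventually_mono)
  have "((\<lambda>s. (\<gamma> s i - \<gamma> t i) * q i (\<gamma> s)) has_real_derivative D i * q i (\<gamma> t)) (at t)" if "i < n" for i
  proof (rule has_derivative_mult_at_zero)
    show "((\<lambda>s. \<gamma> s i - \<gamma> t i) has_real_derivative D i) (at t)"
      using DERIV_diff[OF \<gamma>[OF that] DERIV_const[of "\<gamma> t i"]] by simp
    show "((\<lambda>s. q i (\<gamma> s)) \<longlongrightarrow> q i (\<gamma> t)) (at t)"
      by (rule real_analytic_at_tendsto[OF q[OF that] a lim ev'])
  qed simp
  then have "((\<lambda>s. \<Sum>i<n. (\<gamma> s i - \<gamma> t i) * q i (\<gamma> s)) has_real_derivative (\<Sum>i<n. D i * q i (\<gamma> t))) (at t)"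
    by (intro DERIV_sum) auto
  from DERIV_add[OF DERIV_const[of "g (\<gamma> t)"] this]
  have d: "((\<lambda>s. g (\<gamma> t) + (\<Sum>i<n. (\<gamma> s i - \<gamma> t i) * q i (\<gamma> s))) has_real_derivative
      (\<Sum>i<n. D i * partial_deriv i g (\<gamma> t))) (at t)" by (simp add: pd)
  have "\<forall>\<^sub>F s in nhds t. \<forall>i\<in>{..<n}. dist (\<gamma> s i) (\<gamma> t i) < r"
  proof (intro eventually_ball_finite ballI)
    fix i assume "i \<in> {..<n}"
    then have "((\<lambda>s. \<gamma> s i) \<longlongrightarrow> \<gamma> t i) (nhds t)"
      by (intro tendsto_at_iff_tendsto_nhds[THEN iffD1] lim) simp
    then show "\<forall>\<^sub>F s in nhds t. dist (\<gamma> s i) (\<gamma> t i) < r" using r by (rule tendstoD)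
  qed simp
  with ev have "\<forall>\<^sub>F s in nhds t. g (\<gamma> t) + (\<Sum>i<n. (\<gamma> s i - \<gamma> t i) * q i (\<gamma> s)) = g (\<gamma> s)"
  proof eventually_elim
    case (elim s)
    then have "\<gamma> s \<in> cube n (\<gamma> t) r" by (force simp: cube_iff dist_real_def)
    from h[OF this] show ?case by simp
  qed
  from DERIV_cong_ev[OF refl this refl] d show ?thesis by simp
qed

lemma partial_deriv_cong:
  assumes "a \<in> euc n" "i < n" "r > 0" "\<And>z. z \<in> cube n a r \<Longrightarrow> f z = g z"
  shows "partial_deriv i f a = partial_deriv i g a"
  unfolding partial_deriv_def
proof (rule deriv_cong_ev)
  show "\<forall>\<^sub>F s in nhds (a i). f (a(i := s)) = g (a(i := s))"
    unfolding eventually_nhds_metric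
  proof (intro exI[of _ r] conjI allI impI assms(3))
    fix s assume "dist s (a i) < r"
    then show "f (a(i := s)) = g (a(i := s))"
      by (intro assms(4) fun_upd_cube assms(1,2)) (simp add: dist_real_def)
  qed
qed simp

text \<open>Divide \<open>g\<close> in direction \<open>i\<close> to get \<open>q\<close>, then
  \<open>q\<close> in direction \<open>j\<close> to get \<open>p\<close>. Both mixed derivatives at
  \<open>a\<close> turn out to be \<open>p a\<close>.\<close>

lemma real_analytic_at_partial_commute:
  assumes g: "real_analytic_at n g a" and a: "a \<in> euc n" and i: "i < n" and j: "j < n"
  shows "partial_deriv i (partial_deriv j g) a = partial_deriv j (partial_deriv i g) a"
proof (cases "i = j")
  case False
  obtain q r1 where r1: "r1 > 0" and q: "real_analytic_at n q a"
    and hq: "\<And>z. z \<in> cube n a r1 \<Longrightarrow> g z = g (z(i := a i)) + (z i - a i) * q z"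
    using g i by (rule real_analytic_at_divided_difference) (rule that)
  obtain p r2 where r2: "r2 > 0" and p: "real_analytic_at n p a"
    and hp: "\<And>z. z \<in> cube n a r2 \<Longrightarrow> q z = q (z(j := a j)) + (z j - a j) * p z"
    using q j by (rule real_analytic_at_divided_difference) (rule that)
  obtain r3 where r3: "r3 > 0" and g3: "\<And>b. \<forall>i<n. \<bar>b i - a i\<bar> \<le> r3 \<Longrightarrow> real_analytic_at n g b"
    using real_analytic_at_near[OF g] by blast
  obtain r4 where r4: "r4 > 0" and q4: "\<And>b. \<forall>i<n. \<bar>b i - a i\<bar> \<le> r4 \<Longrightarrow> real_analytic_at n q b"
    using real_analytic_at_near[OF q] by blast
  obtain r5 where r5: "r5 > 0" and p5: "\<And>b. \<forall>i<n. \<bar>b i - a i\<bar> \<le> r5 \<Longrightarrow> real_analytic_at n p b"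
    using real_analytic_at_near[OF p] by blast
  define r where "r = min r1 (min r2 (min r3 (min r4 r5)))"
  have r: "r > 0" "r \<le> r1" "r \<le> r2" "r \<le> r3" "r \<le> r4" "r \<le> r5"
    using r1 r2 r3 r4 r5 by (auto simp: r_def)
  \<comment> \<open>From a point of the cube of radius \<open>s\<close> one may move by another
    \<open>s\<close> without leaving the cube of radius \<open>r\<close>.\<close>
  define s where "s = r / 2"
  have s: "s > 0" "s \<le> r" using r by (auto simp: s_def)
  have line: "z(k := z k + u) \<in> cube n a r" if "z \<in> cube n a s" "k < n" "\<bar>u\<bar> \<le> s" for z k u
    by (rule cube_cube[OF that(1), of _ s])
       (use that in \<open>auto simp: s_def cube_iff intro!: fun_upd_euc\<close>)
  have in_r: "z \<in> cube n a r" if "z \<in> cube n a s" for z using that s(2) by (rule cube_mono)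
  have nearby: "real_analytic_at n g z" "real_analytic_at n q z" "real_analytic_at n p z" if "z \<in> cube n a r" for z
  proof -
    have "\<forall>i<n. \<bar>z i - a i\<bar> \<le> r'" if "r \<le> r'" for r'
      using \<open>z \<in> cube n a r\<close> that by (auto simp: cube_iff)
    then show "real_analytic_at n g z" "real_analytic_at n q z" "real_analytic_at n p z"
      using g3 q4 p5 r by blast+
  qed
  have sub: "z \<in> cube n a r1" "z \<in> cube n a r2" if "z \<in> cube n a r" for z
    using that r cube_mono by blast+
  have pi: "partial_deriv i g z = q z" if z: "z \<in> cube n a s" "z i = a i" for z
  proof (rule partial_derivI, rule has_real_derivative_partial_aux[OF _ _ i s(1)])
    show "real_analytic_at n q z" "z \<in> euc n" using z in_r nearby by (auto simp: cube_iff)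
    fix w assume w: "w \<in> cube n z s"
    have "w \<in> cube n a r" by (rule cube_cube[OF z(1) w]) (simp add: s_def)
    from hq[OF sub(1)[OF this]] show "g w = g (w(i := z i)) + (w i - z i) * q w" by (simp add: z)
  qed
  have "partial_deriv j (partial_deriv i g) a = partial_deriv j q a"
  proof -
    have "\<forall>\<^sub>F u in nhds (a j). partial_deriv i g (a(j := u)) = q (a(j := u))"
      unfolding eventually_nhds_metric
    proof (intro exI[of _ s] conjI allI impI s(1))
      fix u assume "dist u (a j) < s"
      then show "partial_deriv i g (a(j := u)) = q (a(j := u))"
        by (intro pi fun_upd_cube a j) (use False in \<open>auto simp: dist_real_def\<close>)
    qed
    then show ?thesis unfolding partial_deriv_def[of j] by (rule deriv_cong_ev) simp
  qed
  also have "\<dots> = p a"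
    by (rule partial_derivI, rule has_real_derivative_partial_aux[OF p a j r2 hp])
  finally have eq1: "partial_deriv j (partial_deriv i g) a = p a" .
  have pj: "partial_deriv j g (a(i := u)) = partial_deriv j g a + (u - a i) * p (a(i := u))"
    if u: "\<bar>u - a i\<bar> \<le> s" for u
  proof (rule partial_derivI)
    define z where "z = a(i := u)"
    have z: "z \<in> cube n a s" unfolding z_def using u by (intro fun_upd_cube a i)
    have zr: "z \<in> cube n a r" using z by (rule in_r)
    have ze: "z \<in> euc n" using z by (simp add: cube_iff)
    have zj: "z j = a j" using False by (simp add: z_def)
    have d1: "((\<lambda>v. g (a(j := v))) has_real_derivative partial_deriv j g a) (at (z j))"
      unfolding zj by (rule real_analytic_at_has_partial[OF g a j])
    have d2: "((\<lambda>v. (v - z j) * p (z(j := v))) has_real_derivative 1 * p (z(j := z j))) (at (z j))"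
      by (rule has_derivative_mult_at_zero)
         (use real_analytic_at_tendsto_line[OF nearby(3)[OF zr] ze j] in \<open>auto intro!: derivative_eq_intros\<close>)
    have d: "((\<lambda>v. g (a(j := v)) + ((u - a i) * q z + (u - a i) * ((v - z j) * p (z(j := v))))) has_real_derivative
        (partial_deriv j g a + (u - a i) * p z)) (at (z j))"
      using DERIV_add[OF d1 DERIV_add[OF DERIV_const[of "(u - a i) * q z"] DERIV_cmult[OF d2, of "u - a i"]]]
      by simp
    have "\<forall>\<^sub>F v in nhds (z j). g (a(j := v)) + ((u - a i) * q z + (u - a i) * ((v - z j) * p (z(j := v)))) = g (z(j := v))"
      unfolding eventually_nhds_metric
    proof (intro exI[of _ s] conjI allI impI s(1))
      fix v assume v: "dist v (z j) < s"
      have "z(j := z j + (v - z j)) \<in> cube n a r" using v by (intro line z j) (simp add: dist_real_def)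
      then have w: "z(j := v) \<in> cube n a r" by simp
      have "(z(j := v))(i := a i) = a(j := v)" "(z(j := v))(j := a j) = z" "(z(j := v)) i = u"
        using False by (auto simp: z_def fun_eq_iff)
      then have "g (z(j := v)) = g (a(j := v)) + (u - a i) * q (z(j := v))"
        and "q (z(j := v)) = q z + (v - a j) * p (z(j := v))"
        using hq[OF sub(1)[OF w]] hp[OF sub(2)[OF w]] by simp_all
      then show "g (a(j := v)) + ((u - a i) * q z + (u - a i) * ((v - z j) * p (z(j := v)))) = g (z(j := v))"
        by (simp add: zj algebra_simps)
    qed
    from DERIV_cong_ev[OF refl this refl] d
    show "((\<lambda>v. g ((a(i := u))(j := v))) has_real_derivative partial_deriv j g a + (u - a i) * p (a(i := u))) (at ((a(i := u)) j))"
      by (simp add: z_def)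
  qed
  have "partial_deriv i (partial_deriv j g) a = p a"
  proof (rule partial_derivI)
    have "((\<lambda>u. (u - a i) * p (a(i := u))) has_real_derivative 1 * p (a(i := a i))) (at (a i))"
      by (rule has_derivative_mult_at_zero)
         (use real_analytic_at_tendsto_line[OF p a i] in \<open>auto intro!: derivative_eq_intros\<close>)
    from DERIV_add[OF DERIV_const[of "partial_deriv j g a"] this]
    have d: "((\<lambda>u. partial_deriv j g a + (u - a i) * p (a(i := u))) has_real_derivative p a) (at (a i))"
      by simp
    have "\<forall>\<^sub>F u in nhds (a i). partial_deriv j g a + (u - a i) * p (a(i := u)) = partial_deriv j g (a(i := u))"
      unfolding eventually_nhds_metric
      by (intro exI[of _ s] conjI allI impI s(1)) (simp add: pj dist_real_def)
    from DERIV_cong_ev[OF refl this refl] d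
    show "((\<lambda>u. partial_deriv j g (a(i := u))) has_real_derivative p a) (at (a i))" by simp
  qed
  with eq1 show ?thesis by simp
qed simp

text \<open>An iterated derivative in direction \<open>i\<close> sees only the line through
  \<open>z\<close> in that direction. With \<open>i\<close> the time slot of a chart expression,
  this identifies its iterated partial derivatives with those taken in time at a fixed
  point.\<close>

lemma partial_deriv_funpow:
  "(partial_deriv i ^^ k) h z = (deriv ^^ k) (\<lambda>s. h (z(i := s))) (z i)"
proof (induction k arbitrary: z)
  case (Suc k)
  have "(\<lambda>s. (partial_deriv i ^^ k) h (z(i := s))) = (deriv ^^ k) (\<lambda>s. h (z(i := s)))"
    by (rule ext) (simp only: Suc fun_upd_upd fun_upd_same)
  then show ?case
    unfolding funpow.simps(2) comp_apply partial_deriv_def[of i "(partial_deriv i ^^ k) h" z] by (simp only:)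
qed simp

lemma real_analytic_at_funpow:
  assumes "real_analytic_at n h a" "a \<in> euc n" "i < n"
  shows "real_analytic_at n ((partial_deriv i ^^ k) h) a"
  by (induction k) (simp_all add: assms real_analytic_at_partial)

lemma real_analytic_at_near_cube:
  assumes "real_analytic_at n g a"
  obtains r where "r > 0" "\<And>b. b \<in> cube n a r \<Longrightarrow> real_analytic_at n g b"
  using real_analytic_at_near[OF assms] unfolding cube_iff by blast

lemma partial_deriv_funpow_commute:
  assumes "real_analytic_at n h a" "a \<in> euc n" "i < n" "l < n"
  shows "partial_deriv l ((partial_deriv i ^^ k) h) a = (partial_deriv i ^^ k) (partial_deriv l h) a"
  using assms(1,2)
proof (induction k arbitrary: a)
  case (Suc k)
  obtain r where r: "r > 0" "\<And>b. b \<in> cube n a r \<Longrightarrow> real_analytic_at n h b"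
    using Suc.prems(1) by (rule real_analytic_at_near_cube) (rule that)
  have "partial_deriv l (partial_deriv i ((partial_deriv i ^^ k) h)) a =
      partial_deriv i (partial_deriv l ((partial_deriv i ^^ k) h)) a"
    using Suc.prems assms(3,4) by (intro real_analytic_at_partial_commute real_analytic_at_funpow)
  \<comment> \<open>The outer derivative needs the induction hypothesis on a whole cube, hence the
    induction with \<open>a\<close> arbitrary.\<close>
  also have "\<dots> = partial_deriv i ((partial_deriv i ^^ k) (partial_deriv l h)) a"
    by (rule partial_deriv_cong[OF Suc.prems(2) assms(3) r(1)])
       (use Suc.IH r(2) in \<open>auto simp: cube_iff\<close>)
  finally show ?case by simp
qed simp

section \<open>A fixed point theorem and Taylor coefficients\<close>

text \<open>\<open>\<delta>\<close> measures differences relative to the size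
  \<open>\<sigma>\<close> of a factor. A product of degree \<open>k\<close> then varies by
  \<open>k * \<sigma> ^ k * \<delta>\<close>, and by the Leibniz rule this shape is preserved under
  products because degrees add.\<close>

lemma bseries_product_difference:
  assumes "bseries n a r (\<sigma> ^ k) f" "bseries n a r (\<sigma> ^ k) f'" "bseries n a r (real k * \<sigma> ^ k * \<delta>) (\<lambda>z. f z - f' z)"
    and "bseries n a r (\<sigma> ^ l) g" "bseries n a r (\<sigma> ^ l) g'" "bseries n a r (real l * \<sigma> ^ l * \<delta>) (\<lambda>z. g z - g' z)"
  shows "bseries n a r (\<sigma> ^ (k + l)) (\<lambda>z. f z * g z)" "bseries n a r (\<sigma> ^ (k + l)) (\<lambda>z. f' z * g' z)"
    "bseries n a r (real (k + l) * \<sigma> ^ (k + l) * \<delta>) (\<lambda>z. f z * g z - f' z * g' z)"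
proof -
  show "bseries n a r (\<sigma> ^ (k + l)) (\<lambda>z. f z * g z)" "bseries n a r (\<sigma> ^ (k + l)) (\<lambda>z. f' z * g' z)"
    using bseries_mult[OF assms(1,4)] bseries_mult[OF assms(2,5)] by (simp_all add: power_add)
  have "bseries n a r (\<sigma> ^ k * (real l * \<sigma> ^ l * \<delta>) + (real k * \<sigma> ^ k * \<delta>) * \<sigma> ^ l)
      (\<lambda>z. f z * (g z - g' z) + (f z - f' z) * g' z)"
    using bseries_add[OF bseries_mult[OF assms(1,6)] bseries_mult[OF assms(3,5)]] .
  then have "bseries n a r (\<sigma> ^ k * (real l * \<sigma> ^ l * \<delta>) + (real k * \<sigma> ^ k * \<delta>) * \<sigma> ^ l)
      (\<lambda>z. f z * g z - f' z * g' z)"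
    by (rule bseries_cong) (simp add: algebra_simps)
  then show "bseries n a r (real (k + l) * \<sigma> ^ (k + l) * \<delta>) (\<lambda>z. f z * g z - f' z * g' z)"
    by (rule bseries_mono) (simp add: power_add algebra_simps)
qed

lemma bseries_power_difference:
  assumes "bseries n a r \<sigma> f" "bseries n a r \<sigma> f'" "bseries n a r (\<sigma> * \<delta>) (\<lambda>z. f z - f' z)"
  shows "bseries n a r (real k * \<sigma> ^ k * \<delta>) (\<lambda>z. f z ^ k - f' z ^ k)"
proof (induction k)
  case 0
  show ?case using bseries_const[OF bseries_pos[OF assms(1)], of 0 0] by simp
next
  case (Suc k)
  have "bseries n a r (real (1 + k) * \<sigma> ^ (1 + k) * \<delta>) (\<lambda>z. f z * f z ^ k - f' z * f' z ^ k)"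
    by (rule bseries_product_difference(3)) (use assms bseries_power Suc in simp_all)
  then show ?case by simp
qed

lemma bseries_mpow_difference:
  assumes "\<And>i. i < k \<Longrightarrow> bseries n a r \<sigma> (\<lambda>z. f z i)" "\<And>i. i < k \<Longrightarrow> bseries n a r \<sigma> (\<lambda>z. f' z i)"
    "\<And>i. i < k \<Longrightarrow> bseries n a r (\<sigma> * \<delta>) (\<lambda>z. f z i - f' z i)" and r: "r > 0"
  shows "bseries n a r (\<sigma> ^ mdeg k m) (\<lambda>z. mpow k (f z) m) \<and> bseries n a r (\<sigma> ^ mdeg k m) (\<lambda>z. mpow k (f' z) m) \<and>
    bseries n a r (real (mdeg k m) * \<sigma> ^ mdeg k m * \<delta>) (\<lambda>z. mpow k (f z) m - mpow k (f' z) m)"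
  using assms(1-3)
proof (induction k)
  case 0
  show ?case using bseries_const[OF r, of 1 1] bseries_const[OF r, of 0 0] by (simp add: mpow_def mdeg_def)
next
  case (Suc k)
  have deg: "mdeg (Suc k) m = mdeg k m + m k" by (simp add: mdeg_def)
  have pow: "mpow (Suc k) u m = mpow k u m * u k ^ m k" for u by (simp add: mpow_def)
  note b = Suc.prems(1)[OF lessI] Suc.prems(2)[OF lessI] Suc.prems(3)[OF lessI]
  have IH: "bseries n a r (\<sigma> ^ mdeg k m) (\<lambda>z. mpow k (f z) m)" "bseries n a r (\<sigma> ^ mdeg k m) (\<lambda>z. mpow k (f' z) m)"
    "bseries n a r (real (mdeg k m) * \<sigma> ^ mdeg k m * \<delta>) (\<lambda>z. mpow k (f z) m - mpow k (f' z) m)"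
    using Suc.IH Suc.prems by (simp_all add: less_Suc_eq)
  show ?case unfolding deg pow
    using bseries_product_difference[OF IH bseries_power[OF b(1)] bseries_power[OF b(2)] bseries_power_difference[OF b]]
    by blast
qed

text \<open>A Lipschitz estimate for composition with \<open>g\<close>. The inner functions are held
  at norm \<open>\<rho> / 2\<close>, half the radius of \<open>g\<close>: the factor
  \<open>mdeg k m\<close>, by which a monomial magnifies differences, is then absorbed by
  \<open>2 ^ mdeg k m\<close>, and only the norm \<open>N\<close> of \<open>g\<close>
  remains.\<close>

lemma bseries_compose_difference:
  assumes g: "bseries k b \<rho> N g" and r: "r > 0"
    and f: "\<And>j. j < k \<Longrightarrow> bseries n a r (\<rho> / 2) (\<lambda>z. f z j - b j)"
    and f': "\<And>j. j < k \<Longrightarrow> bseries n a r (\<rho> / 2) (\<lambda>z. f' z j - b j)"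
    and d: "\<And>j. j < k \<Longrightarrow> bseries n a r d (\<lambda>z. f z j - f' z j)"
    and f0: "\<And>z. z \<in> cube n a r \<Longrightarrow> f z \<in> euc k" "\<And>z. z \<in> cube n a r \<Longrightarrow> f' z \<in> euc k" and d0: "d \<ge> 0"
  shows "bseries n a r (N * (2 * d / \<rho>)) (\<lambda>z. g (f z) - g (f' z))"
proof -
  have \<rho>: "\<rho> > 0" using g by (rule bseries_pos)
  obtain c where c: "(\<lambda>m. \<bar>c m\<bar> * \<rho> ^ mdeg k m) summable_on multi_idx k"
     "infsum (\<lambda>m. \<bar>c m\<bar> * \<rho> ^ mdeg k m) (multi_idx k) \<le> N"
     "\<And>z. z \<in> cube k b \<rho> \<Longrightarrow> ((\<lambda>m. c m * mpow k (\<lambda>i. z i - b i) m) has_sum g z) (multi_idx k)"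
    using g by (rule bseriesE) (rule that)
  \<comment> \<open>The difference \<open>d\<close> relative to the size
    \<open>\<rho> / 2\<close>.\<close>
  define \<delta> where "\<delta> = 2 * d / \<rho>"
  have \<delta>: "(\<rho> / 2) * \<delta> = d" "\<delta> \<ge> 0" using \<rho> d0 by (auto simp: \<delta>_def)
  have fz: "f z \<in> cube k b \<rho>" "f' z \<in> cube k b \<rho>" if z: "z \<in> cube n a r" for z
  proof -
    have "\<bar>f z j - b j\<bar> \<le> \<rho>" "\<bar>f' z j - b j\<bar> \<le> \<rho>" if "j < k" for j
      using bseries_abs_le[OF f[OF that] z] bseries_abs_le[OF f'[OF that] z] \<rho> by linarith+
    then show "f z \<in> cube k b \<rho>" "f' z \<in> cube k b \<rho>" using f0 z by (auto simp: cube_iff)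
  qed
  have "bseries n a r (infsum (\<lambda>m. \<bar>c m\<bar> * \<rho> ^ mdeg k m) (multi_idx k) * \<delta>) (\<lambda>z. g (f z) - g (f' z))"
  proof (rule bseries_has_sum[OF r, where A = "multi_idx k"])
    fix m assume "m \<in> multi_idx k"
    have "bseries n a r (real (mdeg k m) * (\<rho> / 2) ^ mdeg k m * \<delta>)
        (\<lambda>z. mpow k (\<lambda>i. f z i - b i) m - mpow k (\<lambda>i. f' z i - b i) m)"
      by (rule bseries_mpow_difference[THEN conjunct2, THEN conjunct2]) (use f f' d r \<delta> in auto)
    moreover have "real (mdeg k m) * (\<rho> / 2) ^ mdeg k m * \<delta> \<le> \<rho> ^ mdeg k m * \<delta>"
    proof (rule mult_right_mono[OF _ \<delta>(2)])
      have "real (mdeg k m) \<le> 2 ^ mdeg k m" using less_exp[of "mdeg k m"]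
        by (metis less_imp_le of_nat_le_iff of_nat_numeral of_nat_power)
      then have "real (mdeg k m) * (\<rho> / 2) ^ mdeg k m \<le> 2 ^ mdeg k m * (\<rho> / 2) ^ mdeg k m"
        using \<rho> by (intro mult_right_mono) auto
      also have "\<dots> = \<rho> ^ mdeg k m" by (simp add: power_mult_distrib[symmetric])
      finally show "real (mdeg k m) * (\<rho> / 2) ^ mdeg k m \<le> \<rho> ^ mdeg k m" .
    qed
    ultimately have "bseries n a r (\<rho> ^ mdeg k m * \<delta>)
        (\<lambda>z. mpow k (\<lambda>i. f z i - b i) m - mpow k (\<lambda>i. f' z i - b i) m)" by (rule bseries_mono)
    from bseries_cmult[OF this, of "c m"]
    show "bseries n a r (\<bar>c m\<bar> * \<rho> ^ mdeg k m * \<delta>)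
        (\<lambda>z. c m * (mpow k (\<lambda>i. f z i - b i) m - mpow k (\<lambda>i. f' z i - b i) m))"
      by (simp only: mult.assoc)
  next
    show "((\<lambda>m. \<bar>c m\<bar> * \<rho> ^ mdeg k m * \<delta>) has_sum infsum (\<lambda>m. \<bar>c m\<bar> * \<rho> ^ mdeg k m) (multi_idx k) * \<delta>) (multi_idx k)"
      by (intro has_sum_cmult_left has_sum_infsum c(1))
    fix z assume z: "z \<in> cube n a r"
    have "((\<lambda>m. c m * mpow k (\<lambda>i. f z i - b i) m + - (c m * mpow k (\<lambda>i. f' z i - b i) m)) has_sum g (f z) + - g (f' z)) (multi_idx k)"
      by (intro has_sum_add c(3) fz z) (simp only: has_sum_uminus minus_minus c(3) fz z)
    then show "((\<lambda>m. c m * (mpow k (\<lambda>i. f z i - b i) m - mpow k (\<lambda>i. f' z i - b i) m)) has_sum g (f z) - g (f' z)) (multi_idx k)"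
      by (simp add: right_diff_distrib)
  qed
  then show ?thesis unfolding \<delta>_def[symmetric]
    by (rule bseries_mono) (rule mult_right_mono[OF c(2) \<delta>(2)])
qed

text \<open>The equation is solved by Picard iteration: on cubes of radius \<open>r\<close> the factor \<open>w n\<close> has norm \<open>r\<close>
  and makes the right-hand side a contraction.\<close>

lemma real_analytic_at_fixpoint:
  assumes S: "\<And>j. j < n \<Longrightarrow> real_analytic_at (Suc n) (S j) a" and a: "a \<in> euc n" and \<epsilon>: "\<epsilon> > 0"
  obtains \<Psi> r where "r > 0" "\<And>j. j \<le> n \<Longrightarrow> real_analytic_at (Suc n) (\<lambda>w. \<Psi> w j) a"
    "\<And>w. w \<in> cube (Suc n) a r \<Longrightarrow> \<Psi> w \<in> cube (Suc n) a \<epsilon>"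
    "\<And>w. w \<in> cube (Suc n) a r \<Longrightarrow> \<Psi> w n = w n"
    "\<And>w j. w \<in> cube (Suc n) a r \<Longrightarrow> j < n \<Longrightarrow> \<Psi> w j = w j - w n * S j (\<Psi> w)"
proof -
  have an: "a n = 0" and a': "a \<in> euc (Suc n)" using a by (auto simp: euc_iff)
  obtain \<rho>0 N0 where \<rho>0: "\<rho>0 > 0" "\<And>j. j \<in> {..<n} \<Longrightarrow> bseries (Suc n) a \<rho>0 (N0 j) (S j)"
    by (rule real_analytic_at_family[of "{..<n}" "Suc n" S a]) (use S in auto)
  define \<rho> where "\<rho> = min \<rho>0 \<epsilon>"
  have \<rho>: "\<rho> > 0" "\<rho> \<le> \<rho>0" "\<rho> \<le> \<epsilon>" using \<rho>0 \<epsilon> by (auto simp: \<rho>_def)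
  define N where "N = (\<Sum>j<n. \<bar>N0 j\<bar>)"
  have N: "N \<ge> 0" by (simp add: N_def sum_nonneg)
  have bS: "bseries (Suc n) a \<rho> N (S j)" if "j < n" for j
  proof -
    have "bseries (Suc n) a \<rho> (N0 j) (S j)"
      by (rule bseries_radius_mono[OF \<rho>0(2)]) (use that \<rho> in auto)
    moreover have "\<bar>N0 j\<bar> \<le> N" unfolding N_def using that by (intro member_le_sum) auto
    then have "N0 j \<le> N" by linarith
    ultimately show ?thesis by (rule bseries_mono)
  qed
  \<comment> \<open>This gives \<open>r + r * N = \<rho> / 4\<close>. The iterates then stay within
    norm \<open>\<rho> / 2\<close> of \<open>a\<close>, as the Lipschitz estimate demands, and the
    contraction factor \<open>2 * r * N / \<rho>\<close> is at most \<open>1 / 2\<close>.\<close>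
  define r where "r = \<rho> / (4 * (1 + N))"
  have r: "r > 0" using \<rho> N by (simp add: r_def)
  have "r * m = \<rho> / 4" if "r = \<rho> / (4 * m)" "m > 0" for m using that by simp
  from this[OF r_def] have rN: "r + r * N = \<rho> / 4" using N by (simp add: distrib_left)
  have rN0: "r * N \<ge> 0" using r N by simp
  \<comment> \<open>Slot \<open>n\<close> is time and is carried along unchanged; the slots above it
    are set to 0 so that every iterate is a point of \<open>euc (Suc n)\<close>, whatever
    \<open>w\<close> is.\<close>
  define P where "P = rec_nat (\<lambda>w j. if j \<le> n then w j else (0::real))
     (\<lambda>_ Q w j. if j < n then w j - w n * S j (Q w) else if j = n then w n else 0)"
  have P0: "P 0 w j = (if j \<le> n then w j else 0)" for w j by (simp add: P_def)
  have PS: "P (Suc k) w j = (if j < n then w j - w n * S j (P k w) else if j = n then w n else 0)" for k w j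
    by (simp add: P_def)
  have Pe: "P k w \<in> euc (Suc n)" for k w by (cases k) (auto simp: euc_iff P0 PS)
  have coord: "bseries (Suc n) a r r (\<lambda>w. w j - a j)" if "j \<le> n" for j
    using bseries_coord0[OF r, of j "Suc n" a] that by simp
  have time: "bseries (Suc n) a r r (\<lambda>w. w n)" using coord[of n] by (simp add: an)
  have half: "r \<le> \<rho> / 2" using rN rN0 \<rho> by linarith
  have A: "bseries (Suc n) a r (\<rho> / 2) (\<lambda>w. P k w j - a j)" if "j < Suc n" for k j
    using that
  proof (induction k arbitrary: j)
    case 0
    then have "(\<lambda>w. P 0 w j - a j) = (\<lambda>w. w j - a j)" by (auto simp: P0)
    then show ?case using bseries_mono[OF coord[of j] half] 0 by simp
  next
    case (Suc k)
    show ?case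
    proof (cases "j < n")
      case True
      have "bseries (Suc n) a r N (\<lambda>w. S j (P k w))"
      proof (rule bseries_compose[OF bS[OF True] _ _ r])
        fix i assume "i < Suc n"
        show "bseries (Suc n) a r \<rho> (\<lambda>w. P k w i - a i)"
          by (rule bseries_mono[OF Suc.IH[OF \<open>i < Suc n\<close>]]) (use \<rho> in simp)
      qed (use Pe in \<open>auto simp: euc_iff\<close>)
      then have "bseries (Suc n) a r (r + r * N) (\<lambda>w. (w j - a j) - w n * S j (P k w))"
        by (intro bseries_diff bseries_mult time coord) (use True in simp)
      then have "bseries (Suc n) a r (\<rho> / 2) (\<lambda>w. (w j - a j) - w n * S j (P k w))"
        by (rule bseries_mono) (use rN \<rho> in simp)
      then show ?thesis by (rule bseries_cong) (simp add: PS True)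
    next
      case False
      then have "j = n" using Suc.prems by simp
      have "bseries (Suc n) a r (\<rho> / 2) (\<lambda>w. w n)" by (rule bseries_mono[OF time half])
      then show ?thesis by (rule bseries_cong) (simp add: PS \<open>j = n\<close> an)
    qed
  qed
  have B: "bseries (Suc n) a r ((1 / 2) ^ k * \<rho>) (\<lambda>w. P (Suc k) w j - P k w j)" if "j < Suc n" for k j
    using that
  proof (induction k arbitrary: j)
    case 0
    have "bseries (Suc n) a r (\<rho> / 2 + \<rho> / 2) (\<lambda>w. (P (Suc 0) w j - a j) - (P 0 w j - a j))"
      by (rule bseries_diff[OF A[OF 0] A[OF 0]])
    then show ?case by simp
  next
    case (Suc k)
    show ?case
    proof (cases "j < n")
      case True
      let ?d = "(1 / 2) ^ k * \<rho>"
      have "bseries (Suc n) a r (N * (2 * ?d / \<rho>)) (\<lambda>w. S j (P (Suc k) w) - S j (P k w))"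
        by (rule bseries_compose_difference[OF bS[OF True] r A A Suc.IH Pe Pe]) (use \<rho> in auto)
      from bseries_mult[OF time this]
      have "bseries (Suc n) a r (\<bar>-1\<bar> * (r * (N * (2 * ?d / \<rho>)))) (\<lambda>w. (-1) * (w n * (S j (P (Suc k) w) - S j (P k w))))"
        by (rule bseries_cmult)
      then have "bseries (Suc n) a r (r * (N * (2 * ?d / \<rho>))) (\<lambda>w. P (Suc (Suc k)) w j - P (Suc k) w j)"
        unfolding abs_minus_cancel abs_one mult_1
        by (rule bseries_cong) (simp add: PS True algebra_simps)
      then show ?thesis
      proof (rule bseries_mono)
        have "r * (N * (2 * ?d / \<rho>)) = (r * N) * 2 * (1 / 2) ^ k" using \<rho> by simp
        also have "\<dots> \<le> (\<rho> / 4) * 2 * (1 / 2) ^ k"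
          using rN r by (intro mult_right_mono) auto
        also have "\<dots> = (1 / 2) ^ Suc k * \<rho>" by simp
        finally show "r * (N * (2 * ?d / \<rho>)) \<le> (1 / 2) ^ Suc k * \<rho>" .
      qed
    next
      case False
      then have "j = n" using Suc.prems by simp
      have "bseries (Suc n) a r ((1 / 2) ^ Suc k * \<rho>) (\<lambda>_. 0)" using r \<rho> by (intro bseries_const) auto
      then show ?thesis by (rule bseries_cong) (simp add: PS \<open>j = n\<close>)
    qed
  qed
  \<comment> \<open>The limit is written as the start plus the telescoping series of increments,
    because \<open>bseries_has_sum\<close> then yields its analyticity.\<close>
  define D where "D w j = infsum (\<lambda>k. P (Suc k) w j - P k w j) UNIV" for w j
  define \<Psi> where "\<Psi> w j = (if j \<le> n then P 0 w j + D w j else 0)" for w j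
  have geo: "((\<lambda>k. (1 / 2) ^ k * \<rho>) has_sum 2 * \<rho>) (UNIV :: nat set)"
  proof (rule sums_nonneg_imp_has_sum)
    show "(\<lambda>k. (1 / 2) ^ k * \<rho>) sums (2 * \<rho>)"
      using sums_mult2[OF geometric_sums[of "1 / 2 :: real"], of \<rho>] by simp
  qed (use \<rho> in auto)
  have Dsum: "((\<lambda>k. P (Suc k) w j - P k w j) has_sum D w j) UNIV" if "w \<in> cube (Suc n) a r" "j \<le> n" for w j
    unfolding D_def
    by (rule has_sum_infsum, rule summable_on_bounded_real[OF has_sum_imp_summable[OF geo]])
       (use bseries_abs_le[OF B that(1)] that in auto)
  have bD: "bseries (Suc n) a r (2 * \<rho>) (\<lambda>w. D w j)" if "j \<le> n" for j
    by (rule bseries_has_sum[OF r _ geo Dsum[OF _ that]]) (use B that in auto)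
  have ana: "real_analytic_at (Suc n) (\<lambda>w. \<Psi> w j) a" if "j \<le> n" for j
  proof -
    have "real_analytic_at (Suc n) (\<lambda>w. w j + D w j) a"
      using that by (intro real_analytic_at_add real_analytic_at_coord bseries_imp_real_analytic[OF bD]) auto
    moreover have "(\<lambda>w. \<Psi> w j) = (\<lambda>w. w j + D w j)" using that by (auto simp: \<Psi>_def P0)
    ultimately show ?thesis by simp
  qed
  have lim: "(\<lambda>k. P k w j) \<longlonglongrightarrow> \<Psi> w j" if w: "w \<in> cube (Suc n) a r" and j: "j \<le> n" for w j
  proof -
    have "(\<lambda>k. P (Suc k) w j - P k w j) sums D w j" using Dsum[OF w j] by (rule has_sum_imp_sums)
    then have "(\<lambda>K. \<Sum>k<K. P (Suc k) w j - P k w j) \<longlonglongrightarrow> D w j" by (simp add: sums_def)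
    then have "(\<lambda>K. P 0 w j + (P K w j - P 0 w j)) \<longlonglongrightarrow> P 0 w j + D w j"
      by (intro tendsto_add tendsto_const) (simp only: sum_lessThan_telescope[of "\<lambda>k. P k w j"])
    then show ?thesis using j by (simp add: \<Psi>_def)
  qed
  have \<Psi>e: "\<Psi> w \<in> euc (Suc n)" for w by (auto simp: euc_iff \<Psi>_def)
  have near: "\<Psi> w \<in> cube (Suc n) a (\<rho> / 2)" if w: "w \<in> cube (Suc n) a r" for w
  proof -
    have "\<bar>\<Psi> w j - a j\<bar> \<le> \<rho> / 2" if "j < Suc n" for j
    proof (rule Lim_bounded)
      show "(\<lambda>k. \<bar>P k w j - a j\<bar>) \<longlonglongrightarrow> \<bar>\<Psi> w j - a j\<bar>"
        using lim[OF w, of j] that by (intro tendsto_intros) auto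
      show "\<forall>k\<ge>0. \<bar>P k w j - a j\<bar> \<le> \<rho> / 2" using bseries_abs_le[OF A[OF that] w] by blast
    qed
    then show ?thesis using \<Psi>e by (simp add: cube_iff)
  qed
  have \<Psi>n: "\<Psi> w n = w n" if "w \<in> cube (Suc n) a r" for w
  proof (rule LIMSEQ_unique[OF lim[OF that order_refl]])
    have "P k w n = w n" for k by (cases k) (simp_all add: P0 PS)
    then show "(\<lambda>k. P k w n) \<longlonglongrightarrow> w n" by simp
  qed
  have eq: "\<Psi> w j = w j - w n * S j (\<Psi> w)" if w: "w \<in> cube (Suc n) a r" and j: "j < n" for w j
  proof (rule LIMSEQ_unique)
    \<comment> \<open>Passing to the limit in the iteration needs continuity of \<open>S j\<close>
      at \<open>\<Psi> w\<close> rather than at \<open>a\<close>. The distance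
      \<open>\<rho> / 2\<close> leaves room to recentre the series there.\<close>
    have "real_analytic_at (Suc n) (S j) (\<Psi> w)"
      by (rule bseries_imp_real_analytic[OF bseries_translate[OF bS[OF j], of "\<rho> / 2"]])
         (use near[OF w] \<rho> in \<open>auto simp: cube_iff\<close>)
    then have "(\<lambda>k. S j (P k w)) \<longlonglongrightarrow> S j (\<Psi> w)"
      by (rule real_analytic_at_tendsto[OF _ \<Psi>e]) (use lim[OF w] Pe in auto)
    then have "(\<lambda>k. w j - w n * S j (P k w)) \<longlonglongrightarrow> w j - w n * S j (\<Psi> w)"
      by (intro tendsto_intros)
    then show "(\<lambda>k. P (Suc k) w j) \<longlonglongrightarrow> w j - w n * S j (\<Psi> w)" using j by (simp add: PS)
    show "(\<lambda>k. P (Suc k) w j) \<longlonglongrightarrow> \<Psi> w j" using lim[OF w, of j] j by (intro LIMSEQ_Suc) auto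
  qed
  show thesis
  proof (rule that[OF r ana _ \<Psi>n eq])
    fix w assume "w \<in> cube (Suc n) a r"
    from near[OF this] show "\<Psi> w \<in> cube (Suc n) a \<epsilon>" by (rule cube_mono) (use \<rho> in simp)
  qed
qed

section \<open>Taylor coefficients in one and two variables\<close>

definition taylor_coeff :: "nat \<Rightarrow> (real \<Rightarrow> real) \<Rightarrow> real" where
  "taylor_coeff k F = (deriv ^^ k) F 0 / fact k"

text \<open>The family has positive convergence radius and so is a formal power series expansion of
  \<open>F\<close>; termwise differentiation then identifies \<open>(deriv ^^ k) F 0\<close> with
  \<open>fact k * c k\<close>.\<close>

lemma taylor_coeff_unique:
  assumes r: "r > 0" and F: "\<And>t. \<bar>t\<bar> \<le> r \<Longrightarrow> ((\<lambda>k. c k * t ^ k) has_sum F t) UNIV"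
  shows "taylor_coeff k F = c k"
proof -
  have sums: "(\<lambda>k. c k * t ^ k) sums F t" if "\<bar>t\<bar> \<le> r" for t
    using F[OF that] by (rule has_sum_imp_sums)
  have "conv_radius c \<ge> norm r"
    using sums[of r] r by (intro conv_radius_geI) (simp add: sums_iff)
  then have cr: "fps_conv_radius (Abs_fps c) > 0"
    using r by (simp add: fps_conv_radius_def) (metis ereal_less(2) less_le_trans)
  have "\<forall>\<^sub>F t in nhds 0. eval_fps (Abs_fps c) t = F t"
    unfolding eventually_nhds_metric
  proof (intro exI[of _ r] conjI allI impI r)
    fix t :: real assume "dist t 0 < r"
    then have "(\<lambda>k. c k * t ^ k) sums F t" by (intro sums) (simp add: dist_real_def)
    then show "eval_fps (Abs_fps c) t = F t" by (simp add: eval_fps_def sums_iff)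
  qed
  with cr have "F has_fps_expansion Abs_fps c" by (simp add: has_fps_expansion_def)
  then have "(deriv ^^ k) F has_fps_expansion (fps_deriv ^^ k) (Abs_fps c)"
    by (induction k) (simp_all add: has_fps_expansion_deriv)
  then have "(deriv ^^ k) F 0 = eval_fps ((fps_deriv ^^ k) (Abs_fps c)) 0"
    using eventually_nhds_x_imp_x[of "\<lambda>z. eval_fps ((fps_deriv ^^ k) (Abs_fps c)) z = (deriv ^^ k) F z" 0]
    unfolding has_fps_expansion_def by simp
  also have "\<dots> = fps_nth ((fps_deriv ^^ k) (Abs_fps c)) 0" by (rule eval_fps_at_0)
  also have "\<dots> = fact k * c k" by (simp add: fps_0th_higher_deriv)
  finally show ?thesis by (simp add: taylor_coeff_def)
qed

lemma cube_one: "(\<lambda>i. if i = 0 then t else 0) \<in> cube 1 (\<lambda>_. 0) r \<longleftrightarrow> \<bar>t\<bar> \<le> r"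
  by (auto simp: cube_iff euc_iff)

lemma taylor_has_sum:
  assumes "bseries 1 (\<lambda>_. 0) r N (\<lambda>z. F (z 0))" "\<bar>t\<bar> \<le> r"
  shows "((\<lambda>k. taylor_coeff k F * t ^ k) has_sum F t) UNIV"
proof -
  have r: "r > 0" using assms(1) by (rule bseries_pos)
  obtain c where c: "(\<lambda>m. \<bar>c m\<bar> * r ^ mdeg 1 m) summable_on multi_idx 1"
     "infsum (\<lambda>m. \<bar>c m\<bar> * r ^ mdeg 1 m) (multi_idx 1) \<le> N"
     "\<And>z. z \<in> cube 1 (\<lambda>_. 0) r \<Longrightarrow> ((\<lambda>m. c m * mpow 1 (\<lambda>i. z i - 0) m) has_sum F (z 0)) (multi_idx 1)"
    using assms(1) by (rule bseriesE) (rule that)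
  define e where "e k = (\<lambda>i::nat. if i = 0 then k else (0::nat))" for k :: nat
  have *: "((\<lambda>k. c (e k) * s ^ k) has_sum F s) UNIV" if s: "\<bar>s\<bar> \<le> r" for s
  proof -
    have "((\<lambda>m. c m * mpow 1 (\<lambda>i. (if i = 0 then s else 0) - 0) m) has_sum F s) (multi_idx 1)"
      using c(3)[OF cube_one[THEN iffD2, OF s]] by simp
    moreover have bij: "bij_betw e UNIV (multi_idx 1)"
    proof (rule bij_betwI[where g = "\<lambda>m. m 0"])
      show "e ((\<lambda>m. m 0) m) = m" if "m \<in> multi_idx 1" for m
        using that by (auto simp: e_def multi_idx_def fun_eq_iff)
    qed (auto simp: e_def multi_idx_def)
    ultimately have "((\<lambda>k. c (e k) * mpow 1 (\<lambda>i. (if i = 0 then s else 0) - 0) (e k)) has_sum F s) UNIV"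
      by (simp only: has_sum_reindex_bij_betw[OF bij, of "\<lambda>m. c m * mpow 1 (\<lambda>i. (if i = 0 then s else 0) - 0) m"])
    then show ?thesis by (simp add: mpow_def e_def)
  qed
  have "taylor_coeff k F = c (e k)" for k by (rule taylor_coeff_unique[OF r *])
  then show ?thesis using *[OF assms(2)] by simp
qed

text \<open>Absolute convergence lets the double series of \<open>G s t\<close> be summed in two
  ways: along rows, which gives the coefficients in \<open>s\<close> as functions of
  \<open>t\<close>, and, for \<open>s = t\<close>, along the antidiagonals of total degree
  \<open>k\<close>.\<close>

lemma taylor_coeff_diagonal:
  assumes "real_analytic_at 2 (\<lambda>z. G (z 0) (z 1)) (\<lambda>_. 0)"
  shows "taylor_coeff k (\<lambda>t. G t t) = (\<Sum>i\<le>k. taylor_coeff (k - i) (\<lambda>t. taylor_coeff i (\<lambda>s. G s t)))"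
proof -
  obtain r N where r: "r > 0" and b: "bseries 2 (\<lambda>_. 0) r N (\<lambda>z. G (z 0) (z 1))"
    using assms by (rule real_analytic_atE)
  obtain c where c: "(\<lambda>m. \<bar>c m\<bar> * r ^ mdeg 2 m) summable_on multi_idx 2"
     "infsum (\<lambda>m. \<bar>c m\<bar> * r ^ mdeg 2 m) (multi_idx 2) \<le> N"
     "\<And>z. z \<in> cube 2 (\<lambda>_. 0) r \<Longrightarrow> ((\<lambda>m. c m * mpow 2 (\<lambda>i. z i - 0) m) has_sum G (z 0) (z 1)) (multi_idx 2)"
    using b by (rule bseriesE) (rule that)
  define e where "e = (\<lambda>(k :: nat, l :: nat) (i :: nat). if i = 0 then k else if i = 1 then l else 0 :: nat)"
  have bij: "bij_betw e (UNIV \<times> UNIV) (multi_idx 2)"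
  proof (rule bij_betwI[where g = "\<lambda>m. (m 0, m 1)"])
    show "e ((\<lambda>m. (m 0, m 1)) m) = m" if "m \<in> multi_idx 2" for m
      using that by (auto simp: e_def multi_idx_def fun_eq_iff numeral_2_eq_2)
  qed (auto simp: e_def multi_idx_def)
  have *: "((\<lambda>(k, l). c (e (k, l)) * s ^ k * t ^ l) has_sum G s t) (UNIV \<times> UNIV)"
    if st: "\<bar>s\<bar> \<le> r" "\<bar>t\<bar> \<le> r" for s t
  proof -
    define z where "z i = (if i = 0 then s else if i = 1 then t else 0)" for i :: nat
    have zs: "z 0 = s" "z 1 = t" by (simp_all add: z_def)
    have "z \<in> cube 2 (\<lambda>_. 0) r" using st by (auto simp: z_def cube_iff euc_iff)
    from c(3)[OF this] have "((\<lambda>m. c m * mpow 2 z m) has_sum G s t) (multi_idx 2)" by (simp only: diff_zero zs)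
    then have "((\<lambda>x. c (e x) * mpow 2 z (e x)) has_sum G s t) (UNIV \<times> UNIV)"
      by (simp only: has_sum_reindex_bij_betw[OF bij, of "\<lambda>m. c m * mpow 2 z m"])
    moreover have "c (e x) * mpow 2 z (e x) = (case x of (k, l) \<Rightarrow> c (e (k, l)) * s ^ k * t ^ l)" for x
      by (cases x) (simp add: mpow_def e_def z_def numeral_2_eq_2)
    ultimately show ?thesis by simp
  qed
  have abs_r: "\<bar>r\<bar> \<le> r" using r by simp
  define h where "h i t = infsum (\<lambda>l. c (e (i, l)) * t ^ l) UNIV" for i t
  have h: "((\<lambda>l. c (e (i, l)) * t ^ l) has_sum h i t) UNIV" if "\<bar>t\<bar> \<le> r" for i t
  proof -
    \<comment> \<open>A row of the double series at \<open>s = r\<close> is summable, and division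
      by \<open>r ^ i\<close> removes the power of \<open>s\<close>.\<close>
    have "(\<lambda>(k, l). c (e (k, l)) * r ^ k * t ^ l) summable_on (UNIV \<times> UNIV)"
      using *[OF abs_r that] by (rule has_sum_imp_summable)
    then have "(\<lambda>l. c (e (i, l)) * r ^ i * t ^ l) summable_on UNIV"
      by (rule summable_on_SigmaD1[where f = "\<lambda>k l. c (e (k, l)) * r ^ k * t ^ l"]) simp
    then have "(\<lambda>l. (c (e (i, l)) * r ^ i * t ^ l) * (1 / r ^ i)) summable_on UNIV"
      by (rule summable_on_cmult_left)
    then show ?thesis unfolding h_def using r by (intro has_sum_infsum) simp
  qed
  have tc1: "taylor_coeff i (\<lambda>s. G s t) = h i t" if t: "\<bar>t\<bar> \<le> r" for i t
  proof (rule taylor_coeff_unique[OF r])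
    fix s assume s: "\<bar>s\<bar> \<le> r"
    show "((\<lambda>k. h k t * s ^ k) has_sum G s t) UNIV"
    proof (rule has_sum_SigmaD[OF *[OF s t]])
      fix k :: nat
      have "((\<lambda>l. (c (e (k, l)) * t ^ l) * s ^ k) has_sum h k t * s ^ k) UNIV"
        by (rule has_sum_cmult_left[OF h[OF t]])
      then show "((\<lambda>l. case (k, l) of (k, l) \<Rightarrow> c (e (k, l)) * s ^ k * t ^ l) has_sum h k t * s ^ k) UNIV"
        by (simp add: mult_ac)
    qed
  qed
  have tc2: "taylor_coeff l (\<lambda>t. taylor_coeff i (\<lambda>s. G s t)) = c (e (i, l))" for i l
  proof (rule taylor_coeff_unique[OF r])
    fix t assume "\<bar>t\<bar> \<le> r"
    then show "((\<lambda>l. c (e (i, l)) * t ^ l) has_sum taylor_coeff i (\<lambda>s. G s t)) UNIV"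
      using h tc1 by simp
  qed
  have "taylor_coeff k (\<lambda>t. G t t) = (\<Sum>i\<le>k. c (e (i, k - i)))"
  proof (rule taylor_coeff_unique[OF r])
    fix t assume t: "\<bar>t\<bar> \<le> r"
    define f where "f = (\<lambda>(k, l). c (e (k, l)) * t ^ k * t ^ l)"
    have bij2: "bij_betw (\<lambda>(k, i). (i, k - i)) (Sigma UNIV (\<lambda>k. {..k})) (UNIV \<times> (UNIV :: nat set))"
      by (rule bij_betwI[where g = "\<lambda>(i, l). (i + l, i)"]) auto
    have "((\<lambda>x. f ((\<lambda>(k, i). (i, k - i)) x)) has_sum G t t) (Sigma UNIV (\<lambda>k. {..k}))"
      unfolding has_sum_reindex_bij_betw[OF bij2] f_def by (rule *[OF t t])
    then show "((\<lambda>k. (\<Sum>i\<le>k. c (e (i, k - i))) * t ^ k) has_sum G t t) UNIV"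
    proof (rule has_sum_SigmaD)
      fix k :: nat
      show "((\<lambda>i. f ((\<lambda>(k, i). (i, k - i)) (k, i))) has_sum (\<Sum>i\<le>k. c (e (i, k - i))) * t ^ k) {..k}"
      proof (rule has_sum_finiteI)
        have "f (i, k - i) = c (e (i, k - i)) * t ^ k" if "i \<le> k" for i
          using that by (simp add: f_def mult.assoc power_add[symmetric])
        then show "(\<Sum>i\<le>k. c (e (i, k - i))) * t ^ k = (\<Sum>i\<le>k. f ((\<lambda>(k, i). (i, k - i)) (k, i)))"
          by (simp add: sum_distrib_right)
      qed simp
    qed
  qed
  then show ?thesis by (simp add: tc2)
qed

section \<open>Charts, tangent vectors and tensors\<close>

text \<open>A basic open neighbourhood in the product topology restricts coordinates separately.
  Only the first \<open>n\<close> of them need a radius, since the others are 0 for \<open>z\<close>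
  and for \<open>a\<close>.\<close>

lemma openin_Euclidean_space_cube:
  assumes "openin (Euclidean_space n) S" "a \<in> S"
  shows "\<exists>r>0. cube n a r \<subseteq> S"
proof -
  obtain T where T: "openin (powertop_real UNIV) T" "S = T \<inter> {x. \<forall>i\<ge>n. x i = 0}"
    using assms(1) unfolding Euclidean_space_def openin_subtopology by blast
  have "a \<in> T" using assms(2) T(2) by blast
  then obtain V where V: "a \<in> (\<Pi>\<^sub>E i\<in>UNIV. V i)" "\<And>i. open (V i)" "(\<Pi>\<^sub>E i\<in>UNIV. V i) \<subseteq> T"
    using product_topology_open_contains_basis[OF T(1), of a] by (auto simp: open_openin[symmetric])
  have "\<exists>s>0. \<forall>i\<in>{..<n}. \<forall>s'. 0 < s' \<and> s' \<le> s \<longrightarrow> (\<forall>t. \<bar>t - a i\<bar> \<le> s' \<longrightarrow> t \<in> V i)"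
  proof (rule finite_uniform_radius)
    fix i
    have "a i \<in> V i" using V(1) by (auto simp: PiE_iff)
    then obtain e where e: "e > 0" "cball (a i) e \<subseteq> V i" using V(2) open_contains_cball by blast
    show "\<exists>s>0. \<forall>s'. 0 < s' \<and> s' \<le> s \<longrightarrow> (\<forall>t. \<bar>t - a i\<bar> \<le> s' \<longrightarrow> t \<in> V i)"
    proof (intro exI[of _ e] conjI allI impI e(1))
      fix s' t assume "0 < s' \<and> s' \<le> e" "\<bar>t - a i\<bar> \<le> s'"
      then have "t \<in> cball (a i) e" by (simp add: dist_real_def abs_minus_commute)
      then show "t \<in> V i" using e(2) by blast
    qed
  qed simp
  then obtain s where s: "s > 0" "\<forall>i\<in>{..<n}. \<forall>t. \<bar>t - a i\<bar> \<le> s \<longrightarrow> t \<in> V i" by auto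
  have "cube n a s \<subseteq> S"
  proof
    fix z assume z: "z \<in> cube n a s"
    have "z i \<in> V i" for i
    proof (cases "i < n")
      case True
      then show ?thesis using s(2) z by (auto simp: cube_def)
    next
      case False
      then have "z i = a i" using z assms(2) T(2) by (auto simp: cube_def)
      then show ?thesis using V(1) by (auto simp: PiE_iff)
    qed
    then have "z \<in> T" using V(3) by (auto simp: PiE_iff)
    then show "z \<in> S" using z T(2) by (auto simp: cube_def)
  qed
  with s(1) show ?thesis by blast
qed

lemma openin_open_cube:
  "openin (Euclidean_space n) {z \<in> euc n. \<forall>i<n. \<bar>z i - a i\<bar> < r}"
proof -
  have "open (\<Inter>i\<in>{..<n}. {z :: nat \<Rightarrow> real. \<bar>z i - a i\<bar> < r})"
    by (intro open_INT ballI open_Collect_less continuous_intros) auto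
  then have "openin (powertop_real UNIV) (\<Inter>i\<in>{..<n}. {z. \<bar>z i - a i\<bar> < r})"
    by (simp only: euclidean_product_topology open_openin)
  then have "openin (Euclidean_space n) ({x. \<forall>i\<ge>n. x i = 0} \<inter> (\<Inter>i\<in>{..<n}. {z. \<bar>z i - a i\<bar> < r}))"
    unfolding Euclidean_space_def by (rule openin_subtopology_Int2)
  moreover have "{x. \<forall>i\<ge>n. x i = 0} \<inter> (\<Inter>i\<in>{..<n}. {z. \<bar>z i - a i\<bar> < r}) = {z \<in> euc n. \<forall>i<n. \<bar>z i - a i\<bar> < r}"
    by (auto simp: euc_iff)
  ultimately show ?thesis by simp
qed

text \<open>Tangent vectors and covectors are both real functions; the expansion of linear forms in a frame
  is needed for either kind.\<close>

lemma linear_on_sum: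
  fixes S :: "('b \<Rightarrow> real) set" and L :: "('b \<Rightarrow> real) \<Rightarrow> real"
  assumes closed: "\<And>u v a b. u \<in> S \<Longrightarrow> v \<in> S \<Longrightarrow> (\<lambda>f. a * u f + b * v f) \<in> S"
    and lin: "\<And>u v a b. u \<in> S \<Longrightarrow> v \<in> S \<Longrightarrow> L (\<lambda>f. a * u f + b * v f) = a * L u + b * L v"
    and z: "(\<lambda>_. 0) \<in> S" and u: "\<And>j. j < (n::nat) \<Longrightarrow> u j \<in> S"
  shows "(\<lambda>f. \<Sum>j<n. k j * u j f) \<in> S \<and> L (\<lambda>f. \<Sum>j<n. k j * u j f) = (\<Sum>j<n. k j * L (u j))"
  using u
proof (induction n)
  case 0
  show ?case using lin[OF z z, of 0 0] z by simp
next
  case (Suc n)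
  have IH: "(\<lambda>f. \<Sum>j<n. k j * u j f) \<in> S" "L (\<lambda>f. \<Sum>j<n. k j * u j f) = (\<Sum>j<n. k j * L (u j))"
    using Suc by auto
  have un: "u n \<in> S" using Suc.prems by simp
  show ?case using closed[OF IH(1) un, of 1 "k n"] lin[OF IH(1) un, of 1 "k n"] IH(2) by simp
qed

section \<open>Multi-indices and the expansion of multilinear forms\<close>

lemma finite_multi_indices: "finite (multi_indices n p)"
proof -
  have "multi_indices n p = {I. set I \<subseteq> {..<n} \<and> length I = p}" by (auto simp: multi_indices_def)
  then show ?thesis by (simp add: finite_lists_length_eq)
qed

lemma multi_indices_Suc:
  "multi_indices n (Suc p) = (\<lambda>(j, I). j # I) ` ({..<n} \<times> multi_indices n p)"
proof
  show "multi_indices n (Suc p) \<subseteq> (\<lambda>(j, I). j # I) ` ({..<n} \<times> multi_indices n p)"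
  proof
    fix I assume I: "I \<in> multi_indices n (Suc p)"
    then obtain j J where "I = j # J" by (cases I) (auto simp: multi_indices_def)
    then show "I \<in> (\<lambda>(j, I). j # I) ` ({..<n} \<times> multi_indices n p)"
      using I by (auto simp: multi_indices_def)
  qed
qed (auto simp: multi_indices_def)

lemma sum_multi_indices_Suc:
  "(\<Sum>I\<in>multi_indices n (Suc p). h I) = (\<Sum>j<n. \<Sum>I\<in>multi_indices n p. h (j # I))"
proof -
  have "inj_on (\<lambda>(j, I). j # I) ({..<n} \<times> multi_indices n p)" by (auto simp: inj_on_def)
  then have "(\<Sum>I\<in>multi_indices n (Suc p). h I) =
      (\<Sum>x\<in>{..<n} \<times> multi_indices n p. h ((\<lambda>(j, I). j # I) x))"
    unfolding multi_indices_Suc by (subst sum.reindex) (simp_all add: comp_def)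
  also have "\<dots> = (\<Sum>(j, I)\<in>{..<n} \<times> multi_indices n p. h (j # I))"
    by (rule sum.cong) auto
  finally show ?thesis by (simp add: sum.cartesian_product)
qed

text \<open>Linearity is assumed only in the form of an expansion of each slot, with abstract
  coefficients \<open>k u j\<close>. The same induction on the number of slots thus serves vectors,
  whose coefficients are values on coordinates, and covectors, whose coefficients are values on the
  frame.\<close>

lemma multilinear_expansion:
  fixes F :: "'b list \<Rightarrow> real"
  assumes e: "\<And>j. j < n \<Longrightarrow> e j \<in> S"
    and F: "\<And>us i. length us = p \<Longrightarrow> set us \<subseteq> S \<Longrightarrow> i < p \<Longrightarrow> F us = (\<Sum>j<n. k (us ! i) j * F (us[i := e j]))"
    and us: "length us = p" "set us \<subseteq> S"
  shows "F us = (\<Sum>I\<in>multi_indices n p. F (map e I) * (\<Prod>r<p. k (us ! r) (I ! r)))"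
  using F us
proof (induction p arbitrary: F us)
  case 0
  have "multi_indices n 0 = {[]}" by (auto simp: multi_indices_def)
  then show ?case using 0 by simp
next
  case (Suc p)
  obtain u us' where us: "us = u # us'" "length us' = p" "set us' \<subseteq> S" "u \<in> S"
    using Suc.prems(2,3) by (cases us) auto
  have IH: "F (e j # us') = (\<Sum>I\<in>multi_indices n p. F (e j # map e I) * (\<Prod>r<p. k (us' ! r) (I ! r)))"
    if j: "j < n" for j
  proof (rule Suc.IH[of "\<lambda>us. F (e j # us)", OF _ us(2,3)])
    fix vs i assume v: "length vs = p" "set vs \<subseteq> S" "i < p"
    then show "F (e j # vs) = (\<Sum>l<n. k (vs ! i) l * F (e j # vs[i := e l]))"
      using Suc.prems(1)[of "e j # vs" "Suc i"] e[OF j] by simp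
  qed
  have "F us = (\<Sum>j<n. k u j * F (e j # us'))" using Suc.prems(1)[of us 0] Suc.prems(2,3) us(1) by simp
  also have "\<dots> = (\<Sum>j<n. \<Sum>I\<in>multi_indices n p. F (map e (j # I)) * (\<Prod>r<Suc p. k (us ! r) ((j # I) ! r)))"
    by (rule sum.cong) (simp_all add: IH sum_distrib_left us(1) prod.lessThan_Suc_shift mult_ac del: prod.lessThan_Suc)
  also have "\<dots> = (\<Sum>I\<in>multi_indices n (Suc p). F (map e I) * (\<Prod>r<Suc p. k (us ! r) (I ! r)))"
    by (rule sum_multi_indices_Suc[symmetric])
  finally show ?case .
qed

abbreviation chart_inv :: "'a chart \<Rightarrow> (nat \<Rightarrow> real) \<Rightarrow> 'a" where
  "chart_inv C \<equiv> inv_into (fst C) (snd C)"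

section \<open>Charts and analytic functions on a manifold\<close>

locale analytic_manifold =
  fixes M :: "'a manifold"
  assumes manifold: "real_analytic_manifold M"
begin

abbreviation "dimM \<equiv> mdim M"
abbreviation "carrier \<equiv> topspace (mtop M)"
abbreviation "T \<equiv> tangent_space M"
abbreviation "T' \<equiv> cotangent_space M"
abbreviation "frame \<equiv> coord_vec M"
abbreviation "coframe \<equiv> coord_covec M"
abbreviation "analytic_at \<equiv> analytic_fun_at M"

lemma atlas_facts:
  assumes "C \<in> atlas M"
  shows "openin (mtop M) (fst C)" "openin (Euclidean_space dimM) (snd C ` fst C)"
    "homeomorphic_map (subtopology (mtop M) (fst C)) (subtopology (Euclidean_space dimM) (snd C ` fst C)) (snd C)"
proof -
  have "\<forall>C\<in>atlas M. openin (mtop M) (fst C) \<and> openin (Euclidean_space dimM) (snd C ` fst C) \<and>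
    homeomorphic_map (subtopology (mtop M) (fst C)) (subtopology (Euclidean_space dimM) (snd C ` fst C)) (snd C)"
    using manifold unfolding real_analytic_manifold_def case_prod_unfold by (elim conjE)
  then show "openin (mtop M) (fst C)" "openin (Euclidean_space dimM) (snd C ` fst C)"
    "homeomorphic_map (subtopology (mtop M) (fst C)) (subtopology (Euclidean_space dimM) (snd C ` fst C)) (snd C)"
    using assms by simp_all
qed

lemma chart_exists: "x \<in> carrier \<Longrightarrow> \<exists>C. C \<in> atlas M \<and> x \<in> fst C"
proof -
  assume x: "x \<in> carrier"
  have "(\<Union>C\<in>atlas M. fst C) = carrier"
    using manifold unfolding real_analytic_manifold_def case_prod_unfold by (elim conjE)
  with x show ?thesis by blast
qed

lemma chart_subset: "C \<in> atlas M \<Longrightarrow> fst C \<subseteq> carrier"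
  by (rule openin_subset[OF atlas_facts(1)])

lemma chart_carrier: "C \<in> atlas M \<Longrightarrow> x \<in> fst C \<Longrightarrow> x \<in> carrier"
  by (rule subsetD[OF chart_subset])

lemma chart_topspace: "C \<in> atlas M \<Longrightarrow> topspace (subtopology (mtop M) (fst C)) = fst C"
  using chart_subset[of C] by (simp only: topspace_subtopology Int_absorb1)

lemma chart_inj: "C \<in> atlas M \<Longrightarrow> inj_on (snd C) (fst C)"
  using homeomorphic_imp_injective_map[OF atlas_facts(3)] chart_topspace by simp

lemma chart_inv_chart [simp]: "C \<in> atlas M \<Longrightarrow> x \<in> fst C \<Longrightarrow> chart_inv C (snd C x) = x"
  using chart_inj by (simp add: inv_into_f_f)

lemma chart_euc: "C \<in> atlas M \<Longrightarrow> x \<in> fst C \<Longrightarrow> snd C x \<in> euc dimM"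
  using openin_subset[OF atlas_facts(2)] by blast

text \<open>The device for moving local statements into coordinates: \<open>inv_into\<close> is
  meaningful only on the image of the chart, and on a small cube it is a true inverse with values in
  the prescribed neighbourhood.\<close>

lemma chart_nbhd:
  assumes C: "C \<in> atlas M" "x \<in> fst C" and V: "openin (mtop M) V" "x \<in> V"
  obtains r where "r > 0" "\<And>z. z \<in> cube dimM (snd C x) r \<Longrightarrow>
    z \<in> snd C ` fst C \<and> chart_inv C z \<in> fst C \<and> chart_inv C z \<in> V \<and> snd C (chart_inv C z) = z"
proof -
  have "openin (subtopology (mtop M) (fst C)) (fst C \<inter> V)"
    using V(1) by (rule openin_subtopology_Int2)
  then have "openin (subtopology (Euclidean_space dimM) (snd C ` fst C)) (snd C ` (fst C \<inter> V))"
    using homeomorphic_imp_open_map[OF atlas_facts(3)[OF C(1)]] unfolding open_map_def by blast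
  then have "openin (Euclidean_space dimM) (snd C ` (fst C \<inter> V))"
    using atlas_facts(2)[OF C(1)] by (rule openin_trans_full)
  from openin_Euclidean_space_cube[OF this, of "snd C x"] C V
  obtain r where r: "r > 0" "cube dimM (snd C x) r \<subseteq> snd C ` (fst C \<inter> V)" by blast
  have "z \<in> snd C ` fst C \<and> chart_inv C z \<in> fst C \<and> chart_inv C z \<in> V \<and> snd C (chart_inv C z) = z"
    if z: "z \<in> cube dimM (snd C x) r" for z
  proof -
    obtain y where y: "y \<in> fst C" "y \<in> V" "z = snd C y" using r(2) z by blast
    then show ?thesis using C(1) by simp
  qed
  with r(1) show thesis by (rule that)
qed

lemma chart_cube_open:
  assumes C: "C \<in> atlas M" "x \<in> fst C" and r: "r > 0"
  obtains V where "openin (mtop M) V" "x \<in> V" "V \<subseteq> fst C" "\<And>y. y \<in> V \<Longrightarrow> snd C y \<in> cube dimM (snd C x) r"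
proof -
  let ?B = "{z \<in> euc dimM. \<forall>i<dimM. \<bar>z i - snd C x i\<bar> < r}"
  let ?V = "{y \<in> fst C. snd C y \<in> ?B}"
  have "continuous_map (subtopology (mtop M) (fst C)) (Euclidean_space dimM) (snd C)"
    using homeomorphic_imp_continuous_map[OF atlas_facts(3)[OF C(1)]] by (simp add: continuous_map_in_subtopology)
  from openin_continuous_map_preimage[OF this openin_open_cube[of dimM "snd C x" r]]
  have "openin (subtopology (mtop M) (fst C)) ?V" by (simp only: chart_topspace[OF C(1)])
  then have "openin (mtop M) ?V" using atlas_facts(1)[OF C(1)] by (rule openin_trans_full)
  moreover have "x \<in> ?V" using C r chart_euc by auto
  moreover have "\<And>y. y \<in> ?V \<Longrightarrow> snd C y \<in> cube dimM (snd C x) r" by (force simp: cube_iff)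
  ultimately show thesis using that[of ?V] by blast
qed

lemma transition_analytic:
  assumes "C \<in> atlas M" "D \<in> atlas M" "x \<in> fst C" "x \<in> fst D" "j < dimM"
  shows "real_analytic_at dimM (\<lambda>z. snd D (chart_inv C z) j) (snd C x)"
proof -
  have "\<forall>C\<in>atlas M. \<forall>D\<in>atlas M. \<forall>x\<in>fst C \<inter> fst D. \<forall>j<dimM.
      real_analytic_at dimM (\<lambda>z. snd D (chart_inv C z) j) (snd C x)"
    using manifold unfolding real_analytic_manifold_def case_prod_unfold by (elim conjE)
  then show ?thesis using assms by blast
qed

lemma analytic_atD:
  "analytic_at f x \<Longrightarrow> C \<in> atlas M \<Longrightarrow> x \<in> fst C \<Longrightarrow> real_analytic_at dimM (\<lambda>z. f (chart_inv C z)) (snd C x)"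
  unfolding analytic_fun_at_def case_prod_unfold by blast

lemma analytic_atI:
  "(\<And>C. C \<in> atlas M \<Longrightarrow> x \<in> fst C \<Longrightarrow> real_analytic_at dimM (\<lambda>z. f (chart_inv C z)) (snd C x)) \<Longrightarrow> analytic_at f x"
  unfolding analytic_fun_at_def case_prod_unfold by blast

text \<open>The definition quantifies over all charts at \<open>x\<close>. One of them suffices,
  because any other chart expression arises by composing with an analytic transition map.\<close>

lemma analytic_at_chart:
  assumes C: "C \<in> atlas M" "x \<in> fst C" and f: "real_analytic_at dimM (\<lambda>z. f (chart_inv C z)) (snd C x)"
  shows "analytic_at f x"
proof (rule analytic_atI)
  fix D assume D: "D \<in> atlas M" "x \<in> fst D"
  obtain r where r: "r > 0" and h: "\<And>z. z \<in> cube dimM (snd D x) r \<Longrightarrow>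
    z \<in> snd D ` fst D \<and> chart_inv D z \<in> fst D \<and> chart_inv D z \<in> fst C \<and> snd D (chart_inv D z) = z"
    using D atlas_facts(1)[OF C(1)] C(2) by (rule chart_nbhd) (rule that)
  have "real_analytic_at dimM (\<lambda>z. f (chart_inv C (snd C (chart_inv D z)))) (snd D x)"
  proof (rule real_analytic_at_compose[where g = "\<lambda>z. f (chart_inv C z)" and f = "\<lambda>z. snd C (chart_inv D z)",
        OF _ _ chart_euc[OF D] r])
    show "real_analytic_at dimM (\<lambda>z. f (chart_inv C z)) (snd C (chart_inv D (snd D x)))" using f D by simp
    show "real_analytic_at dimM (\<lambda>z. snd C (chart_inv D z) j) (snd D x)" if "j < dimM" for j
      using D(1) C(1) D(2) C(2) that by (rule transition_analytic)
    show "snd C (chart_inv D z) \<in> euc dimM" if "z \<in> cube dimM (snd D x) r" for z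
      using h[OF that] chart_euc[OF C(1)] by blast
  qed
  then show "real_analytic_at dimM (\<lambda>z. f (chart_inv D z)) (snd D x)"
    by (rule real_analytic_at_cong[OF _ r]) (use h C(1) in auto)
qed

lemma analytic_at_local:
  assumes "analytic_at f x" "openin (mtop M) V" "x \<in> V" "\<And>y. y \<in> V \<Longrightarrow> f y = g y"
  shows "analytic_at g x"
proof (rule analytic_atI)
  fix C assume C: "C \<in> atlas M" "x \<in> fst C"
  obtain r where r: "r > 0" and h: "\<And>z. z \<in> cube dimM (snd C x) r \<Longrightarrow>
    z \<in> snd C ` fst C \<and> chart_inv C z \<in> fst C \<and> chart_inv C z \<in> V \<and> snd C (chart_inv C z) = z"
    using C assms(2,3) by (rule chart_nbhd) (rule that)
  show "real_analytic_at dimM (\<lambda>z. g (chart_inv C z)) (snd C x)"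
    by (rule real_analytic_at_cong[OF analytic_atD[OF assms(1) C] r]) (use h assms(4) in auto)
qed

lemma analytic_at_const: "analytic_at (\<lambda>_. k) x"
  by (rule analytic_atI) (rule real_analytic_at_const)

lemma analytic_at_add: "analytic_at f x \<Longrightarrow> analytic_at g x \<Longrightarrow> analytic_at (\<lambda>y. f y + g y) x"
  by (rule analytic_atI) (intro real_analytic_at_add analytic_atD)

lemma analytic_at_diff: "analytic_at f x \<Longrightarrow> analytic_at g x \<Longrightarrow> analytic_at (\<lambda>y. f y - g y) x"
  by (rule analytic_atI) (intro real_analytic_at_diff analytic_atD)

lemma analytic_at_mult: "analytic_at f x \<Longrightarrow> analytic_at g x \<Longrightarrow> analytic_at (\<lambda>y. f y * g y) x"
  by (rule analytic_atI) (intro real_analytic_at_mult analytic_atD)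

lemma analytic_at_lincomb: "analytic_at f x \<Longrightarrow> analytic_at g x \<Longrightarrow> analytic_at (\<lambda>y. a * f y + b * g y) x"
  by (intro analytic_at_add analytic_at_mult analytic_at_const)

lemma analytic_at_sum: "(\<And>i. i \<in> A \<Longrightarrow> analytic_at (f i) x) \<Longrightarrow> analytic_at (\<lambda>y. \<Sum>i\<in>A. f i y) x"
  by (rule analytic_atI) (intro real_analytic_at_sum analytic_atD)

lemma analytic_at_coord:
  assumes "C \<in> atlas M" "x \<in> fst C" "j < dimM"
  shows "analytic_at (\<lambda>y. snd C y j) x"
  by (rule analytic_atI) (rule transition_analytic[OF _ assms(1) _ assms(2,3)])

section \<open>Derivations and the coordinate frame\<close>

lemma tangentD:
  assumes "v \<in> T x" "analytic_at f x" "analytic_at g x"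
  shows "v (\<lambda>y. a * f y + b * g y) = a * v f + b * v g" "v (\<lambda>y. f y * g y) = f x * v g + g x * v f"
  using assms unfolding tangent_space_def by blast+

lemma tangent_nonanalytic: "v \<in> T x \<Longrightarrow> \<not> analytic_at f x \<Longrightarrow> v f = 0"
  unfolding tangent_space_def by blast

lemma tangentI:
  assumes "\<And>f g a b. analytic_at f x \<Longrightarrow> analytic_at g x \<Longrightarrow> v (\<lambda>y. a * f y + b * g y) = a * v f + b * v g"
    "\<And>f g. analytic_at f x \<Longrightarrow> analytic_at g x \<Longrightarrow> v (\<lambda>y. f y * g y) = f x * v g + g x * v f"
    "\<And>f. \<not> analytic_at f x \<Longrightarrow> v f = 0"
  shows "v \<in> T x"
  unfolding tangent_space_def using assms by blast

lemma tangent_const: assumes "v \<in> T x" shows "v (\<lambda>_. k) = 0"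
proof -
  have "v (\<lambda>_. 1) = v (\<lambda>_. 1) + v (\<lambda>_. 1)"
    using tangentD(2)[OF assms analytic_at_const[of 1] analytic_at_const[of 1]] by simp
  then show ?thesis
    using tangentD(1)[OF assms analytic_at_const[of 1] analytic_at_const[of 1], of k 0] by simp
qed

lemma tangent_diff:
  assumes "v \<in> T x" "analytic_at f x" "analytic_at g x"
  shows "v (\<lambda>y. f y - g y) = v f - v g"
  using tangentD(1)[OF assms, of 1 "-1"] by simp

lemma tangent_sum:
  assumes "v \<in> T x" "\<And>i. i < n \<Longrightarrow> analytic_at (f i) x"
  shows "v (\<lambda>y. \<Sum>i<n. f i y) = (\<Sum>i<(n::nat). v (f i))"
  using assms(2)
proof (induction n)
  case 0
  show ?case using tangent_const[OF assms(1), of 0] by simp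
next
  case (Suc n)
  have "analytic_at (\<lambda>y. \<Sum>i<n. f i y) x" by (rule analytic_at_sum) (use Suc.prems in auto)
  from tangentD(1)[OF assms(1) this, of "f n" 1 1] show ?case using Suc by simp
qed

text \<open>The difference \<open>h = f - g\<close> equals \<open>h * \<kappa>\<close>, where
  \<open>\<kappa>\<close> is 0 on \<open>V\<close> and 1 elsewhere. Both factors vanish at
  \<open>x\<close>, so the Leibniz rule gives \<open>v h = 0\<close>; \<open>\<kappa>\<close> is
  analytic at \<open>x\<close> because it is constant nearby.\<close>

lemma tangent_local:
  assumes v: "v \<in> T x" and f: "analytic_at f x" and V: "openin (mtop M) V" "x \<in> V" "\<And>y. y \<in> V \<Longrightarrow> f y = g y"
  shows "v f = v g"
proof -
  have g: "analytic_at g x" using analytic_at_local[OF f V] .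
  define \<kappa> where "\<kappa> y = (if y \<in> V then 0 else 1 :: real)" for y
  have \<kappa>: "analytic_at \<kappa> x"
    by (rule analytic_at_local[OF analytic_at_const[of 0] V(1,2)]) (simp add: \<kappa>_def)
  define h where "h y = f y - g y" for y
  have h: "analytic_at h x" unfolding h_def by (rule analytic_at_diff[OF f g])
  have "(\<lambda>y. h y * \<kappa> y) = h" using V(3) by (auto simp: h_def \<kappa>_def fun_eq_iff)
  moreover have "v (\<lambda>y. h y * \<kappa> y) = h x * v \<kappa> + \<kappa> x * v h" by (rule tangentD(2)[OF v h \<kappa>])
  ultimately have "v h = 0" using V by (simp add: h_def \<kappa>_def)
  then show ?thesis using tangent_diff[OF v f g] by (simp add: h_def[abs_def])
qed

text \<open>Hadamard's lemma in the chart: apart from a constant, \<open>f\<close> is a sum of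
  products \<open>(z i - a i) * q i z\<close>, and the Leibniz rule keeps only the value of
  \<open>q i\<close> at the base point, which is the partial derivative.\<close>

lemma tangent_expand:
  assumes v: "v \<in> T x" and C: "C \<in> atlas M" "x \<in> fst C" and f: "analytic_at f x"
  shows "v f = (\<Sum>i<dimM. v (\<lambda>y. snd C y i) * chart_partial C i f x)"
proof -
  let ?F = "\<lambda>z. f (chart_inv C z)" and ?a = "snd C x"
  obtain q r where r: "r > 0" and q: "\<And>i. i < dimM \<Longrightarrow> real_analytic_at dimM (q i) ?a"
    and h: "\<And>z. z \<in> cube dimM ?a r \<Longrightarrow> ?F z = ?F ?a + (\<Sum>i<dimM. (z i - ?a i) * q i z)"
    and pd: "\<And>i. i < dimM \<Longrightarrow> q i ?a = partial_deriv i ?F ?a"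
    using analytic_atD[OF f C] chart_euc[OF C] by (rule real_analytic_at_hadamard) (rule that)
  obtain V where V: "openin (mtop M) V" "x \<in> V" "V \<subseteq> fst C" "\<And>y. y \<in> V \<Longrightarrow> snd C y \<in> cube dimM ?a r"
    using C r by (rule chart_cube_open) (rule that)
  obtain s where s: "s > 0" and hs: "\<And>z. z \<in> cube dimM ?a s \<Longrightarrow>
    z \<in> snd C ` fst C \<and> chart_inv C z \<in> fst C \<and> chart_inv C z \<in> fst C \<and> snd C (chart_inv C z) = z"
    using C atlas_facts(1)[OF C(1)] C(2) by (rule chart_nbhd) (rule that)
  have Q: "analytic_at (\<lambda>y. q i (snd C y)) x" if "i < dimM" for i
    by (rule analytic_at_chart[OF C], rule real_analytic_at_cong[OF q[OF that] s]) (use hs in auto)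
  have lin: "analytic_at (\<lambda>y. snd C y i - ?a i) x" if "i < dimM" for i
    by (intro analytic_at_diff analytic_at_const analytic_at_coord C that)
  have prod: "analytic_at (\<lambda>y. (snd C y i - ?a i) * q i (snd C y)) x" if "i < dimM" for i
    by (intro analytic_at_mult lin Q that)
  have sum: "analytic_at (\<lambda>y. \<Sum>i<dimM. (snd C y i - ?a i) * q i (snd C y)) x"
    by (rule analytic_at_sum) (use prod in auto)
  \<comment> \<open>The representation is valid near \<open>x\<close> only, hence the appeal to
    locality.\<close>
  have "v f = v (\<lambda>y. f x + (\<Sum>i<dimM. (snd C y i - ?a i) * q i (snd C y)))"
  proof (rule tangent_local[OF v f V(1,2)])
    fix y assume y: "y \<in> V"
    then have "y \<in> fst C" using V(3) by blast
    then show "f y = f x + (\<Sum>i<dimM. (snd C y i - ?a i) * q i (snd C y))"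
      using h[OF V(4)[OF y]] C by simp
  qed
  also have "\<dots> = v (\<lambda>y. \<Sum>i<dimM. (snd C y i - ?a i) * q i (snd C y))"
    using tangentD(1)[OF v analytic_at_const[of "f x"] sum, of 1 1] tangent_const[OF v] by simp
  also have "\<dots> = (\<Sum>i<dimM. v (\<lambda>y. (snd C y i - ?a i) * q i (snd C y)))"
    by (rule tangent_sum[OF v prod])
  also have "\<dots> = (\<Sum>i<dimM. v (\<lambda>y. snd C y i) * chart_partial C i f x)"
  proof (rule sum.cong[OF refl])
    fix i assume "i \<in> {..<dimM}"
    then have i: "i < dimM" by simp
    have "v (\<lambda>y. (snd C y i - ?a i) * q i (snd C y)) = q i ?a * v (\<lambda>y. snd C y i - ?a i)"
      using tangentD(2)[OF v lin[OF i] Q[OF i]] by simp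
    also have "v (\<lambda>y. snd C y i - ?a i) = v (\<lambda>y. snd C y i)"
      using tangent_diff[OF v analytic_at_coord[OF C i] analytic_at_const[of "?a i"]] tangent_const[OF v] by simp
    finally show "v (\<lambda>y. (snd C y i - ?a i) * q i (snd C y)) = v (\<lambda>y. snd C y i) * chart_partial C i f x"
      by (simp add: chart_partial_def pd[OF i])
  qed
  finally show ?thesis .
qed

lemma chart_has_partial:
  assumes "C \<in> atlas M" "x \<in> fst C" "analytic_at f x" "i < dimM"
  shows "((\<lambda>s. f (chart_inv C ((snd C x)(i := s)))) has_real_derivative chart_partial C i f x) (at (snd C x i))"
  unfolding chart_partial_def
  by (rule real_analytic_at_has_partial[OF analytic_atD[OF assms(3,1,2)] chart_euc[OF assms(1,2)] assms(4)])

lemma chart_partialI: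
  "((\<lambda>s. f (chart_inv C ((snd C x)(i := s)))) has_real_derivative D) (at (snd C x i)) \<Longrightarrow> chart_partial C i f x = D"
  unfolding chart_partial_def by (rule partial_derivI)

lemma chart_partial_lincomb:
  assumes C: "C \<in> atlas M" "x \<in> fst C" and f: "analytic_at f x" "analytic_at g x" and i: "i < dimM"
  shows "chart_partial C i (\<lambda>y. a * f y + b * g y) x = a * chart_partial C i f x + b * chart_partial C i g x"
  by (rule chart_partialI)
     (intro DERIV_add DERIV_cmult chart_has_partial[OF C _ i] f)

lemma coord_vec_eq: "analytic_at f x \<Longrightarrow> frame C i x f = chart_partial C i f x"
  by (simp add: coord_vec_def chart_partial_def)

lemma coord_vec_tangent:
  assumes C: "C \<in> atlas M" "x \<in> fst C" and i: "i < dimM"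
  shows "frame C i x \<in> T x"
proof (rule tangentI)
  fix f g a b assume f: "analytic_at f x" and g: "analytic_at g x"
  show "frame C i x (\<lambda>y. a * f y + b * g y) = a * frame C i x f + b * frame C i x g"
    using chart_partial_lincomb[OF C f g i] by (simp add: coord_vec_eq f g analytic_at_lincomb)
  have "chart_partial C i (\<lambda>y. f y * g y) x = chart_partial C i f x * g x + chart_partial C i g x * f x"
    by (rule chart_partialI)
       (use DERIV_mult[OF chart_has_partial[OF C f i] chart_has_partial[OF C g i]] C in simp)
  then show "frame C i x (\<lambda>y. f y * g y) = f x * frame C i x g + g x * frame C i x f"
    by (simp add: coord_vec_eq f g analytic_at_mult)
next
  fix f assume "\<not> analytic_at f x"
  then show "frame C i x f = 0" by (simp add: coord_vec_def)
qed

lemma coord_vec_coord: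
  assumes C: "C \<in> atlas M" "x \<in> fst C" and i: "i < dimM" "j < dimM"
  shows "frame C i x (\<lambda>y. snd C y j) = (if i = j then 1 else 0)"
proof -
  obtain s where s: "s > 0" and hs: "\<And>z. z \<in> cube dimM (snd C x) s \<Longrightarrow>
    z \<in> snd C ` fst C \<and> chart_inv C z \<in> fst C \<and> chart_inv C z \<in> fst C \<and> snd C (chart_inv C z) = z"
    using C atlas_facts(1)[OF C(1)] C(2) by (rule chart_nbhd) (rule that)
  have "partial_deriv i (\<lambda>z. snd C (chart_inv C z) j) (snd C x) = partial_deriv i (\<lambda>z. z j) (snd C x)"
    by (rule partial_deriv_cong[OF chart_euc[OF C] i(1) s]) (use hs in auto)
  also have "\<dots> = (if i = j then 1 else 0)"
    by (rule partial_derivI) (auto intro!: derivative_eq_intros)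
  finally show ?thesis using analytic_at_coord[OF C i(2)] by (simp add: coord_vec_def)
qed

lemma tangent_lincomb:
  assumes u: "u \<in> T x" and v: "v \<in> T x"
  shows "(\<lambda>f. a * u f + b * v f) \<in> T x"
proof (rule tangentI)
  fix f g c d assume f: "analytic_at f x" and g: "analytic_at g x"
  show "a * u (\<lambda>y. c * f y + d * g y) + b * v (\<lambda>y. c * f y + d * g y) = c * (a * u f + b * v f) + d * (a * u g + b * v g)"
    unfolding tangentD(1)[OF u f g] tangentD(1)[OF v f g] by (simp add: algebra_simps)
  show "a * u (\<lambda>y. f y * g y) + b * v (\<lambda>y. f y * g y) = f x * (a * u g + b * v g) + g x * (a * u f + b * v f)"
    unfolding tangentD(2)[OF u f g] tangentD(2)[OF v f g] by (simp add: algebra_simps)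
qed (simp add: tangent_nonanalytic[OF u] tangent_nonanalytic[OF v])

lemma tangent_zero: "(\<lambda>_. 0) \<in> T x"
  by (rule tangentI) simp_all

text \<open>Since both sides vanish on functions that are not analytic at \<open>x\<close>, the
  expansion is an equality of total functions and may be rewritten inside other terms.\<close>

lemma tangent_frame:
  assumes "v \<in> T x" "C \<in> atlas M" "x \<in> fst C"
  shows "(\<lambda>f. \<Sum>i<dimM. v (\<lambda>y. snd C y i) * frame C i x f) = v"
proof
  fix f
  show "(\<Sum>i<dimM. v (\<lambda>y. snd C y i) * frame C i x f) = v f"
  proof (cases "analytic_at f x")
    case True
    then show ?thesis using tangent_expand[OF assms True] by (simp add: coord_vec_eq)
  next
    case False
    then show ?thesis by (simp add: tangent_nonanalytic[OF assms(1)] coord_vec_def)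
  qed
qed

lemma tangent_linear_expand:
  assumes lin: "\<And>u v a b. u \<in> T x \<Longrightarrow> v \<in> T x \<Longrightarrow> L (\<lambda>f. a * u f + b * v f) = a * L u + b * L v"
    and C: "C \<in> atlas M" "x \<in> fst C" and v: "v \<in> T x"
  shows "L v = (\<Sum>i<dimM. v (\<lambda>y. snd C y i) * L (frame C i x))"
proof -
  have "L (\<lambda>f. \<Sum>i<dimM. v (\<lambda>y. snd C y i) * frame C i x f) = (\<Sum>i<dimM. v (\<lambda>y. snd C y i) * L (frame C i x))"
    by (rule linear_on_sum[where S = "T x" and L = L and n = dimM and k = "\<lambda>i. v (\<lambda>y. snd C y i)" and u = "\<lambda>i. frame C i x", THEN conjunct2])
       (use tangent_lincomb tangent_zero coord_vec_tangent[OF C] lin in auto)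
  then show ?thesis by (simp only: tangent_frame[OF v C])
qed

section \<open>Covectors and the coordinate coframe\<close>

lemma cotangentD: "\<omega> \<in> T' x \<Longrightarrow> u \<in> T x \<Longrightarrow> v \<in> T x \<Longrightarrow> \<omega> (\<lambda>f. a * u f + b * v f) = a * \<omega> u + b * \<omega> v"
  unfolding cotangent_space_def by blast

lemma cotangent_outside: "\<omega> \<in> T' x \<Longrightarrow> v \<notin> T x \<Longrightarrow> \<omega> v = 0"
  unfolding cotangent_space_def by blast

lemma cotangentI:
  assumes "\<And>u v a b. u \<in> T x \<Longrightarrow> v \<in> T x \<Longrightarrow> \<omega> (\<lambda>f. a * u f + b * v f) = a * \<omega> u + b * \<omega> v"
    "\<And>v. v \<notin> T x \<Longrightarrow> \<omega> v = 0"
  shows "\<omega> \<in> T' x"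
  unfolding cotangent_space_def using assms by blast

lemma cotangent_expand:
  assumes "\<omega> \<in> T' x" "C \<in> atlas M" "x \<in> fst C" "v \<in> T x"
  shows "\<omega> v = (\<Sum>i<dimM. v (\<lambda>y. snd C y i) * \<omega> (frame C i x))"
  by (rule tangent_linear_expand[OF _ assms(2-4)]) (rule cotangentD[OF assms(1)])

lemma cotangent_lincomb:
  assumes w: "\<omega> \<in> T' x" and t: "\<theta> \<in> T' x"
  shows "(\<lambda>v. a * \<omega> v + b * \<theta> v) \<in> T' x"
proof (rule cotangentI)
  fix u v c d assume uv: "u \<in> T x" "v \<in> T x"
  show "a * \<omega> (\<lambda>f. c * u f + d * v f) + b * \<theta> (\<lambda>f. c * u f + d * v f) =
      c * (a * \<omega> u + b * \<theta> u) + d * (a * \<omega> v + b * \<theta> v)"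
    unfolding cotangentD[OF w uv] cotangentD[OF t uv] by (simp add: algebra_simps)
qed (simp add: cotangent_outside[OF w] cotangent_outside[OF t])

lemma cotangent_zero: "(\<lambda>_. 0) \<in> T' x"
  by (rule cotangentI) simp_all

lemma coord_covec_cotangent:
  shows "coframe C j x \<in> T' x"
  by (rule cotangentI) (auto simp: coord_covec_def tangent_lincomb)

lemma coord_covec_coord_vec:
  assumes "C \<in> atlas M" "x \<in> fst C" "i < dimM" "j < dimM"
  shows "coframe C j x (frame C i x) = (if i = j then 1 else 0)"
  using coord_vec_tangent[OF assms(1-3)] coord_vec_coord[OF assms] by (simp add: coord_covec_def)

lemma cotangent_frame:
  assumes w: "\<omega> \<in> T' x" and C: "C \<in> atlas M" "x \<in> fst C"
  shows "(\<lambda>v. \<Sum>j<dimM. \<omega> (frame C j x) * coframe C j x v) = \<omega>"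
proof
  fix v
  show "(\<Sum>j<dimM. \<omega> (frame C j x) * coframe C j x v) = \<omega> v"
  proof (cases "v \<in> T x")
    case True
    then show ?thesis using cotangent_expand[OF w C True] by (simp add: coord_covec_def mult.commute)
  next
    case False
    then show ?thesis by (simp add: cotangent_outside[OF w] coord_covec_def)
  qed
qed

lemma cotangent_linear_expand:
  assumes lin: "\<And>u v a b. u \<in> T' x \<Longrightarrow> v \<in> T' x \<Longrightarrow> L (\<lambda>f. a * u f + b * v f) = a * L u + b * L v"
    and C: "C \<in> atlas M" "x \<in> fst C" and v: "\<omega> \<in> T' x"
  shows "L \<omega> = (\<Sum>j<dimM. \<omega> (frame C j x) * L (coframe C j x))"
proof -
  have "L (\<lambda>f. \<Sum>j<dimM. \<omega> (frame C j x) * coframe C j x f) = (\<Sum>j<dimM. \<omega> (frame C j x) * L (coframe C j x))"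
  proof (rule linear_on_sum[where S = "T' x" and L = L and n = dimM and k = "\<lambda>j. \<omega> (frame C j x)" and u = "\<lambda>j. coframe C j x", THEN conjunct2])
    fix u v a b assume uv: "u \<in> T' x" "v \<in> T' x"
    show "(\<lambda>f. a * u f + b * v f) \<in> T' x" using uv by (rule cotangent_lincomb)
    show "L (\<lambda>f. a * u f + b * v f) = a * L u + b * L v" using uv by (rule lin)
  qed (rule cotangent_zero coord_covec_cotangent)+
  then show ?thesis by (simp only: cotangent_frame[OF v C])
qed

section \<open>Tensors in coordinates\<close>

lemma tensor_argsI:
  "length vs = p \<Longrightarrow> set vs \<subseteq> T x \<Longrightarrow> length ws = q \<Longrightarrow> set ws \<subseteq> T' x \<Longrightarrow> (vs, ws) \<in> tensor_args M p q x"
  by (simp add: tensor_args_def)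

lemma multilinear_atD:
  assumes "multilinear_at M p q x F" "(vs, ws) \<in> tensor_args M p q x"
  shows "i < p \<Longrightarrow> u \<in> T x \<Longrightarrow> v \<in> T x \<Longrightarrow> F (vs[i := (\<lambda>f. a * u f + b * v f)]) ws = a * F (vs[i := u]) ws + b * F (vs[i := v]) ws"
    "j < q \<Longrightarrow> \<omega> \<in> T' x \<Longrightarrow> \<theta> \<in> T' x \<Longrightarrow> F vs (ws[j := (\<lambda>v. a * \<omega> v + b * \<theta> v)]) = a * F vs (ws[j := \<omega>]) + b * F vs (ws[j := \<theta>])"
  using assms unfolding multilinear_at_def by fast+

text \<open>The vector slots are expanded first, the covector slots inside. The sum has the shape
  used in \<open>lie_deriv\<close>, so pullbacks and Lie derivatives can be compared term by
  term.\<close>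

lemma multilinear_at_expand:
  assumes F: "multilinear_at M p q x F" and C: "C \<in> atlas M" "x \<in> fst C" and args: "(vs, ws) \<in> tensor_args M p q x"
  shows "F vs ws = (\<Sum>I\<in>multi_indices dimM p. \<Sum>J\<in>multi_indices dimM q.
    F (map (\<lambda>i. frame C i x) I) (map (\<lambda>j. coframe C j x) J) *
    (\<Prod>r<p. (vs ! r) (\<lambda>y. snd C y (I ! r))) * (\<Prod>s<q. (ws ! s) (frame C (J ! s) x)))"
proof -
  have vs: "length vs = p" "set vs \<subseteq> T x" and ws: "length ws = q" "set ws \<subseteq> T' x"
    using args by (auto simp: tensor_args_def)
  have 1: "F vs ws = (\<Sum>I\<in>multi_indices dimM p. F (map (\<lambda>i. frame C i x) I) ws * (\<Prod>r<p. (vs ! r) (\<lambda>y. snd C y (I ! r))))"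
  proof (rule multilinear_expansion[where F = "\<lambda>vs. F vs ws" and k = "\<lambda>v j. v (\<lambda>y. snd C y j)" and S = "T x", OF _ _ vs])
    fix us i assume us: "length us = p" "set us \<subseteq> T x" "i < p"
    have "us ! i \<in> T x" using us by auto
    have "F (us[i := us ! i]) ws = (\<Sum>j<dimM. (us ! i) (\<lambda>y. snd C y j) * F (us[i := frame C j x]) ws)"
      by (rule tangent_linear_expand[where L = "\<lambda>v. F (us[i := v]) ws", OF _ C \<open>us ! i \<in> T x\<close>])
         (rule multilinear_atD(1)[OF F tensor_argsI[OF us(1,2) ws] us(3)])
    then show "F us ws = (\<Sum>j<dimM. (us ! i) (\<lambda>y. snd C y j) * F (us[i := frame C j x]) ws)" by simp
  qed (rule coord_vec_tangent[OF C])
  have 2: "F us ws = (\<Sum>J\<in>multi_indices dimM q. F us (map (\<lambda>j. coframe C j x) J) * (\<Prod>s<q. (ws ! s) (frame C (J ! s) x)))"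
    if us: "length us = p" "set us \<subseteq> T x" for us
  proof (rule multilinear_expansion[where F = "F us" and k = "\<lambda>w j. w (frame C j x)" and S = "T' x", OF _ _ ws])
    fix zs i assume zs: "length zs = q" "set zs \<subseteq> T' x" "i < q"
    have "zs ! i \<in> T' x" using zs by auto
    have "F us (zs[i := zs ! i]) = (\<Sum>j<dimM. (zs ! i) (frame C j x) * F us (zs[i := coframe C j x]))"
      by (rule cotangent_linear_expand[where L = "\<lambda>v. F us (zs[i := v])", OF _ C \<open>zs ! i \<in> T' x\<close>])
         (rule multilinear_atD(2)[OF F tensor_argsI[OF us zs(1,2)] zs(3)])
    then show "F us zs = (\<Sum>j<dimM. (zs ! i) (frame C j x) * F us (zs[i := coframe C j x]))" by simp
  qed (rule coord_covec_cotangent)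
  show ?thesis unfolding 1
  proof (rule sum.cong[OF refl])
    fix I assume I: "I \<in> multi_indices dimM p"
    have "set (map (\<lambda>i. frame C i x) I) \<subseteq> T x" "length (map (\<lambda>i. frame C i x) I) = p"
      using I coord_vec_tangent[OF C] by (auto simp: multi_indices_def)
    show "F (map (\<lambda>i. frame C i x) I) ws * (\<Prod>r<p. (vs ! r) (\<lambda>y. snd C y (I ! r))) =
      (\<Sum>J\<in>multi_indices dimM q. F (map (\<lambda>i. frame C i x) I) (map (\<lambda>j. coframe C j x) J) *
        (\<Prod>r<p. (vs ! r) (\<lambda>y. snd C y (I ! r))) * (\<Prod>s<q. (ws ! s) (frame C (J ! s) x)))"
      unfolding 2[OF \<open>length (map (\<lambda>i. frame C i x) I) = p\<close> \<open>set (map (\<lambda>i. frame C i x) I) \<subseteq> T x\<close>] sum_distrib_right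
      by (intro sum.cong refl) (simp only: mult_ac)
  qed
qed

section \<open>Analytic maps and transport of tangent vectors\<close>

lemma analytic_mapD:
  assumes f: "analytic_map M N f" and "C \<in> atlas M" "x \<in> fst C" "D \<in> atlas N" "f x \<in> fst D" "j < mdim N"
  shows "real_analytic_at dimM (\<lambda>z. snd D (f (chart_inv C z)) j) (snd C x)"
proof -
  have "\<forall>C\<in>atlas M. \<forall>D\<in>atlas N. \<forall>x\<in>fst C. f x \<in> fst D \<longrightarrow>
      (\<forall>j<mdim N. real_analytic_at dimM (\<lambda>z. snd D (f (chart_inv C z)) j) (snd C x))"
    using f unfolding analytic_map_def case_prod_unfold by (elim conjE)
  then show ?thesis using assms(2-) by blast
qed

lemma analytic_map_carrier:
  assumes "analytic_map M M f" "x \<in> carrier"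
  shows "f x \<in> carrier"
proof -
  have "continuous_map (mtop M) (mtop M) f" using assms(1) by (simp add: analytic_map_def)
  then have "f ` carrier \<subseteq> carrier" by (rule continuous_map_image_subset_topspace)
  then show ?thesis using assms(2) by blast
qed

lemma analytic_at_compose_map:
  assumes f: "analytic_map M M f" and x: "x \<in> carrier" and g: "analytic_at g (f x)"
  shows "analytic_at (\<lambda>y. g (f y)) x"
proof -
  have cont: "continuous_map (mtop M) (mtop M) f" using f by (simp add: analytic_map_def)
  have fx: "f x \<in> carrier" by (rule analytic_map_carrier[OF f x])
  obtain C where C: "C \<in> atlas M" "x \<in> fst C" using chart_exists[OF x] by blast
  obtain D where D: "D \<in> atlas M" "f x \<in> fst D" using chart_exists[OF fx] by blast
  have V: "openin (mtop M) {y \<in> carrier. f y \<in> fst D}" "x \<in> {y \<in> carrier. f y \<in> fst D}"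
    using openin_continuous_map_preimage[OF cont atlas_facts(1)[OF D(1)]] x D(2) by auto
  obtain r where r: "r > 0" and h: "\<And>z. z \<in> cube dimM (snd C x) r \<Longrightarrow>
    z \<in> snd C ` fst C \<and> chart_inv C z \<in> fst C \<and> chart_inv C z \<in> {y \<in> carrier. f y \<in> fst D} \<and> snd C (chart_inv C z) = z"
    using C V by (rule chart_nbhd) (rule that)
  have "real_analytic_at dimM (\<lambda>z. g (chart_inv D (snd D (f (chart_inv C z))))) (snd C x)"
  proof (rule real_analytic_at_compose[where g = "\<lambda>z. g (chart_inv D z)" and f = "\<lambda>z. snd D (f (chart_inv C z))",
        OF _ _ chart_euc[OF C] r])
    show "real_analytic_at dimM (\<lambda>z. g (chart_inv D z)) (snd D (f (chart_inv C (snd C x))))"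
      using analytic_atD[OF g D] C by simp
    show "real_analytic_at dimM (\<lambda>z. snd D (f (chart_inv C z)) j) (snd C x)" if "j < dimM" for j
      using analytic_mapD[OF f C D that] .
    show "snd D (f (chart_inv C z)) \<in> euc dimM" if "z \<in> cube dimM (snd C x) r" for z
      using h[OF that] chart_euc[OF D(1)] by blast
  qed
  then have "real_analytic_at dimM (\<lambda>z. g (f (chart_inv C z))) (snd C x)"
    by (rule real_analytic_at_cong[OF _ r]) (use h D(1) in auto)
  then show ?thesis by (rule analytic_at_chart[OF C])
qed

lemma push_vec_tangent:
  assumes f: "analytic_map M M f" and x: "x \<in> carrier" and v: "v \<in> T x"
  shows "push_vec M f x v \<in> T (f x)"
proof (rule tangentI)
  fix g h a b assume g: "analytic_at g (f x)" and h: "analytic_at h (f x)"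
  note gf = analytic_at_compose_map[OF f x g] and hf = analytic_at_compose_map[OF f x h]
  show "push_vec M f x v (\<lambda>y. a * g y + b * h y) = a * push_vec M f x v g + b * push_vec M f x v h"
    using tangentD(1)[OF v gf hf] by (simp add: push_vec_def g h analytic_at_lincomb)
  show "push_vec M f x v (\<lambda>y. g y * h y) = g (f x) * push_vec M f x v h + h (f x) * push_vec M f x v g"
    using tangentD(2)[OF v gf hf] by (simp add: push_vec_def g h analytic_at_mult)
qed (simp add: push_vec_def)

lemma push_vec_lincomb:
  "push_vec M f x (\<lambda>g. a * u g + b * v g) = (\<lambda>g. a * push_vec M f x u g + b * push_vec M f x v g)"
  by (auto simp: push_vec_def fun_eq_iff)

text \<open>Test functions are total on the type, whereas \<open>g (f y) = y\<close> is known on the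
  carrier only. The carrier is open, so locality of \<open>v\<close> closes the gap.\<close>

lemma push_vec_inverse:
  assumes f: "analytic_map M M f" "analytic_map M M g" and gf: "\<And>y. y \<in> carrier \<Longrightarrow> g (f y) = y"
    and x: "x \<in> carrier" and v: "v \<in> T x"
  shows "push_vec M g (f x) (push_vec M f x v) = v"
proof
  fix h
  have fx: "f x \<in> carrier"
    by (rule analytic_map_carrier[OF f(1) x])
  show "push_vec M g (f x) (push_vec M f x v) h = v h"
  proof (cases "analytic_at h x")
    case True
    then have hg: "analytic_at (\<lambda>y. h (g y)) (f x)"
      by (intro analytic_at_compose_map[OF f(2) fx]) (simp add: gf x)
    have "v (\<lambda>y. h (g (f y))) = v h"
      by (rule tangent_local[OF v analytic_at_compose_map[OF f(1) x hg] openin_topspace x]) (simp add: gf)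
    then show ?thesis using True hg by (simp add: push_vec_def gf x)
  next
    case False
    then show ?thesis by (simp add: push_vec_def gf x tangent_nonanalytic[OF v])
  qed
qed

end

section \<open>The derivative of the pullback\<close>

text \<open>The differentiated factor is replaced inside the product, which is the shape that
  \<open>sum_multi_indices_transpose\<close> takes apart.\<close>

lemma DERIV_prod_lessThan:
  fixes f :: "nat \<Rightarrow> real \<Rightarrow> real"
  assumes "\<And>r. r < p \<Longrightarrow> (f r has_real_derivative D r) (at t)"
  shows "((\<lambda>t. \<Prod>r<p. f r t) has_real_derivative (\<Sum>r<p. \<Prod>s<p. if s = r then D r else f s t)) (at t)"
  using assms
proof (induction p)
  case 0
  show ?case by simp
next
  case (Suc p)
  have IH: "((\<lambda>t. \<Prod>r<p. f r t) has_real_derivative (\<Sum>r<p. \<Prod>s<p. if s = r then D r else f s t)) (at t)"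
    using Suc by simp
  have 1: "(\<Prod>s<p. if s = p then D p else f s t) = (\<Prod>s<p. f s t)" by (rule prod.cong) auto
  have 2: "(\<Sum>r<p. \<Prod>s<Suc p. if s = r then D r else f s t) = (\<Sum>r<p. \<Prod>s<p. if s = r then D r else f s t) * f p t"
    unfolding sum_distrib_right by (rule sum.cong) auto
  have e: "(\<Sum>r<Suc p. \<Prod>s<Suc p. if s = r then D r else f s t) =
      (\<Sum>r<p. \<Prod>s<p. if s = r then D r else f s t) * f p t + D p * (\<Prod>r<p. f r t)"
    unfolding sum.lessThan_Suc[of _ p] 2 by (simp add: 1 mult.commute)
  show ?case unfolding e using DERIV_mult[OF IH Suc.prems[OF lessI]] by (simp only: prod.lessThan_Suc)
qed

lemma sum_rotate3:
  "(\<Sum>i\<in>A. \<Sum>j\<in>B. \<Sum>k\<in>C. f i j k) = (\<Sum>k\<in>C. \<Sum>i\<in>A. \<Sum>j\<in>B. f i j k)"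
proof -
  have "(\<Sum>i\<in>A. \<Sum>j\<in>B. \<Sum>k\<in>C. f i j k) = (\<Sum>i\<in>A. \<Sum>k\<in>C. \<Sum>j\<in>B. f i j k)"
    by (rule sum.cong[OF refl sum.swap])
  also have "\<dots> = (\<Sum>k\<in>C. \<Sum>i\<in>A. \<Sum>j\<in>B. f i j k)" by (rule sum.swap)
  finally show ?thesis .
qed

lemma mult_sum_right: "w * (\<Sum>i\<in>A. a i * b i) = (\<Sum>i\<in>A. a i * b i * (w :: real))"
  by (simp add: sum_distrib_left mult_ac)

lemma mult_sum_middle: "w * (\<Sum>i\<in>A. a i * b i) = (\<Sum>i\<in>A. a i * (w :: real) * b i)"
  by (simp add: sum_distrib_left mult_ac)

text \<open>With entries of size at most \<open>1 / (2 * n)\<close> the l1 norm of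
  \<open>A W\<close> is at most half that of \<open>W\<close>, so this term can be absorbed on the
  left.\<close>

lemma linear_system_bounded:
  fixes A :: "nat \<Rightarrow> nat \<Rightarrow> real" and W w :: "nat \<Rightarrow> real"
  assumes W: "\<And>j. j < n \<Longrightarrow> W j = w j - (\<Sum>l<n. A j l * W l)"
    and A: "\<And>j l. j < n \<Longrightarrow> l < n \<Longrightarrow> \<bar>A j l\<bar> \<le> 1 / (2 * real n)"
  shows "(\<Sum>j<n. \<bar>W j\<bar>) \<le> 2 * (\<Sum>j<n. \<bar>w j\<bar>)"
proof -
  let ?S = "\<Sum>j<n. \<bar>W j\<bar>"
  have "?S \<le> (\<Sum>j<n. \<bar>w j\<bar> + (1 / (2 * real n)) * ?S)"
  proof (rule sum_mono)
    fix j assume "j \<in> {..<n}"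
    then have j: "j < n" by simp
    have "\<bar>\<Sum>l<n. A j l * W l\<bar> \<le> (\<Sum>l<n. \<bar>A j l * W l\<bar>)" by (rule sum_abs)
    also have "\<dots> \<le> (\<Sum>l<n. (1 / (2 * real n)) * \<bar>W l\<bar>)"
      unfolding abs_mult using A[OF j] by (intro sum_mono mult_right_mono) auto
    also have "\<dots> = (1 / (2 * real n)) * ?S" by (rule sum_distrib_left[symmetric])
    finally show "\<bar>W j\<bar> \<le> \<bar>w j\<bar> + (1 / (2 * real n)) * ?S" using W[OF j] by linarith
  qed
  also have "\<dots> = (\<Sum>j<n. \<bar>w j\<bar>) + real n * ((1 / (2 * real n)) * ?S)"
    by (simp add: sum.distrib)
  also have "real n * ((1 / (2 * real n)) * ?S) \<le> ?S / 2" by (cases "n = 0") auto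
  finally show ?thesis by linarith
qed

text \<open>The solution of a linear system near the identity matrix is differentiated without
  determinants: it is bounded, hence continuous, hence differentiable.\<close>

lemma linear_system_derivative:
  fixes A :: "nat \<Rightarrow> nat \<Rightarrow> real \<Rightarrow> real" and W :: "nat \<Rightarrow> real \<Rightarrow> real"
  assumes A0: "\<And>j l. j < n \<Longrightarrow> l < n \<Longrightarrow> A j l t0 = 0"
    and dA: "\<And>j l. j < n \<Longrightarrow> l < n \<Longrightarrow> (A j l has_real_derivative D j l) (at t0)"
    and W: "\<forall>\<^sub>F t in nhds t0. \<forall>j<n. W j t = w j - (\<Sum>l<n. A j l t * W l t)"
    and j: "j < n"
  shows "(W j has_real_derivative - (\<Sum>l<n. D j l * w l)) (at t0)"
proof -
  have W0: "W l t0 = w l" if "l < n" for l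
    using eventually_nhds_x_imp_x[OF W] that A0 by simp
  have Alim: "(A i l \<longlongrightarrow> 0) (at t0)" if "i < n" "l < n" for i l
    using DERIV_isCont[OF dA[OF that]] A0[OF that] by (simp add: isCont_def)
  have Wev: "\<forall>\<^sub>F t in at t0. \<forall>j<n. W j t = w j - (\<Sum>l<n. A j l t * W l t)"
    using W by (auto simp: eventually_at_filter elim: eventually_mono)
  have n: "1 / (2 * real n) > 0" using j by simp
  have "\<forall>\<^sub>F t in at t0. \<forall>i\<in>{..<n}. \<forall>l\<in>{..<n}. dist (A i l t) 0 < 1 / (2 * real n)"
    by (intro eventually_ball_finite ballI tendstoD[OF Alim n]) auto
  with Wev have bdd: "\<forall>\<^sub>F t in at t0. (\<Sum>j<n. \<bar>W j t\<bar>) \<le> 2 * (\<Sum>j<n. \<bar>w j\<bar>)"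
  proof eventually_elim
    case (elim t)
    show ?case by (rule linear_system_bounded[where A = "\<lambda>i l. A i l t"]) (use elim in \<open>auto simp: less_imp_le\<close>)
  qed
  \<comment> \<open>The entries of \<open>A\<close> tend to 0 and the solution is bounded. The
    system itself then shows that \<open>W\<close> is continuous at \<open>t0\<close>.\<close>
  have AW: "((\<lambda>t. A i l t * W l t) \<longlongrightarrow> 0) (at t0)" if "i < n" "l < n" for i l
  proof (rule tendsto_rabs_zero_cancel, rule tendsto_sandwich[OF _ _ tendsto_const])
    let ?K = "2 * (\<Sum>j<n. \<bar>w j\<bar>)"
    show "\<forall>\<^sub>F t in at t0. \<bar>A i l t * W l t\<bar> \<le> \<bar>A i l t\<bar> * ?K"
      using bdd
    proof eventually_elim
      case (elim t)
      have "\<bar>W l t\<bar> \<le> (\<Sum>j<n. \<bar>W j t\<bar>)" using that by (intro member_le_sum) auto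
      then show ?case using elim by (simp add: abs_mult mult_left_mono)
    qed
    have "((\<lambda>t. \<bar>A i l t\<bar> * ?K) \<longlongrightarrow> \<bar>0\<bar> * ?K) (at t0)"
      by (intro tendsto_mult tendsto_rabs tendsto_const Alim that)
    then show "((\<lambda>t. \<bar>A i l t\<bar> * ?K) \<longlongrightarrow> 0) (at t0)" by simp
  qed simp
  have Wlim: "(W l \<longlongrightarrow> W l t0) (at t0)" if "l < n" for l
  proof -
    have "((\<lambda>t. w l - (\<Sum>k<n. A l k t * W k t)) \<longlongrightarrow> w l - (\<Sum>k<n. 0)) (at t0)"
      by (intro tendsto_diff tendsto_const tendsto_sum AW that) auto
    then have "((\<lambda>t. w l - (\<Sum>k<n. A l k t * W k t)) \<longlongrightarrow> W l t0) (at t0)" by (simp add: W0 that)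
    then show ?thesis
      by (rule Lim_transform_eventually) (use Wev that in \<open>auto elim: eventually_mono\<close>)
  qed
  have "((\<lambda>t. A j l t * W l t) has_real_derivative D j l * W l t0) (at t0)" if "l < n" for l
    by (rule has_derivative_mult_at_zero[OF dA[OF j that] A0[OF j that] Wlim[OF that]])
  then have "((\<lambda>t. \<Sum>l<n. A j l t * W l t) has_real_derivative (\<Sum>l<n. D j l * W l t0)) (at t0)"
    by (intro DERIV_sum) auto
  from DERIV_diff[OF DERIV_const[of "w j"] this]
  have d: "((\<lambda>t. w j - (\<Sum>l<n. A j l t * W l t)) has_real_derivative - (\<Sum>l<n. D j l * w l)) (at t0)"
    by (simp add: W0)
  have "\<forall>\<^sub>F t in nhds t0. w j - (\<Sum>l<n. A j l t * W l t) = W j t"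
    using W by eventually_elim (use j in simp)
  from DERIV_cong_ev[OF refl this refl] d show ?thesis by simp
qed

lemma multi_indices_update: "I \<in> multi_indices n p \<Longrightarrow> k < n \<Longrightarrow> I[r := k] \<in> multi_indices n p"
  using set_update_subset_insert[of I r k] by (auto simp: multi_indices_def)

lemma multi_indices_nth: "I \<in> multi_indices n p \<Longrightarrow> r < p \<Longrightarrow> I ! r < n"
  by (auto simp: multi_indices_def subset_iff)

text \<open>The map \<open>(I, k) \<mapsto> (I[r := k], I ! r)\<close> is an involution.\<close>

lemma sum_multi_indices_transpose:
  fixes c :: "nat list \<Rightarrow> real" and V :: "nat \<Rightarrow> nat \<Rightarrow> real"
  assumes r: "r < p"
  shows "(\<Sum>I\<in>multi_indices n p. c I * (\<Prod>s<p. if s = r then (\<Sum>k<n. A (I ! r) k * V r k) else V s (I ! s))) =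
    (\<Sum>I\<in>multi_indices n p. (\<Sum>k<n. A k (I ! r) * c (I[r := k])) * (\<Prod>s<p. V s (I ! s)))"
proof -
  have step: "c I * (\<Prod>s<p. if s = r then (\<Sum>k<n. A (I ! r) k * V r k) else V s (I ! s)) =
      (\<Sum>k<n. c I * A (I ! r) k * (\<Prod>s<p. V s (I[r := k] ! s)))" if I: "I \<in> multi_indices n p" for I
  proof -
    have len: "length I = p" using I by (simp add: multi_indices_def)
    have 1: "(\<Prod>s<p. if s = r then X else V s (I ! s)) = X * (\<Prod>s\<in>{..<p} - {r}. V s (I ! s))" for X
    proof -
      have "(\<Prod>s<p. if s = r then X else V s (I ! s)) = X * (\<Prod>s\<in>{..<p} - {r}. if s = r then X else V s (I ! s))"
        using r by (subst prod.remove[of _ r]) auto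
      also have "(\<Prod>s\<in>{..<p} - {r}. if s = r then X else V s (I ! s)) = (\<Prod>s\<in>{..<p} - {r}. V s (I ! s))"
        by (rule prod.cong) auto
      finally show ?thesis .
    qed
    have 2: "(\<Prod>s<p. V s (I[r := k] ! s)) = V r k * (\<Prod>s\<in>{..<p} - {r}. V s (I ! s))" for k
    proof -
      have "(\<Prod>s<p. V s (I[r := k] ! s)) = V r (I[r := k] ! r) * (\<Prod>s\<in>{..<p} - {r}. V s (I[r := k] ! s))"
        using r by (subst prod.remove[of _ r]) auto
      also have "(\<Prod>s\<in>{..<p} - {r}. V s (I[r := k] ! s)) = (\<Prod>s\<in>{..<p} - {r}. V s (I ! s))"
        by (rule prod.cong) auto
      finally show ?thesis using r len by simp
    qed
    show ?thesis unfolding 1 2 by (simp add: sum_distrib_left sum_distrib_right mult_ac)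
  qed
  have "(\<Sum>I\<in>multi_indices n p. c I * (\<Prod>s<p. if s = r then (\<Sum>k<n. A (I ! r) k * V r k) else V s (I ! s))) =
      (\<Sum>I\<in>multi_indices n p. \<Sum>k<n. c I * A (I ! r) k * (\<Prod>s<p. V s (I[r := k] ! s)))"
    by (rule sum.cong[OF refl step])
  also have "\<dots> = (\<Sum>(I, k)\<in>multi_indices n p \<times> {..<n}. c I * A (I ! r) k * (\<Prod>s<p. V s (I[r := k] ! s)))"
    by (rule sum.cartesian_product)
  also have "\<dots> = (\<Sum>(I, k)\<in>multi_indices n p \<times> {..<n}. A k (I ! r) * c (I[r := k]) * (\<Prod>s<p. V s (I ! s)))"
  proof (rule sum.reindex_bij_witness[where i = "\<lambda>(I, k). (I[r := k], I ! r)" and j = "\<lambda>(I, k). (I[r := k], I ! r)"])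
    fix x :: "nat list \<times> nat" assume x: "x \<in> multi_indices n p \<times> {..<n}"
    obtain I k where Ik: "x = (I, k)" by (cases x)
    have I: "I \<in> multi_indices n p" "k < n" "length I = p" using x Ik by (auto simp: multi_indices_def)
    show "(\<lambda>(I, k). (I[r := k], I ! r)) ((\<lambda>(I, k). (I[r := k], I ! r)) x) = x"
      using I r by (simp add: Ik)
    then show "(\<lambda>(I, k). (I[r := k], I ! r)) ((\<lambda>(I, k). (I[r := k], I ! r)) x) = x" .
    show "(\<lambda>(I, k). (I[r := k], I ! r)) x \<in> multi_indices n p \<times> {..<n}"
      using I r multi_indices_update multi_indices_nth by (simp add: Ik)
    then show "(\<lambda>(I, k). (I[r := k], I ! r)) x \<in> multi_indices n p \<times> {..<n}" .
    show "(case (\<lambda>(I, k). (I[r := k], I ! r)) x of (I, k) \<Rightarrow> A k (I ! r) * c (I[r := k]) * (\<Prod>s<p. V s (I ! s))) =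
        (case x of (I, k) \<Rightarrow> c I * A (I ! r) k * (\<Prod>s<p. V s (I[r := k] ! s)))"
      using I r by (simp add: Ik mult_ac)
  qed
  also have "\<dots> = (\<Sum>I\<in>multi_indices n p. \<Sum>k<n. A k (I ! r) * c (I[r := k]) * (\<Prod>s<p. V s (I ! s)))"
    by (rule sum.cartesian_product[symmetric])
  also have "\<dots> = (\<Sum>I\<in>multi_indices n p. (\<Sum>k<n. A k (I ! r) * c (I[r := k])) * (\<Prod>s<p. V s (I ! s)))"
    by (simp only: sum_distrib_right)
  finally show ?thesis .
qed

lemma cube_Suc_split:
  assumes "w \<in> cube (Suc n) (a(n := t0)) r" "a \<in> euc n"
  shows "\<bar>w n - t0\<bar> \<le> r" "w(n := 0) \<in> cube n a r"
  using assms by (auto simp: cube_iff euc_iff less_Suc_eq)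

lemma euc_Suc: "a \<in> euc n \<Longrightarrow> a(n := t) \<in> euc (Suc n)"
  by (auto simp: euc_iff)

lemma euc_upd_last: "a \<in> euc n \<Longrightarrow> a(n := 0) = a"
  by (auto simp: euc_iff fun_eq_iff)

lemma real_analytic_at_insert_last:
  assumes "real_analytic_at (Suc n) h (a(n := t))" "a \<in> euc n"
  shows "real_analytic_at n (\<lambda>z. h (z(n := t))) a"
proof (rule real_analytic_at_compose[where g = h and k = "Suc n" and f = "\<lambda>z. z(n := t)", OF assms(1) _ assms(2) zero_less_one])
  fix j assume "j < Suc n"
  then show "real_analytic_at n (\<lambda>z. (z(n := t)) j) a"
    by (cases "j = n") (simp_all add: real_analytic_at_const real_analytic_at_coord)
next
  fix z assume "z \<in> cube n a 1"
  then show "z(n := t) \<in> euc (Suc n)" by (simp add: cube_iff euc_Suc)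
qed

section \<open>The family in charts and its velocity\<close>

locale analytic_flow = analytic_manifold M for M :: "'a manifold" +
  fixes e :: real and \<phi> :: "real \<Rightarrow> 'a \<Rightarrow> 'a"
  assumes e_pos: "e > 0" and family: "analytic_family M e \<phi>"
    and phi_0: "\<forall>x \<in> carrier. \<phi> 0 x = x"
begin

abbreviation "\<psi> t \<equiv> inv_into carrier (\<phi> t)"
abbreviation "\<xi> t \<equiv> velocity_field M \<phi> t"

lemma flow_maps:
  assumes "\<bar>t\<bar> < e"
  shows "bij_betw (\<phi> t) carrier carrier" "analytic_map M M (\<phi> t)" "analytic_map M M (\<psi> t)"
proof -
  have "t \<in> {-e<..<e}" using assms by auto
  then have "analytic_automorphism M (\<phi> t)" using family unfolding analytic_family_def by blast
  then show "bij_betw (\<phi> t) carrier carrier" "analytic_map M M (\<phi> t)" "analytic_map M M (\<psi> t)"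
    unfolding analytic_automorphism_def by blast+
qed

lemma flow_carrier: "\<bar>t\<bar> < e \<Longrightarrow> x \<in> carrier \<Longrightarrow> \<phi> t x \<in> carrier"
  by (rule analytic_map_carrier[OF flow_maps(2)])

lemma inverse_carrier: "\<bar>t\<bar> < e \<Longrightarrow> x \<in> carrier \<Longrightarrow> \<psi> t x \<in> carrier"
  by (rule analytic_map_carrier[OF flow_maps(3)])

lemma inverse_flow: "\<bar>t\<bar> < e \<Longrightarrow> x \<in> carrier \<Longrightarrow> \<psi> t (\<phi> t x) = x"
  using flow_maps(1) by (rule bij_betw_inv_into_left)

lemma flow_inverse: "\<bar>t\<bar> < e \<Longrightarrow> x \<in> carrier \<Longrightarrow> \<phi> t (\<psi> t x) = x"
  using flow_maps(1) by (rule bij_betw_inv_into_right)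

lemma joint_map: "analytic_map (interval_times (-e) e M) M (\<lambda>(t, x). \<phi> t x)"
  using family unfolding analytic_family_def by blast

text \<open>The analogue of \<open>chart_nbhd\<close> for the family: continuity in the product
  topology gives one radius for time and space together.\<close>

lemma joint_nbhd:
  assumes C: "C \<in> atlas M" "x \<in> fst C" and t0: "\<bar>t0\<bar> < e" and V: "openin (mtop M) V" "\<phi> t0 x \<in> V"
  obtains r where "r > 0" "\<And>t. \<bar>t - t0\<bar> \<le> r \<Longrightarrow> \<bar>t\<bar> < e"
    "\<And>t z. \<bar>t - t0\<bar> \<le> r \<Longrightarrow> z \<in> cube dimM (snd C x) r \<Longrightarrow>
      z \<in> snd C ` fst C \<and> chart_inv C z \<in> fst C \<and> snd C (chart_inv C z) = z \<and> \<phi> t (chart_inv C z) \<in> V"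
proof -
  let ?X = "prod_topology (top_of_set {-e<..<e}) (mtop M)"
  let ?S = "{p \<in> topspace ?X. (\<lambda>(t, x). \<phi> t x) p \<in> V}"
  have "continuous_map ?X (mtop M) (\<lambda>(t, x). \<phi> t x)"
    using joint_map by (simp add: analytic_map_def interval_times_def)
  from openin_continuous_map_preimage[OF this V(1)] have S: "openin ?X ?S" .
  have "(t0, x) \<in> ?S" using t0 V(2) chart_carrier[OF C] by auto
  from openin_prod_topology_alt[THEN iffD1, OF S, rule_format, OF this]
  obtain A B where AB: "openin (top_of_set {-e<..<e}) A" "openin (mtop M) B" "t0 \<in> A" "x \<in> B" "A \<times> B \<subseteq> ?S"
    by (elim exE conjE) (rule that)
  obtain G where G: "open G" "A = {-e<..<e} \<inter> G" using AB(1) unfolding openin_open by blast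
  then have "open A" by auto
  then obtain r1 where r1: "r1 > 0" "cball t0 r1 \<subseteq> A" using AB(3) open_contains_cball by blast
  obtain r2 where r2: "r2 > 0" and h: "\<And>z. z \<in> cube dimM (snd C x) r2 \<Longrightarrow>
    z \<in> snd C ` fst C \<and> chart_inv C z \<in> fst C \<and> chart_inv C z \<in> B \<and> snd C (chart_inv C z) = z"
    using C AB(2,4) by (rule chart_nbhd) (rule that)
  have A: "t \<in> A" if "\<bar>t - t0\<bar> \<le> min r1 r2" for t
    using that r1(2) by (auto simp: dist_real_def abs_minus_commute subset_iff)
  show thesis
  proof (rule that[of "min r1 r2"])
    show "\<bar>t\<bar> < e" if "\<bar>t - t0\<bar> \<le> min r1 r2" for t using A[OF that] G(2) by auto
    fix t z assume t: "\<bar>t - t0\<bar> \<le> min r1 r2" and z: "z \<in> cube dimM (snd C x) (min r1 r2)"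
    have "z \<in> cube dimM (snd C x) r2" using z by (rule cube_mono) simp
    note hz = h[OF this]
    then have "(t, chart_inv C z) \<in> ?S" using A[OF t] AB(5) by blast
    with hz show "z \<in> snd C ` fst C \<and> chart_inv C z \<in> fst C \<and> snd C (chart_inv C z) = z \<and> \<phi> t (chart_inv C z) \<in> V"
      by simp
  qed (use r1 r2 in simp)
qed

lemma flow_near:
  assumes x: "x \<in> carrier" and t0: "\<bar>t0\<bar> < e" and V: "openin (mtop M) V" "\<phi> t0 x \<in> V"
  shows "\<forall>\<^sub>F t in nhds t0. \<bar>t\<bar> < e \<and> \<phi> t x \<in> V"
proof -
  obtain C where C: "C \<in> atlas M" "x \<in> fst C" using chart_exists[OF x] by blast
  obtain r where r: "r > 0" "\<And>t. \<bar>t - t0\<bar> \<le> r \<Longrightarrow> \<bar>t\<bar> < e"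
    "\<And>t z. \<bar>t - t0\<bar> \<le> r \<Longrightarrow> z \<in> cube dimM (snd C x) r \<Longrightarrow>
      z \<in> snd C ` fst C \<and> chart_inv C z \<in> fst C \<and> snd C (chart_inv C z) = z \<and> \<phi> t (chart_inv C z) \<in> V"
    using C t0 V by (rule joint_nbhd) (rule that)
  have "snd C x \<in> cube dimM (snd C x) r" using chart_euc[OF C] r(1) by (simp add: center_in_cube)
  then have "\<phi> t x \<in> V" if "\<bar>t - t0\<bar> \<le> r" for t
    using r(3)[OF that \<open>snd C x \<in> cube dimM (snd C x) r\<close>] C by simp
  then show ?thesis
    unfolding eventually_nhds_metric using r(1,2) by (intro exI[of _ r]) (auto simp: dist_real_def)
qed

text \<open>In the product chart, time is coordinate number \<open>mdim M\<close>.\<close>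

definition flow_expr :: "'a chart \<Rightarrow> ('a \<Rightarrow> real) \<Rightarrow> (nat \<Rightarrow> real) \<Rightarrow> real" where
  "flow_expr C g w = g (\<phi> (w dimM) (chart_inv C (w(dimM := 0))))"

text \<open>\<open>analytic_family\<close> speaks of product charts and of coordinates of the
  target. The inverse product chart is made explicit near the base point, and composition with a
  chart expression passes from target coordinates to an arbitrary function \<open>g\<close>.\<close>

lemma flow_expr_analytic:
  assumes C: "C \<in> atlas M" "x \<in> fst C" and t0: "\<bar>t0\<bar> < e" and g: "analytic_at g (\<phi> t0 x)"
  shows "real_analytic_at (Suc dimM) (flow_expr C g) ((snd C x)(dimM := t0))"
proof -
  let ?N = "interval_times (-e) e M" and ?a = "(snd C x)(dimM := t0)"
  let ?C = "({-e<..<e} \<times> fst C, \<lambda>(t, x). (snd C x)(dimM := t))"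
  have x: "x \<in> carrier" using chart_carrier[OF C] .
  obtain D where D: "D \<in> atlas M" "\<phi> t0 x \<in> fst D" using chart_exists[OF flow_carrier[OF t0 x]] by blast
  obtain r where r: "r > 0" "\<And>t. \<bar>t - t0\<bar> \<le> r \<Longrightarrow> \<bar>t\<bar> < e"
    and h: "\<And>t z. \<bar>t - t0\<bar> \<le> r \<Longrightarrow> z \<in> cube dimM (snd C x) r \<Longrightarrow>
      z \<in> snd C ` fst C \<and> chart_inv C z \<in> fst C \<and> snd C (chart_inv C z) = z \<and> \<phi> t (chart_inv C z) \<in> fst D"
    using C t0 atlas_facts(1)[OF D(1)] D(2) by (rule joint_nbhd) (rule that)
  have a: "?a \<in> euc (Suc dimM)" by (rule euc_Suc[OF chart_euc[OF C]])
  have inj: "inj_on (snd ?C) (fst ?C)"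
  proof (rule inj_onI)
    fix p p' assume p: "p \<in> fst ?C" "p' \<in> fst ?C" "snd ?C p = snd ?C p'"
    obtain t y t' y' where ty: "p = (t, y)" "p' = (t', y')" by (cases p, cases p')
    have eq: "(snd C y)(dimM := t) = (snd C y')(dimM := t')" using p(3) by (simp add: ty)
    have "t = t'" using fun_cong[OF eq, of dimM] by simp
    moreover have "(snd C y)(dimM := 0) = (snd C y')(dimM := 0)"
      using arg_cong[OF eq, of "\<lambda>f. f(dimM := 0)"] by simp
    then have "snd C y = snd C y'" using p(1,2) chart_euc[OF C(1)] by (simp add: ty euc_upd_last)
    then have "y = y'" using p(1,2) chart_inj[OF C(1)] by (auto simp: ty inj_on_def)
    ultimately show "p = p'" by (simp add: ty)
  qed
  \<comment> \<open>On this cube the slot \<open>mdim M\<close> carries the time, and resetting it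
    to 0 recovers the space coordinates.\<close>
  have inv: "inv_into (fst ?C) (snd ?C) w = (w dimM, chart_inv C (w(dimM := 0)))"
    if w: "w \<in> cube (Suc dimM) ?a r" for w
  proof -
    note s = cube_Suc_split[OF w chart_euc[OF C]]
    note hw = h[OF s]
    have "snd ?C (w dimM, chart_inv C (w(dimM := 0))) = w" using hw by simp
    moreover have "(w dimM, chart_inv C (w(dimM := 0))) \<in> fst ?C" using hw r(2)[OF s(1)] by auto
    ultimately show ?thesis using inv_into_f_f[OF inj] by metis
  qed
  have N: "?C \<in> atlas ?N" using C(1) by (force simp: interval_times_def)
  have dimN: "mdim ?N = Suc dimM" by (simp add: interval_times_def)
  have all: "\<forall>C\<in>atlas ?N. \<forall>D\<in>atlas M. \<forall>p\<in>fst C. (\<lambda>(t, x). \<phi> t x) p \<in> fst D \<longrightarrow>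
      (\<forall>j<dimM. real_analytic_at (mdim ?N) (\<lambda>z. snd D ((\<lambda>(t, x). \<phi> t x) (inv_into (fst C) (snd C) z)) j) (snd C p))"
    using joint_map unfolding analytic_map_def case_prod_unfold by (elim conjE)
  have p: "(t0, x) \<in> fst ?C" "(\<lambda>(t, x). \<phi> t x) (t0, x) \<in> fst D" using t0 C D by auto
  have d: "real_analytic_at (Suc dimM) (\<lambda>w. snd D ((\<lambda>(t, x). \<phi> t x) (inv_into (fst ?C) (snd ?C) w)) j) ?a" if "j < dimM" for j
    using all[rule_format, OF N D(1) p that] by (simp only: dimN fst_conv snd_conv prod.case)
  have d': "real_analytic_at (Suc dimM) (\<lambda>w. snd D (\<phi> (w dimM) (chart_inv C (w(dimM := 0)))) j) ?a" if "j < dimM" for j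
  proof (rule real_analytic_at_cong[OF d[OF that] r(1)])
    fix w assume "w \<in> cube (Suc dimM) ?a r"
    from inv[OF this] show "snd D ((\<lambda>(t, x). \<phi> t x) (inv_into (fst ?C) (snd ?C) w)) j = snd D (\<phi> (w dimM) (chart_inv C (w(dimM := 0)))) j"
      by (simp only: prod.case)
  qed
  have "real_analytic_at (Suc dimM) (\<lambda>w. g (chart_inv D (snd D (\<phi> (w dimM) (chart_inv C (w(dimM := 0))))))) ?a"
  proof (rule real_analytic_at_compose[where g = "\<lambda>z. g (chart_inv D z)" and k = dimM
        and f = "\<lambda>w. snd D (\<phi> (w dimM) (chart_inv C (w(dimM := 0))))", OF _ d' a r(1)])
    have "chart_inv C (?a(dimM := 0)) = x" using C chart_euc[OF C] by (simp add: euc_upd_last)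
    then show "real_analytic_at dimM (\<lambda>z. g (chart_inv D z)) (snd D (\<phi> (?a dimM) (chart_inv C (?a(dimM := 0)))))"
      using analytic_atD[OF g D] by simp
    fix w assume w: "w \<in> cube (Suc dimM) ?a r"
    from h[OF cube_Suc_split[OF w chart_euc[OF C]]]
    show "snd D (\<phi> (w dimM) (chart_inv C (w(dimM := 0)))) \<in> euc dimM" using chart_euc[OF D(1)] by blast
  qed
  then show ?thesis
  proof (rule real_analytic_at_cong[OF _ r(1)])
    fix w assume w: "w \<in> cube (Suc dimM) ?a r"
    from h[OF cube_Suc_split[OF w chart_euc[OF C]]] D(1)
    show "g (chart_inv D (snd D (\<phi> (w dimM) (chart_inv C (w(dimM := 0)))))) = flow_expr C g w"
      by (simp add: flow_expr_def)
  qed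
qed

lemma flow_expr_time:
  assumes "C \<in> atlas M" "x \<in> fst C"
  shows "flow_expr C g ((snd C x)(dimM := t)) = g (\<phi> t x)"
  using assms chart_euc[OF assms] by (simp add: flow_expr_def euc_upd_last)

text \<open>At \<open>\<phi> t0 x\<close> the curve in the definition of the velocity is
  \<open>s \<mapsto> \<phi> s x\<close>, since the inverse map returns to \<open>x\<close>. The
  definition only uses \<open>deriv\<close>; that a derivative exists comes from
  \<open>flow_expr_analytic\<close>.\<close>

lemma flow_has_velocity:
  assumes x: "x \<in> carrier" and t0: "\<bar>t0\<bar> < e" and g: "analytic_at g (\<phi> t0 x)"
  shows "((\<lambda>t. g (\<phi> t x)) has_real_derivative \<xi> t0 (\<phi> t0 x) g) (at t0)"
proof -
  obtain C where C: "C \<in> atlas M" "x \<in> fst C" using chart_exists[OF x] by blast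
  let ?a = "(snd C x)(dimM := t0)"
  have "((\<lambda>s. flow_expr C g (?a(dimM := s))) has_real_derivative partial_deriv dimM (flow_expr C g) ?a) (at (?a dimM))"
    by (rule real_analytic_at_has_partial[OF flow_expr_analytic[OF C t0 g] euc_Suc[OF chart_euc[OF C]]]) simp
  then have "((\<lambda>t. g (\<phi> t x)) has_real_derivative partial_deriv dimM (flow_expr C g) ?a) (at t0)"
    by (simp add: flow_expr_time[OF C])
  moreover from DERIV_imp_deriv[OF this] have "\<xi> t0 (\<phi> t0 x) g = partial_deriv dimM (flow_expr C g) ?a"
    using g by (simp add: velocity_field_def inverse_flow[OF t0 x])
  ultimately show ?thesis by simp
qed

lemma velocity_eq_partial:
  assumes C: "C \<in> atlas M" "x \<in> fst C" and t0: "\<bar>t0\<bar> < e" and g: "analytic_at g (\<phi> t0 x)"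
  shows "partial_deriv dimM (flow_expr C g) ((snd C x)(dimM := t0)) = \<xi> t0 (\<phi> t0 x) g"
proof (rule partial_derivI)
  show "((\<lambda>s. flow_expr C g (((snd C x)(dimM := t0))(dimM := s))) has_real_derivative \<xi> t0 (\<phi> t0 x) g) (at (((snd C x)(dimM := t0)) dimM))"
    using flow_has_velocity[OF chart_carrier[OF C] t0 g] by (simp add: flow_expr_time[OF C])
qed

text \<open>Evaluated at \<open>\<phi> t0 y\<close> the inverse map in the velocity cancels, leaving
  the time derivative of the jointly analytic flow.\<close>

lemma velocity_along_flow_analytic:
  assumes x: "x \<in> carrier" and t0: "\<bar>t0\<bar> < e" and V: "openin (mtop M) V" "\<phi> t0 x \<in> V"
    and g: "\<And>y. y \<in> V \<Longrightarrow> analytic_at g y"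
  shows "analytic_at (\<lambda>y. \<xi> t0 (\<phi> t0 y) g) x"
proof -
  obtain C where C: "C \<in> atlas M" "x \<in> fst C" using chart_exists[OF x] by blast
  obtain r where r: "r > 0" "\<And>t. \<bar>t - t0\<bar> \<le> r \<Longrightarrow> \<bar>t\<bar> < e"
    and h: "\<And>t z. \<bar>t - t0\<bar> \<le> r \<Longrightarrow> z \<in> cube dimM (snd C x) r \<Longrightarrow>
      z \<in> snd C ` fst C \<and> chart_inv C z \<in> fst C \<and> snd C (chart_inv C z) = z \<and> \<phi> t (chart_inv C z) \<in> V"
    using C t0 V by (rule joint_nbhd) (rule that)
  have "real_analytic_at (Suc dimM) (partial_deriv dimM (flow_expr C g)) ((snd C x)(dimM := t0))"
    by (rule real_analytic_at_partial[OF flow_expr_analytic[OF C t0 g[OF V(2)]] euc_Suc[OF chart_euc[OF C]]]) simp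
  from real_analytic_at_insert_last[OF this chart_euc[OF C]]
  have "real_analytic_at dimM (\<lambda>z. \<xi> t0 (\<phi> t0 (chart_inv C z)) g) (snd C x)"
  proof (rule real_analytic_at_cong[OF _ r(1)])
    fix z assume z: "z \<in> cube dimM (snd C x) r"
    have hz: "chart_inv C z \<in> fst C" "snd C (chart_inv C z) = z" "\<phi> t0 (chart_inv C z) \<in> V"
      using h[of t0, OF _ z] r(1) by auto
    from velocity_eq_partial[OF C(1) hz(1) t0 g[OF hz(3)]]
    show "partial_deriv dimM (flow_expr C g) (z(dimM := t0)) = \<xi> t0 (\<phi> t0 (chart_inv C z)) g" by (simp only: hz(2))
  qed
  then show ?thesis by (rule analytic_at_chart[OF C])
qed

lemma flow_expr_partial:
  assumes C: "C \<in> atlas M" "x \<in> fst C" and k: "k < dimM"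
  shows "partial_deriv k (flow_expr C g) ((snd C x)(dimM := t)) = chart_partial C k (\<lambda>y. g (\<phi> t y)) x"
proof -
  have "((snd C x)(dimM := t, k := s))(dimM := 0) = (snd C x)(k := s)" for s
    using k chart_euc[OF C] by (auto simp: fun_eq_iff euc_iff)
  then show ?thesis using k by (simp add: partial_deriv_def chart_partial_def flow_expr_def del: fun_upd_apply) simp
qed

text \<open>The derivatives in the time and in the space variables commute.\<close>

lemma tangent_flow_derivative:
  assumes x: "x \<in> carrier" and t0: "\<bar>t0\<bar> < e" and V: "openin (mtop M) V" "\<phi> t0 x \<in> V"
    and g: "\<And>y. y \<in> V \<Longrightarrow> analytic_at g y" and v: "v \<in> T x"
  shows "((\<lambda>t. v (\<lambda>y. g (\<phi> t y))) has_real_derivative v (\<lambda>y. \<xi> t0 (\<phi> t0 y) g)) (at t0)"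
proof -
  obtain C where C: "C \<in> atlas M" "x \<in> fst C" using chart_exists[OF x] by blast
  let ?H = "flow_expr C g" and ?a = "(snd C x)(dimM := t0)"
  have H: "real_analytic_at (Suc dimM) ?H ?a" by (rule flow_expr_analytic[OF C t0 g[OF V(2)]])
  have a: "?a \<in> euc (Suc dimM)" by (rule euc_Suc[OF chart_euc[OF C]])
  obtain r where r: "r > 0" "\<And>t. \<bar>t - t0\<bar> \<le> r \<Longrightarrow> \<bar>t\<bar> < e"
    and h: "\<And>t z. \<bar>t - t0\<bar> \<le> r \<Longrightarrow> z \<in> cube dimM (snd C x) r \<Longrightarrow>
      z \<in> snd C ` fst C \<and> chart_inv C z \<in> fst C \<and> snd C (chart_inv C z) = z \<and> \<phi> t (chart_inv C z) \<in> V"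
    using C t0 V by (rule joint_nbhd) (rule that)
  have part: "((\<lambda>t. chart_partial C k (\<lambda>y. g (\<phi> t y)) x) has_real_derivative
      chart_partial C k (\<lambda>y. \<xi> t0 (\<phi> t0 y) g) x) (at t0)" if k: "k < dimM" for k
  proof -
    have "((\<lambda>s. partial_deriv k ?H (?a(dimM := s))) has_real_derivative partial_deriv dimM (partial_deriv k ?H) ?a) (at (?a dimM))"
      by (rule real_analytic_at_has_partial[OF real_analytic_at_partial[OF H a] a]) (use k in auto)
    then have "((\<lambda>t. chart_partial C k (\<lambda>y. g (\<phi> t y)) x) has_real_derivative partial_deriv dimM (partial_deriv k ?H) ?a) (at t0)"
      by (simp add: flow_expr_partial[OF C k])
    also have "partial_deriv dimM (partial_deriv k ?H) ?a = partial_deriv k (partial_deriv dimM ?H) ?a"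
      by (rule real_analytic_at_partial_commute[OF H a]) (use k in auto)
    also have "\<dots> = partial_deriv k (\<lambda>w. \<xi> t0 (\<phi> t0 (chart_inv C (w(dimM := 0)))) g) ?a"
    proof -
      \<comment> \<open>To substitute the velocity under a space derivative, equality at the base
        point is too little; it is shown along a piece of the line.\<close>
      have "\<forall>\<^sub>F s in nhds (?a k). partial_deriv dimM ?H (?a(k := s)) = \<xi> t0 (\<phi> t0 (chart_inv C ((?a(k := s))(dimM := 0)))) g"
        unfolding eventually_nhds_metric
      proof (intro exI[of _ r] conjI allI impI r(1))
        fix s assume "dist s (?a k) < r"
        then have z: "(snd C x)(k := s) \<in> cube dimM (snd C x) r"
          using k by (intro fun_upd_cube chart_euc[OF C]) (simp_all add: dist_real_def)
        have hz: "chart_inv C ((snd C x)(k := s)) \<in> fst C" "snd C (chart_inv C ((snd C x)(k := s))) = (snd C x)(k := s)"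
          "\<phi> t0 (chart_inv C ((snd C x)(k := s))) \<in> V"
          using h[of t0, OF _ z] r(1) by auto
        have 1: "?a(k := s) = ((snd C x)(k := s))(dimM := t0)" using k by (auto simp: fun_eq_iff)
        have 2: "(?a(k := s))(dimM := 0) = (snd C x)(k := s)"
          using k chart_euc[OF C] by (auto simp: fun_eq_iff euc_iff)
        show "partial_deriv dimM ?H (?a(k := s)) = \<xi> t0 (\<phi> t0 (chart_inv C ((?a(k := s))(dimM := 0)))) g"
          unfolding 2 using velocity_eq_partial[OF C(1) hz(1) t0 g[OF hz(3)]] by (simp only: hz(2) 1)
      qed
      then show ?thesis unfolding partial_deriv_def[of k] by (rule deriv_cong_ev) simp
    qed
    also have "\<dots> = chart_partial C k (\<lambda>y. \<xi> t0 (\<phi> t0 y) g) x"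
    proof -
      have "((snd C x)(dimM := t0, k := s))(dimM := 0) = (snd C x)(k := s)" for s
        using k chart_euc[OF C] by (auto simp: fun_eq_iff euc_iff)
      then show ?thesis using k by (simp add: partial_deriv_def chart_partial_def del: fun_upd_apply) simp
    qed
    finally show ?thesis .
  qed
  have "((\<lambda>t. \<Sum>k<dimM. v (\<lambda>y. snd C y k) * chart_partial C k (\<lambda>y. g (\<phi> t y)) x) has_real_derivative
      (\<Sum>k<dimM. v (\<lambda>y. snd C y k) * chart_partial C k (\<lambda>y. \<xi> t0 (\<phi> t0 y) g) x)) (at t0)"
    by (intro DERIV_sum DERIV_cmult part) auto
  then have d: "((\<lambda>t. \<Sum>k<dimM. v (\<lambda>y. snd C y k) * chart_partial C k (\<lambda>y. g (\<phi> t y)) x) has_real_derivative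
      v (\<lambda>y. \<xi> t0 (\<phi> t0 y) g)) (at t0)"
    by (simp only: tangent_expand[OF v C velocity_along_flow_analytic[OF x t0 V g]])
  have "\<forall>\<^sub>F t in nhds t0. (\<Sum>k<dimM. v (\<lambda>y. snd C y k) * chart_partial C k (\<lambda>y. g (\<phi> t y)) x) = v (\<lambda>y. g (\<phi> t y))"
    using flow_near[OF x t0 V]
  proof eventually_elim
    case (elim t)
    have "analytic_at (\<lambda>y. g (\<phi> t y)) x"
      by (rule analytic_at_compose_map[OF flow_maps(2) x g]) (use elim in auto)
    from tangent_expand[OF v C this] show ?case by simp
  qed
  from DERIV_cong_ev[OF refl this refl] d show ?thesis by simp
qed

text \<open>At one fixed time the analytic inverse is part of being an automorphism, so composing it
  with \<open>velocity_along_flow_analytic\<close> is enough. Analyticity jointly in time is a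
  different matter and comes later.\<close>

lemma velocity_component_analytic:
  assumes C: "C \<in> atlas M" "y \<in> fst C" and t0: "\<bar>t0\<bar> < e" and i: "i < dimM"
  shows "analytic_at (field_component C (\<xi> t0) i) y"
proof -
  have y: "y \<in> carrier" by (rule chart_carrier[OF C])
  have x: "\<psi> t0 y \<in> carrier" by (rule inverse_carrier[OF t0 y])
  have fx: "\<phi> t0 (\<psi> t0 y) \<in> fst C" using C flow_inverse[OF t0 y] by simp
  have "analytic_at (\<lambda>x. \<xi> t0 (\<phi> t0 x) (\<lambda>y. snd C y i)) (\<psi> t0 y)"
    by (rule velocity_along_flow_analytic[OF x t0 atlas_facts(1)[OF C(1)] fx analytic_at_coord[OF C(1) _ i]])
  from analytic_at_compose_map[OF flow_maps(3)[OF t0] y this]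
  show ?thesis
    by (rule analytic_at_local[OF _ openin_topspace y]) (simp add: flow_inverse[OF t0] field_component_def)
qed

section \<open>Transport of vectors and covectors along the flow\<close>

lemma push_vec_flow_tangent: "\<bar>t\<bar> < e \<Longrightarrow> x \<in> carrier \<Longrightarrow> v \<in> T x \<Longrightarrow> push_vec M (\<phi> t) x v \<in> T (\<phi> t x)"
  by (rule push_vec_tangent[OF flow_maps(2)])

text \<open>The linearised flow equation: the components of a transported vector evolve by the
  Jacobian matrix of the velocity, because differentiation in time and the derivation
  \<open>v\<close> commute.\<close>

lemma push_vec_component_derivative:
  assumes x: "x \<in> carrier" and t0: "\<bar>t0\<bar> < e" and C: "C \<in> atlas M" "\<phi> t0 x \<in> fst C"
    and v: "v \<in> T x" and i: "i < dimM"
  shows "((\<lambda>t. push_vec M (\<phi> t) x v (\<lambda>y. snd C y i)) has_real_derivative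
    (\<Sum>k<dimM. chart_partial C k (field_component C (\<xi> t0) i) (\<phi> t0 x) * push_vec M (\<phi> t0) x v (\<lambda>y. snd C y k))) (at t0)"
proof -
  let ?g = "\<lambda>y. snd C y i"
  have d: "((\<lambda>t. v (\<lambda>y. ?g (\<phi> t y))) has_real_derivative v (\<lambda>y. \<xi> t0 (\<phi> t0 y) ?g)) (at t0)"
    by (rule tangent_flow_derivative[OF x t0 atlas_facts(1)[OF C(1)] C(2) analytic_at_coord[OF C(1) _ i] v])
  have an: "analytic_at (field_component C (\<xi> t0) i) (\<phi> t0 x)" by (rule velocity_component_analytic[OF C t0 i])
  have "v (\<lambda>y. \<xi> t0 (\<phi> t0 y) ?g) = push_vec M (\<phi> t0) x v (field_component C (\<xi> t0) i)"
    using an by (simp add: push_vec_def field_component_def)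
  also have "\<dots> = (\<Sum>k<dimM. chart_partial C k (field_component C (\<xi> t0) i) (\<phi> t0 x) * push_vec M (\<phi> t0) x v (\<lambda>y. snd C y k))"
    unfolding tangent_expand[OF push_vec_flow_tangent[OF t0 x v] C an] by (rule sum.cong) simp_all
  finally have eq: "v (\<lambda>y. \<xi> t0 (\<phi> t0 y) ?g) = \<dots>" .
  have "\<forall>\<^sub>F t in nhds t0. v (\<lambda>y. ?g (\<phi> t y)) = push_vec M (\<phi> t) x v ?g"
    using flow_near[OF x t0 atlas_facts(1)[OF C(1)] C(2)]
  proof eventually_elim
    case (elim t)
    then have "analytic_at ?g (\<phi> t x)" by (intro analytic_at_coord[OF C(1) _ i]) simp
    then show ?case by (simp add: push_vec_def)
  qed
  from DERIV_cong_ev[OF refl this refl] d show ?thesis by (simp only: eq)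
qed

lemma push_inverse_push:
  assumes "\<bar>t\<bar> < e" "x \<in> carrier" "v \<in> T x"
  shows "push_vec M (\<psi> t) (\<phi> t x) (push_vec M (\<phi> t) x v) = v"
  by (rule push_vec_inverse[OF flow_maps(2,3)[OF assms(1)] inverse_flow[OF assms(1)] assms(2,3)])

lemma push_push_inverse:
  assumes t: "\<bar>t\<bar> < e" and x: "x \<in> carrier" and w: "w \<in> T (\<phi> t x)"
  shows "push_vec M (\<psi> t) (\<phi> t x) w \<in> T x" "push_vec M (\<phi> t) x (push_vec M (\<psi> t) (\<phi> t x) w) = w"
proof -
  have fx: "\<phi> t x \<in> carrier" by (rule flow_carrier[OF t x])
  show "push_vec M (\<psi> t) (\<phi> t x) w \<in> T x"
    using push_vec_tangent[OF flow_maps(3)[OF t] fx w] by (simp add: inverse_flow[OF t x])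
  show "push_vec M (\<phi> t) x (push_vec M (\<psi> t) (\<phi> t x) w) = w"
    using push_vec_inverse[OF flow_maps(3,2)[OF t] flow_inverse[OF t] fx w] by (simp add: inverse_flow[OF t x])
qed

lemma inv_push:
  assumes t: "\<bar>t\<bar> < e" and x: "x \<in> carrier" and w: "w \<in> T (\<phi> t x)"
  shows "inv_into (T x) (push_vec M (\<phi> t) x) w = push_vec M (\<psi> t) (\<phi> t x) w"
proof -
  have "inj_on (push_vec M (\<phi> t) x) (T x)"
    by (rule inj_on_inverseI[where g = "push_vec M (\<psi> t) (\<phi> t x)"]) (rule push_inverse_push[OF t x])
  from inv_into_f_f[OF this push_push_inverse(1)[OF t x w]] show ?thesis
    by (simp add: push_push_inverse(2)[OF t x w])
qed

lemma push_covec_eq: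
  assumes "\<bar>t\<bar> < e" "x \<in> carrier" "w \<in> T (\<phi> t x)"
  shows "push_covec M (\<phi> t) x \<omega> w = \<omega> (push_vec M (\<psi> t) (\<phi> t x) w)"
  using assms by (simp add: push_covec_def inv_push)

lemma push_covec_push_vec:
  assumes "\<bar>t\<bar> < e" "x \<in> carrier" "v \<in> T x"
  shows "push_covec M (\<phi> t) x \<omega> (push_vec M (\<phi> t) x v) = \<omega> v"
  using push_covec_eq[OF assms(1,2) push_vec_flow_tangent[OF assms]] push_inverse_push[OF assms] by simp

lemma push_covec_cotangent:
  assumes t: "\<bar>t\<bar> < e" and x: "x \<in> carrier" and w: "\<omega> \<in> T' x"
  shows "push_covec M (\<phi> t) x \<omega> \<in> T' (\<phi> t x)"
proof (rule cotangentI)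
  fix u v a b assume u: "u \<in> T (\<phi> t x)" and v: "v \<in> T (\<phi> t x)"
  show "push_covec M (\<phi> t) x \<omega> (\<lambda>f. a * u f + b * v f) = a * push_covec M (\<phi> t) x \<omega> u + b * push_covec M (\<phi> t) x \<omega> v"
    unfolding push_covec_eq[OF t x u] push_covec_eq[OF t x v] push_covec_eq[OF t x tangent_lincomb[OF u v]] push_vec_lincomb
    by (rule cotangentD[OF w push_push_inverse(1)[OF t x u] push_push_inverse(1)[OF t x v]])
qed (simp add: push_covec_def)

text \<open>The dual equation, with transposed matrix and opposite sign. The pairing of a
  transported covector with a transported vector is constant in time; for a basis of vectors this is
  a linear system for the covector components, to which \<open>linear_system_derivative\<close>
  applies.\<close>

lemma push_covec_component_derivative:
  assumes x: "x \<in> carrier" and t0: "\<bar>t0\<bar> < e" and C: "C \<in> atlas M" "\<phi> t0 x \<in> fst C"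
    and w: "\<omega> \<in> T' x" and j: "j < dimM"
  shows "((\<lambda>t. push_covec M (\<phi> t) x \<omega> (frame C j (\<phi> t x))) has_real_derivative
    (\<Sum>k<dimM. - chart_partial C j (field_component C (\<xi> t0) k) (\<phi> t0 x) * push_covec M (\<phi> t0) x \<omega> (frame C k (\<phi> t0 x)))) (at t0)"
proof -
  let ?W = "\<lambda>j t. push_covec M (\<phi> t) x \<omega> (frame C j (\<phi> t x))"
  \<comment> \<open>The vectors that become the coordinate frame at time \<open>t0\<close>. With
    this basis the matrix of the system is the identity there, so \<open>A\<close> vanishes at
    \<open>t0\<close>.\<close>
  define u where "u j = push_vec M (\<psi> t0) (\<phi> t0 x) (frame C j (\<phi> t0 x))" for j
  have u: "u j \<in> T x" "push_vec M (\<phi> t0) x (u j) = frame C j (\<phi> t0 x)" if "j < dimM" for j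
    using push_push_inverse[OF t0 x coord_vec_tangent[OF C that]] by (simp_all add: u_def)
  define A where "A j l t = push_vec M (\<phi> t) x (u j) (\<lambda>y. snd C y l) - (if j = l then 1 else 0)" for j l t
  have "(?W j has_real_derivative - (\<Sum>l<dimM. chart_partial C j (field_component C (\<xi> t0) l) (\<phi> t0 x) * ?W l t0)) (at t0)"
  proof (rule linear_system_derivative[where A = A, OF _ _ _ j])
    fix j l assume jl: "j < dimM" "l < dimM"
    show "A j l t0 = 0" using u(2)[OF jl(1)] coord_vec_coord[OF C jl] by (simp add: A_def)
    have "(\<Sum>k<dimM. chart_partial C k (field_component C (\<xi> t0) l) (\<phi> t0 x) * push_vec M (\<phi> t0) x (u j) (\<lambda>y. snd C y k)) =
        (\<Sum>k<dimM. if k = j then chart_partial C j (field_component C (\<xi> t0) l) (\<phi> t0 x) else 0)"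
      by (rule sum.cong) (auto simp: u(2)[OF jl(1)] coord_vec_coord[OF C jl(1)])
    also have "\<dots> = chart_partial C j (field_component C (\<xi> t0) l) (\<phi> t0 x)" using jl by simp
    finally have s: "(\<Sum>k<dimM. chart_partial C k (field_component C (\<xi> t0) l) (\<phi> t0 x) * push_vec M (\<phi> t0) x (u j) (\<lambda>y. snd C y k)) =
        chart_partial C j (field_component C (\<xi> t0) l) (\<phi> t0 x)" .
    from DERIV_diff[OF push_vec_component_derivative[OF x t0 C u(1)[OF jl(1)] jl(2)] DERIV_const]
    show "(A j l has_real_derivative chart_partial C j (field_component C (\<xi> t0) l) (\<phi> t0 x)) (at t0)"
      unfolding A_def s by simp
  next
    show "\<forall>\<^sub>F t in nhds t0. \<forall>j<dimM. ?W j t = ?W j t0 - (\<Sum>l<dimM. A j l t * ?W l t)"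
      using flow_near[OF x t0 atlas_facts(1)[OF C(1)] C(2)]
    proof eventually_elim
      case (elim t)
      then have t: "\<bar>t\<bar> < e" and Ct: "\<phi> t x \<in> fst C" by auto
      show ?case
      proof (intro allI impI)
        fix j assume j: "j < dimM"
        have "?W j t0 = \<omega> (u j)" using push_covec_push_vec[OF t0 x u(1)[OF j]] by (simp only: u(2)[OF j])
        also have "\<dots> = push_covec M (\<phi> t) x \<omega> (push_vec M (\<phi> t) x (u j))"
          by (rule push_covec_push_vec[OF t x u(1)[OF j], symmetric])
        also have "\<dots> = (\<Sum>l<dimM. push_vec M (\<phi> t) x (u j) (\<lambda>y. snd C y l) * ?W l t)"
          by (rule cotangent_expand[OF push_covec_cotangent[OF t x w] C(1) Ct push_vec_flow_tangent[OF t x u(1)[OF j]]])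
        also have "\<dots> = (\<Sum>l<dimM. A j l t * ?W l t + (if l = j then ?W j t else 0))"
          by (rule sum.cong) (auto simp: A_def algebra_simps)
        also have "\<dots> = (\<Sum>l<dimM. A j l t * ?W l t) + ?W j t" using j by (simp add: sum.distrib)
        finally show "?W j t = ?W j t0 - (\<Sum>l<dimM. A j l t * ?W l t)" by simp
      qed
    qed
  qed
  then show ?thesis by (simp add: sum_negf)
qed

text \<open>The sum in \<open>lie_deriv\<close> with the chart as a parameter, so that different
  charts can be compared.\<close>

definition lie_form :: "'a chart \<Rightarrow> 'a vector_field \<Rightarrow> 'a tensor_field \<Rightarrow> 'a tensor_field" where
  "lie_form C \<eta> \<beta> x vs ws = (\<Sum>I \<in> multi_indices dimM (length vs). \<Sum>J \<in> multi_indices dimM (length ws).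
       lie_component M C \<eta> \<beta> I J x *
       (\<Prod>r<length vs. (vs ! r) (\<lambda>y. snd C y (I ! r))) *
       (\<Prod>s<length ws. (ws ! s) (frame C (J ! s) x)))"

lemma tensor_args_push:
  assumes t: "\<bar>t\<bar> < e" and x: "x \<in> carrier" and a: "(vs, ws) \<in> tensor_args M p q x"
  shows "(map (push_vec M (\<phi> t) x) vs, map (push_covec M (\<phi> t) x) ws) \<in> tensor_args M p q (\<phi> t x)"
  using a push_vec_flow_tangent[OF t x] push_covec_cotangent[OF t x] by (auto simp: tensor_args_def)

text \<open>In a chart around \<open>\<phi> t0 x\<close> the pullback is a sum of products of a
  tensor component, vector components and covector components. The product rule yields three groups
  of terms, which are the three sums in \<open>lie_component\<close>.\<close>

lemma pullback_derivative:
  assumes x: "x \<in> carrier" and t0: "\<bar>t0\<bar> < e" and C: "C \<in> atlas M" "\<phi> t0 x \<in> fst C"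
    and \<beta>: "analytic_tensor_field M p q \<beta>" and a: "(vs, ws) \<in> tensor_args M p q x"
  shows "((\<lambda>t. pullback M (\<phi> t) \<beta> x vs ws) has_real_derivative
    lie_form C (\<xi> t0) \<beta> (\<phi> t0 x) (map (push_vec M (\<phi> t0) x) vs) (map (push_covec M (\<phi> t0) x) ws)) (at t0)"
proof -
  define y where "y = \<phi> t0 x"
  define V where "V r i t = push_vec M (\<phi> t) x (vs ! r) (\<lambda>y. snd C y i)" for r i t
  define W where "W s j t = push_covec M (\<phi> t) x (ws ! s) (frame C j (\<phi> t x))" for s j t
  define c where "c I J t = tensor_component M C \<beta> I J (\<phi> t x)" for I J t
  define X where "X k = field_component C (\<xi> t0) k" for k
  have len: "length vs = p" "length ws = q" using a by (auto simp: tensor_args_def)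
  have vs: "vs ! r \<in> T x" if "r < p" for r using a that by (auto simp: tensor_args_def)
  have ws: "ws ! s \<in> T' x" if "s < q" for s using a that by (auto simp: tensor_args_def)
  have dV: "(V r i has_real_derivative (\<Sum>k<dimM. chart_partial C k (X i) y * V r k t0)) (at t0)"
    if "r < p" "i < dimM" for r i
    using push_vec_component_derivative[OF x t0 C vs[OF that(1)] that(2)] by (simp only: V_def[abs_def] X_def y_def)
  have dW: "(W s j has_real_derivative (\<Sum>k<dimM. - chart_partial C j (X k) y * W s k t0)) (at t0)"
    if "s < q" "j < dimM" for s j
    using push_covec_component_derivative[OF x t0 C ws[OF that(1)] that(2)] by (simp only: W_def[abs_def] X_def y_def)
  have near: "\<forall>\<^sub>F t in nhds t0. \<bar>t\<bar> < e \<and> \<phi> t x \<in> fst C" by (rule flow_near[OF x t0 atlas_facts(1)[OF C(1)] C(2)])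
  have dc: "(c I J has_real_derivative (\<Sum>k<dimM. X k y * chart_partial C k (tensor_component M C \<beta> I J) y)) (at t0)"
    if I: "I \<in> multi_indices dimM p" and J: "J \<in> multi_indices dimM q" for I J
  proof -
    have "analytic_at (tensor_component M C \<beta> I J) y"
      using \<beta> C I J unfolding analytic_tensor_field_def y_def by blast
    from analytic_atD[OF this C[folded y_def]]
    have an: "real_analytic_at dimM (\<lambda>z. tensor_component M C \<beta> I J (chart_inv C z)) (snd C (\<phi> t0 x))" by (simp add: y_def)
    have "((\<lambda>t. tensor_component M C \<beta> I J (chart_inv C (snd C (\<phi> t x)))) has_real_derivative
        (\<Sum>k<dimM. X k y * partial_deriv k (\<lambda>z. tensor_component M C \<beta> I J (chart_inv C z)) (snd C (\<phi> t0 x)))) (at t0)"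
    proof (rule real_analytic_at_chain[where \<gamma> = "\<lambda>t. snd C (\<phi> t x)", OF an])
      fix i assume i: "i < dimM"
      show "((\<lambda>s. snd C (\<phi> s x) i) has_real_derivative X i y) (at t0)"
        using flow_has_velocity[OF x t0 analytic_at_coord[OF C i]] by (simp add: X_def y_def field_component_def)
    next
      show "\<forall>\<^sub>F s in nhds t0. snd C (\<phi> s x) \<in> euc dimM"
        using near by eventually_elim (use chart_euc[OF C(1)] in blast)
    qed
    then have d: "((\<lambda>t. tensor_component M C \<beta> I J (chart_inv C (snd C (\<phi> t x)))) has_real_derivative
        (\<Sum>k<dimM. X k y * chart_partial C k (tensor_component M C \<beta> I J) y)) (at t0)"
      by (simp add: chart_partial_def y_def)
    have "\<forall>\<^sub>F t in nhds t0. tensor_component M C \<beta> I J (chart_inv C (snd C (\<phi> t x))) = c I J t"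
      using near by eventually_elim (use C(1) in \<open>simp add: c_def\<close>)
    from DERIV_cong_ev[OF refl this refl] d show ?thesis by simp
  qed
  define PV where "PV I t = (\<Prod>r<p. V r (I ! r) t)" for I t
  define PW where "PW J t = (\<Prod>s<q. W s (J ! s) t)" for J t
  define DV where "DV I r = (\<Prod>s<p. if s = r then (\<Sum>k<dimM. chart_partial C k (X (I ! r)) y * V r k t0) else V s (I ! s) t0)" for I r
  define DW where "DW J r = (\<Prod>s<q. if s = r then (\<Sum>k<dimM. - chart_partial C (J ! r) (X k) y * W r k t0) else W s (J ! s) t0)" for J r
  have dPV: "(PV I has_real_derivative (\<Sum>r<p. DV I r)) (at t0)" if "I \<in> multi_indices dimM p" for I
    unfolding PV_def[abs_def] DV_def
    by (rule DERIV_prod_lessThan) (use dV multi_indices_nth[OF that] in blast)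
  have dPW: "(PW J has_real_derivative (\<Sum>r<q. DW J r)) (at t0)" if "J \<in> multi_indices dimM q" for J
    unfolding PW_def[abs_def] DW_def
    by (rule DERIV_prod_lessThan) (use dW multi_indices_nth[OF that] in blast)
  define Dc where "Dc I J = (\<Sum>k<dimM. X k y * chart_partial C k (tensor_component M C \<beta> I J) y)" for I J
  have "((\<lambda>t. \<Sum>I\<in>multi_indices dimM p. \<Sum>J\<in>multi_indices dimM q. c I J t * PV I t * PW J t) has_real_derivative
      (\<Sum>I\<in>multi_indices dimM p. \<Sum>J\<in>multi_indices dimM q.
        (Dc I J * PV I t0 + (\<Sum>r<p. DV I r) * c I J t0) * PW J t0 + (\<Sum>s<q. DW J s) * (c I J t0 * PV I t0))) (at t0)"
    unfolding Dc_def by (intro DERIV_sum DERIV_mult dc dPV dPW)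
  also have "(\<Sum>I\<in>multi_indices dimM p. \<Sum>J\<in>multi_indices dimM q.
        (Dc I J * PV I t0 + (\<Sum>r<p. DV I r) * c I J t0) * PW J t0 + (\<Sum>s<q. DW J s) * (c I J t0 * PV I t0)) =
      (\<Sum>I\<in>multi_indices dimM p. \<Sum>J\<in>multi_indices dimM q. Dc I J * PV I t0 * PW J t0)
    + (\<Sum>r<p. \<Sum>J\<in>multi_indices dimM q. PW J t0 * (\<Sum>I\<in>multi_indices dimM p. c I J t0 * DV I r))
    + (\<Sum>s<q. \<Sum>I\<in>multi_indices dimM p. PV I t0 * (\<Sum>J\<in>multi_indices dimM q. c I J t0 * DW J s))"
  proof -
    have 1: "(\<Sum>I\<in>multi_indices dimM p. \<Sum>J\<in>multi_indices dimM q. \<Sum>r<p. PW J t0 * (c I J t0 * DV I r)) =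
      (\<Sum>r<p. \<Sum>J\<in>multi_indices dimM q. PW J t0 * (\<Sum>I\<in>multi_indices dimM p. c I J t0 * DV I r))"
      unfolding sum_distrib_left by (rule trans[OF sum.swap sum_rotate3])
    have 2: "(\<Sum>I\<in>multi_indices dimM p. \<Sum>J\<in>multi_indices dimM q. \<Sum>s<q. PV I t0 * (c I J t0 * DW J s)) =
      (\<Sum>s<q. \<Sum>I\<in>multi_indices dimM p. PV I t0 * (\<Sum>J\<in>multi_indices dimM q. c I J t0 * DW J s))"
      unfolding sum_distrib_left by (rule sum_rotate3)
    have "(Dc I J * PV I t0 + (\<Sum>r<p. DV I r) * c I J t0) * PW J t0 + (\<Sum>s<q. DW J s) * (c I J t0 * PV I t0) =
        Dc I J * PV I t0 * PW J t0 + (\<Sum>r<p. PW J t0 * (c I J t0 * DV I r)) + (\<Sum>s<q. PV I t0 * (c I J t0 * DW J s))" for I J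
      unfolding sum_distrib_left[symmetric] by (simp add: algebra_simps)
    then show ?thesis by (simp only: sum.distrib 1 2)
  qed
  \<comment> \<open>Relabelling the indices moves the Jacobian of the velocity from the vector
    components to the tensor components.\<close>
  also have "(\<Sum>r<p. \<Sum>J\<in>multi_indices dimM q. PW J t0 * (\<Sum>I\<in>multi_indices dimM p. c I J t0 * DV I r)) =
     (\<Sum>I\<in>multi_indices dimM p. \<Sum>J\<in>multi_indices dimM q.
        (\<Sum>r<p. \<Sum>k<dimM. chart_partial C (I ! r) (X k) y * c (I[r := k]) J t0) * PV I t0 * PW J t0)"
  proof -
    have eq: "(\<Sum>I\<in>multi_indices dimM p. c I J t0 * DV I r) =
        (\<Sum>I\<in>multi_indices dimM p. (\<Sum>k<dimM. chart_partial C (I ! r) (X k) y * c (I[r := k]) J t0) * PV I t0)"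
      if "r < p" for J r
      unfolding DV_def PV_def
      using sum_multi_indices_transpose[OF that, where n = dimM and c = "\<lambda>I. c I J t0" and V = "\<lambda>r i. V r i t0"
        and A = "\<lambda>a k. chart_partial C k (X a) y"] .
    have "(\<Sum>r<p. \<Sum>J\<in>multi_indices dimM q. PW J t0 * (\<Sum>I\<in>multi_indices dimM p. c I J t0 * DV I r)) =
      (\<Sum>r<p. \<Sum>J\<in>multi_indices dimM q. \<Sum>I\<in>multi_indices dimM p.
        (\<Sum>k<dimM. chart_partial C (I ! r) (X k) y * c (I[r := k]) J t0) * PV I t0 * PW J t0)"
      by (intro sum.cong refl, subst eq, simp) (rule mult_sum_right)
    also have "\<dots> = (\<Sum>J\<in>multi_indices dimM q. \<Sum>I\<in>multi_indices dimM p. \<Sum>r<p.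
        (\<Sum>k<dimM. chart_partial C (I ! r) (X k) y * c (I[r := k]) J t0) * PV I t0 * PW J t0)"
      by (rule sum_rotate3[symmetric])
    also have "\<dots> = (\<Sum>I\<in>multi_indices dimM p. \<Sum>J\<in>multi_indices dimM q. \<Sum>r<p.
        (\<Sum>k<dimM. chart_partial C (I ! r) (X k) y * c (I[r := k]) J t0) * PV I t0 * PW J t0)"
      by (rule sum.swap)
    finally show ?thesis by (simp only: sum_distrib_right)
  qed
  \<comment> \<open>The same for the covectors; the minus sign is that of the dual equation.\<close>
  also have "(\<Sum>s<q. \<Sum>I\<in>multi_indices dimM p. PV I t0 * (\<Sum>J\<in>multi_indices dimM q. c I J t0 * DW J s)) =
     (\<Sum>I\<in>multi_indices dimM p. \<Sum>J\<in>multi_indices dimM q.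
        (\<Sum>s<q. \<Sum>k<dimM. - chart_partial C k (X (J ! s)) y * c I (J[s := k]) t0) * PV I t0 * PW J t0)"
  proof -
    have eq: "(\<Sum>J\<in>multi_indices dimM q. c I J t0 * DW J s) =
        (\<Sum>J\<in>multi_indices dimM q. (\<Sum>k<dimM. - chart_partial C k (X (J ! s)) y * c I (J[s := k]) t0) * PW J t0)"
      if "s < q" for I s
      unfolding DW_def PW_def
      using sum_multi_indices_transpose[OF that, where n = dimM and c = "\<lambda>J. c I J t0" and V = "\<lambda>r i. W r i t0"
        and A = "\<lambda>a k. - chart_partial C a (X k) y"] .
    have "(\<Sum>s<q. \<Sum>I\<in>multi_indices dimM p. PV I t0 * (\<Sum>J\<in>multi_indices dimM q. c I J t0 * DW J s)) =
      (\<Sum>s<q. \<Sum>I\<in>multi_indices dimM p. \<Sum>J\<in>multi_indices dimM q.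
        (\<Sum>k<dimM. - chart_partial C k (X (J ! s)) y * c I (J[s := k]) t0) * PV I t0 * PW J t0)"
      by (intro sum.cong refl, subst eq, simp) (rule mult_sum_middle)
    also have "\<dots> = (\<Sum>I\<in>multi_indices dimM p. \<Sum>J\<in>multi_indices dimM q. \<Sum>s<q.
        (\<Sum>k<dimM. - chart_partial C k (X (J ! s)) y * c I (J[s := k]) t0) * PV I t0 * PW J t0)"
      by (rule sum_rotate3[symmetric])
    finally show ?thesis by (simp only: sum_distrib_right)
  qed
  also have "(\<Sum>I\<in>multi_indices dimM p. \<Sum>J\<in>multi_indices dimM q. Dc I J * PV I t0 * PW J t0) +
     (\<Sum>I\<in>multi_indices dimM p. \<Sum>J\<in>multi_indices dimM q.
        (\<Sum>r<p. \<Sum>k<dimM. chart_partial C (I ! r) (X k) y * c (I[r := k]) J t0) * PV I t0 * PW J t0) +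
     (\<Sum>I\<in>multi_indices dimM p. \<Sum>J\<in>multi_indices dimM q.
        (\<Sum>s<q. \<Sum>k<dimM. - chart_partial C k (X (J ! s)) y * c I (J[s := k]) t0) * PV I t0 * PW J t0) =
     (\<Sum>I\<in>multi_indices dimM p. \<Sum>J\<in>multi_indices dimM q. lie_component M C (\<xi> t0) \<beta> I J y * PV I t0 * PW J t0)"
    unfolding sum.distrib[symmetric]
  proof (intro sum.cong refl)
    fix I J assume "I \<in> multi_indices dimM p" "J \<in> multi_indices dimM q"
    then have "length I = p" "length J = q" by (auto simp: multi_indices_def)
    then have "lie_component M C (\<xi> t0) \<beta> I J y = Dc I J
      + (\<Sum>r<p. \<Sum>k<dimM. chart_partial C (I ! r) (X k) y * c (I[r := k]) J t0)
      + (\<Sum>s<q. \<Sum>k<dimM. - chart_partial C k (X (J ! s)) y * c I (J[s := k]) t0)"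
      by (simp add: lie_component_def Dc_def X_def c_def y_def sum_negf)
    then show "Dc I J * PV I t0 * PW J t0 +
        (\<Sum>r<p. \<Sum>k<dimM. chart_partial C (I ! r) (X k) y * c (I[r := k]) J t0) * PV I t0 * PW J t0 +
        (\<Sum>s<q. \<Sum>k<dimM. - chart_partial C k (X (J ! s)) y * c I (J[s := k]) t0) * PV I t0 * PW J t0 =
        lie_component M C (\<xi> t0) \<beta> I J y * PV I t0 * PW J t0"
      by (simp only: distrib_right)
  qed
  also have "\<dots> = lie_form C (\<xi> t0) \<beta> y (map (push_vec M (\<phi> t0) x) vs) (map (push_covec M (\<phi> t0) x) ws)"
    unfolding lie_form_def by (simp add: len PV_def PW_def V_def W_def y_def)
  finally have d: "((\<lambda>t. \<Sum>I\<in>multi_indices dimM p. \<Sum>J\<in>multi_indices dimM q. c I J t * PV I t * PW J t) has_real_derivative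
    lie_form C (\<xi> t0) \<beta> (\<phi> t0 x) (map (push_vec M (\<phi> t0) x) vs) (map (push_covec M (\<phi> t0) x) ws)) (at t0)"
    by (simp only: y_def)
  have "\<forall>\<^sub>F t in nhds t0. (\<Sum>I\<in>multi_indices dimM p. \<Sum>J\<in>multi_indices dimM q. c I J t * PV I t * PW J t) = pullback M (\<phi> t) \<beta> x vs ws"
    using near
  proof eventually_elim
    case (elim t)
    then have t: "\<bar>t\<bar> < e" and Ct: "\<phi> t x \<in> fst C" by auto
    have "multilinear_at M p q (\<phi> t x) (\<beta> (\<phi> t x))"
      using \<beta> flow_carrier[OF t x] unfolding analytic_tensor_field_def by blast
    from multilinear_at_expand[OF this C(1) Ct tensor_args_push[OF t x a]]
    show ?case by (simp add: pullback_def c_def PV_def PW_def V_def W_def tensor_component_def len)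
  qed
  from DERIV_cong_ev[OF refl this refl] d show ?thesis by simp
qed

end

section \<open>Joint analyticity of the inverse flow and of the velocity\<close>

abbreviation analytic_at_0 :: "(real \<Rightarrow> real) \<Rightarrow> bool" where
  "analytic_at_0 h \<equiv> real_analytic_at 1 (\<lambda>z. h (z 0)) (\<lambda>_. 0)"

lemma zero_euc: "(\<lambda>_. 0) \<in> euc n"
  by (simp add: euc_iff)

lemma eventually_cube_one:
  assumes "\<forall>\<^sub>F t in nhds 0. P t"
  obtains r where "r > 0" "\<And>t :: real. \<bar>t\<bar> \<le> r \<Longrightarrow> P t"
proof -
  obtain d where d: "d > 0" "\<And>t. dist t 0 < d \<Longrightarrow> P t" using assms unfolding eventually_nhds_metric by blast
  show thesis by (rule that[of "d / 2"]) (use d in \<open>auto simp: dist_real_def\<close>)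
qed

lemma analytic_at_0_cong:
  assumes "analytic_at_0 f" "\<forall>\<^sub>F t in nhds 0. f t = g t"
  shows "analytic_at_0 g"
proof -
  obtain r where r: "r > 0" "\<And>t. \<bar>t\<bar> \<le> r \<Longrightarrow> f t = g t" using assms(2) by (rule eventually_cube_one) (rule that)
  show ?thesis by (rule real_analytic_at_cong[OF assms(1) r(1)]) (simp add: cube_iff r(2))
qed

lemma analytic_at_0_line:
  assumes "real_analytic_at (Suc n) G a" "a \<in> euc n"
  shows "analytic_at_0 (\<lambda>t. G (a(n := t)))"
proof (rule real_analytic_at_compose[where g = G and k = "Suc n" and f = "\<lambda>z. a(n := z 0)", OF _ _ zero_euc zero_less_one])
  show "real_analytic_at (Suc n) G (a(n := 0))" using assms by (simp add: euc_upd_last)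
  fix j assume "j < Suc n"
  then show "real_analytic_at 1 (\<lambda>z. (a(n := z 0)) j) (\<lambda>_. 0)"
    by (cases "j = n") (simp_all add: real_analytic_at_const real_analytic_at_coord)
qed (rule euc_Suc[OF assms(2)])

lemma analytic_at_0_embed:
  assumes "analytic_at_0 h" "i < m"
  shows "real_analytic_at m (\<lambda>z. h (z i)) (\<lambda>_. 0)"
proof -
  have "real_analytic_at m (\<lambda>z. h ((\<lambda>j :: nat. if j = 0 then z i else 0) 0)) (\<lambda>_. 0)"
  proof (rule real_analytic_at_compose[where g = "\<lambda>z. h (z 0)" and k = 1 and f = "\<lambda>z j. if j = 0 then z i else 0",
        OF _ _ zero_euc zero_less_one])
    have "(\<lambda>j. if j = (0 :: nat) then 0 else 0) = (\<lambda>_. 0 :: real)" by auto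
    then show "real_analytic_at 1 (\<lambda>z. h (z 0)) (\<lambda>j. if j = 0 then (\<lambda>_. 0) i else 0)" using assms(1) by simp
    fix j :: nat assume "j < 1"
    then show "real_analytic_at m (\<lambda>z. if j = 0 then z i else 0) (\<lambda>_. 0)"
      using assms(2) by (simp add: real_analytic_at_coord)
  qed (simp add: euc_iff)
  then show ?thesis by simp
qed

lemma taylor_coeff_cong:
  assumes "\<forall>\<^sub>F t in nhds 0. f t = g t"
  shows "taylor_coeff k f = taylor_coeff k g"
  unfolding taylor_coeff_def using higher_deriv_cong_ev[OF assms refl] by simp

lemma taylor_coeff_add:
  assumes "analytic_at_0 f" "analytic_at_0 g"
  shows "taylor_coeff k (\<lambda>t. f t + g t) = taylor_coeff k f + taylor_coeff k g"
proof -
  obtain r N N' where r: "r > 0" "bseries 1 (\<lambda>_. 0) r N (\<lambda>z. f (z 0))" "bseries 1 (\<lambda>_. 0) r N' (\<lambda>z. g (z 0))"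
    using assms by (rule real_analytic_at_binary) (rule that)
  show ?thesis
  proof (rule taylor_coeff_unique[OF r(1)])
    fix t assume t: "\<bar>t\<bar> \<le> r"
    from has_sum_add[OF taylor_has_sum[OF r(2) t] taylor_has_sum[OF r(3) t]]
    show "((\<lambda>k. (taylor_coeff k f + taylor_coeff k g) * t ^ k) has_sum f t + g t) UNIV"
      by (simp only: distrib_right)
  qed
qed

lemma taylor_coeff_cmult:
  assumes "analytic_at_0 f"
  shows "taylor_coeff k (\<lambda>t. b * f t) = b * taylor_coeff k f"
proof -
  obtain r N where r: "r > 0" "bseries 1 (\<lambda>_. 0) r N (\<lambda>z. f (z 0))"
    using assms by (rule real_analytic_atE) (rule that)
  show ?thesis
  proof (rule taylor_coeff_unique[OF r(1)])
    fix t assume t: "\<bar>t\<bar> \<le> r"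
    from has_sum_cmult_right[OF taylor_has_sum[OF r(2) t], of b]
    show "((\<lambda>k. b * taylor_coeff k f * t ^ k) has_sum b * f t) UNIV" by (simp only: mult.assoc)
  qed
qed

lemma taylor_coeff_sum:
  assumes "finite A" "\<And>i. i \<in> A \<Longrightarrow> analytic_at_0 (f i)"
  shows "taylor_coeff k (\<lambda>t. \<Sum>i\<in>A. f i t) = (\<Sum>i\<in>A. taylor_coeff k (f i))"
  using assms
proof (induction A)
  case empty
  show ?case using taylor_coeff_cmult[OF real_analytic_at_const[of 1 0], of k 0] by simp
next
  case (insert i A)
  have "analytic_at_0 (\<lambda>t. \<Sum>i\<in>A. f i t)" by (rule real_analytic_at_sum) (use insert in auto)
  from taylor_coeff_add[OF _ this, of "f i" k] insert show ?case by simp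
qed

lemma taylor_coeff_linear:
  assumes "finite A" "\<And>i. i \<in> A \<Longrightarrow> analytic_at_0 (f i)"
  shows "taylor_coeff k (\<lambda>t. \<Sum>i\<in>A. f i t * c i) = (\<Sum>i\<in>A. taylor_coeff k (f i) * c i)"
proof -
  have "taylor_coeff k (\<lambda>t. \<Sum>i\<in>A. c i * f i t) = (\<Sum>i\<in>A. taylor_coeff k (\<lambda>t. c i * f i t))"
    by (rule taylor_coeff_sum[OF assms(1)]) (intro real_analytic_at_mult real_analytic_at_const assms(2))
  also have "\<dots> = (\<Sum>i\<in>A. c i * taylor_coeff k (f i))"
    by (rule sum.cong[OF refl taylor_coeff_cmult[OF assms(2)]])
  finally show ?thesis by (simp only: mult.commute)
qed

lemma analytic_at_0_linear:
  assumes "\<And>i. i \<in> A \<Longrightarrow> analytic_at_0 (f i)"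
  shows "analytic_at_0 (\<lambda>t. \<Sum>i\<in>A. f i t * c i)"
  by (intro real_analytic_at_sum real_analytic_at_mult real_analytic_at_const assms)

lemma partial_deriv_cdivide:
  assumes "real_analytic_at n f a" "a \<in> euc n" "i < n"
  shows "partial_deriv i (\<lambda>z. f z / c) a = partial_deriv i f a / c"
  by (rule partial_derivI) (rule DERIV_cdivide[OF real_analytic_at_has_partial[OF assms]])

context analytic_manifold
begin

lemma chart_partial_analytic:
  assumes C: "C \<in> atlas M" "x \<in> fst C" and f: "analytic_at f x" and k: "k < dimM"
  shows "analytic_at (chart_partial C k f) x"
proof (rule analytic_at_chart[OF C])
  obtain s where s: "s > 0" and hs: "\<And>z. z \<in> cube dimM (snd C x) s \<Longrightarrow>
    z \<in> snd C ` fst C \<and> chart_inv C z \<in> fst C \<and> chart_inv C z \<in> fst C \<and> snd C (chart_inv C z) = z"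
    using C atlas_facts(1)[OF C(1)] C(2) by (rule chart_nbhd) (rule that)
  show "real_analytic_at dimM (\<lambda>z. chart_partial C k f (chart_inv C z)) (snd C x)"
    by (rule real_analytic_at_cong[OF real_analytic_at_partial[OF analytic_atD[OF f C] chart_euc[OF C] k] s])
       (simp add: chart_partial_def hs)
qed

end

context analytic_flow
begin

lemma e_0: "\<bar>0 :: real\<bar> < e"
  using e_pos by simp

lemma phi_zero: "x \<in> carrier \<Longrightarrow> \<phi> 0 x = x"
  using phi_0 by blast

lemma analytic_along_flow:
  assumes C: "C \<in> atlas M" "x \<in> fst C" and f: "analytic_at f x"
  shows "analytic_at_0 (\<lambda>t. f (\<phi> t x))"
proof -
  have x: "x \<in> carrier" by (rule chart_carrier[OF C])
  have "real_analytic_at (Suc dimM) (flow_expr C f) ((snd C x)(dimM := 0))"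
    by (rule flow_expr_analytic[OF C e_0]) (simp add: phi_zero[OF x] f)
  then have "real_analytic_at (Suc dimM) (flow_expr C f) (snd C x)" by (simp only: euc_upd_last[OF chart_euc[OF C]])
  from analytic_at_0_line[OF this chart_euc[OF C]] show ?thesis by (simp only: flow_expr_time[OF C])
qed

section \<open>The inverse flow near time 0\<close>

definition inverse_expr :: "'a chart \<Rightarrow> ('a \<Rightarrow> real) \<Rightarrow> (nat \<Rightarrow> real) \<Rightarrow> real" where
  "inverse_expr C g w = g (\<psi> (w dimM) (chart_inv C (w(dimM := 0))))"

definition velocity_expr :: "'a chart \<Rightarrow> nat \<Rightarrow> (nat \<Rightarrow> real) \<Rightarrow> real" where
  "velocity_expr C i w = field_component C (\<xi> (w dimM)) i (chart_inv C (w(dimM := 0)))"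

text \<open>Here \<open>w\<close> stands for a time and a point, and \<open>u\<close> for the same
  time and the preimage of that point; both points lie in the chart. Analyticity of the velocity and
  of the inverse flow are derived from this common set of facts.\<close>

definition inverse_point :: "'a chart \<Rightarrow> (nat \<Rightarrow> real) \<Rightarrow> (nat \<Rightarrow> real) \<Rightarrow> bool" where
  "inverse_point C w u \<longleftrightarrow> \<bar>w dimM\<bar> < e \<and> u dimM = w dimM \<and>
      chart_inv C (w(dimM := 0)) \<in> fst C \<and> chart_inv C (u(dimM := 0)) \<in> fst C \<and>
      snd C (chart_inv C (u(dimM := 0))) = u(dimM := 0) \<and>
      \<phi> (w dimM) (chart_inv C (u(dimM := 0))) = chart_inv C (w(dimM := 0)) \<and>
      \<psi> (w dimM) (chart_inv C (w(dimM := 0))) = chart_inv C (u(dimM := 0))"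

text \<open>Since \<open>\<phi>\<^sub>0\<close> is the identity, \<open>\<phi>\<^sub>t(z) = z + t S(t, z)\<close>, and the inverse solves a fixed point equation.\<close>

lemma inverse_flow_solution:
  assumes C: "C \<in> atlas M" "x \<in> fst C"
  obtains \<Psi> r where "r > 0" "\<And>j. j \<le> dimM \<Longrightarrow> real_analytic_at (Suc dimM) (\<lambda>w. \<Psi> w j) (snd C x)"
    "\<Psi> (snd C x) = snd C x" "\<And>w. w \<in> cube (Suc dimM) (snd C x) r \<Longrightarrow> \<Psi> w \<in> euc (Suc dimM)"
    "\<And>w. w \<in> cube (Suc dimM) (snd C x) r \<Longrightarrow> inverse_point C w (\<Psi> w)"
proof -
  let ?a = "snd C x"
  have x: "x \<in> carrier" by (rule chart_carrier[OF C])
  have a: "?a \<in> euc dimM" by (rule chart_euc[OF C])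
  have a0: "?a dimM = 0" using a by (simp add: euc_iff)
  have a_upd: "?a(dimM := 0) = ?a" by (rule euc_upd_last[OF a])
  have "\<phi> 0 x \<in> fst C" using C by (simp add: phi_zero[OF x])
  with C e_0 atlas_facts(1)[OF C(1)]
  obtain r2 where r2: "r2 > 0" "\<And>t. \<bar>t - 0\<bar> \<le> r2 \<Longrightarrow> \<bar>t\<bar> < e"
    and h: "\<And>t z. \<bar>t - 0\<bar> \<le> r2 \<Longrightarrow> z \<in> cube dimM ?a r2 \<Longrightarrow>
      z \<in> snd C ` fst C \<and> chart_inv C z \<in> fst C \<and> snd C (chart_inv C z) = z \<and> \<phi> t (chart_inv C z) \<in> fst C"
    by (rule joint_nbhd) (rule that)
  have split: "\<bar>w dimM - 0\<bar> \<le> r" "w(dimM := 0) \<in> cube dimM ?a r" if "w \<in> cube (Suc dimM) ?a r" for w r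
    using cube_Suc_split[of w dimM ?a 0 r, unfolded a_upd, OF that a] by auto
  let ?F = "\<lambda>j. flow_expr C (\<lambda>y. snd C y j)"
  have ex: "\<exists>S s. s > 0 \<and> real_analytic_at (Suc dimM) S ?a \<and>
      (\<forall>w \<in> cube (Suc dimM) ?a s. ?F j w = w j + w dimM * S w)" if j: "j < dimM" for j
  proof -
    have "real_analytic_at (Suc dimM) (?F j) (?a(dimM := 0))"
      by (rule flow_expr_analytic[OF C e_0]) (simp add: phi_zero[OF x] analytic_at_coord[OF C j])
    \<comment> \<open>The displacement of the flow is divided by time; it vanishes at time 0 because
      \<open>\<phi> 0\<close> is the identity.\<close>
    then have "real_analytic_at (Suc dimM) (\<lambda>w. ?F j w - w j) ?a"
      unfolding a_upd by (rule real_analytic_at_diff[OF _ real_analytic_at_coord]) (use j in simp)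
    then obtain S s where s: "s > 0" and S: "real_analytic_at (Suc dimM) S ?a"
      and hS: "\<And>w. w \<in> cube (Suc dimM) ?a s \<Longrightarrow> ?F j w - w j =
        (?F j (w(dimM := ?a dimM)) - (w(dimM := ?a dimM)) j) + (w dimM - ?a dimM) * S w"
      using lessI by (rule real_analytic_at_divided_difference) (rule that)
    have "?F j w = w j + w dimM * S w" if w: "w \<in> cube (Suc dimM) ?a (min s r2)" for w
    proof -
      have w1: "w \<in> cube (Suc dimM) ?a s" "w \<in> cube (Suc dimM) ?a r2" using w cube_mono by auto
      have hz: "chart_inv C (w(dimM := 0)) \<in> fst C" "snd C (chart_inv C (w(dimM := 0))) = w(dimM := 0)"
        using h[of 0, OF _ split(2)[OF w1(2)]] r2(1) by auto
      have "?F j (w(dimM := 0)) = (w(dimM := 0)) j"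
        using hz phi_zero[OF chart_carrier[OF C(1) hz(1)]] by (simp add: flow_expr_def)
      then show ?thesis using hS[OF w1(1)] by (simp add: a0)
    qed
    then show ?thesis using s r2(1) S by (intro exI[of _ S] exI[of _ "min s r2"]) auto
  qed
  define P where "P j S \<longleftrightarrow> real_analytic_at (Suc dimM) S ?a \<and>
    (\<exists>s>0. \<forall>w \<in> cube (Suc dimM) ?a s. ?F j w = w j + w dimM * S w)" for j S
  have "\<forall>j\<in>{..<dimM}. \<exists>S. P j S" using ex unfolding P_def by blast
  then obtain S where "\<forall>j\<in>{..<dimM}. P j (S j)" using bchoice[of "{..<dimM}" P] by blast
  then have S: "\<And>j. j < dimM \<Longrightarrow> real_analytic_at (Suc dimM) (S j) ?a"
    and S': "\<And>j. j < dimM \<Longrightarrow> \<exists>s>0. \<forall>w \<in> cube (Suc dimM) ?a s. ?F j w = w j + w dimM * S j w"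
    unfolding P_def by auto
  have "\<exists>s>0. \<forall>j\<in>{..<dimM}. \<forall>s'. 0 < s' \<and> s' \<le> s \<longrightarrow> (\<forall>w \<in> cube (Suc dimM) ?a s'. ?F j w = w j + w dimM * S j w)"
  proof (rule finite_uniform_radius)
    fix j assume "j \<in> {..<dimM}"
    then obtain s where s: "s > 0" "\<forall>w \<in> cube (Suc dimM) ?a s. ?F j w = w j + w dimM * S j w" using S' by blast
    show "\<exists>s>0. \<forall>s'. 0 < s' \<and> s' \<le> s \<longrightarrow> (\<forall>w \<in> cube (Suc dimM) ?a s'. ?F j w = w j + w dimM * S j w)"
    proof (intro exI[of _ s] conjI allI impI ballI s(1))
      fix s' w assume "0 < s' \<and> s' \<le> s" "w \<in> cube (Suc dimM) ?a s'"
      then have "w \<in> cube (Suc dimM) ?a s" using cube_mono by blast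
      with s(2) show "?F j w = w j + w dimM * S j w" by blast
    qed
  qed simp
  then obtain r1 where r1: "r1 > 0" and F1: "\<And>j w. j < dimM \<Longrightarrow> w \<in> cube (Suc dimM) ?a r1 \<Longrightarrow> ?F j w = w j + w dimM * S j w"
    by auto
  \<comment> \<open>\<open>r1\<close> keeps the solution where the displacement formula holds,
    \<open>r2\<close> where the flow stays inside the chart.\<close>
  have eps: "min r1 r2 > 0" using r1 r2 by simp
  obtain \<Psi> r where r: "r > 0" and \<Psi>: "\<And>j. j \<le> dimM \<Longrightarrow> real_analytic_at (Suc dimM) (\<lambda>w. \<Psi> w j) ?a"
    and \<Psi>c: "\<And>w. w \<in> cube (Suc dimM) ?a r \<Longrightarrow> \<Psi> w \<in> cube (Suc dimM) ?a (min r1 r2)"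
    and \<Psi>t: "\<And>w. w \<in> cube (Suc dimM) ?a r \<Longrightarrow> \<Psi> w dimM = w dimM"
    and \<Psi>e: "\<And>w j. w \<in> cube (Suc dimM) ?a r \<Longrightarrow> j < dimM \<Longrightarrow> \<Psi> w j = w j - w dimM * S j (\<Psi> w)"
    using S a eps by (rule real_analytic_at_fixpoint) (assumption, rule that)
  have a': "?a \<in> cube (Suc dimM) ?a r" using r a by (intro center_in_cube) (simp_all add: euc_iff)
  have \<Psi>a: "\<Psi> ?a = ?a"
  proof
    fix j
    consider "j < dimM" | "j = dimM" | "j > dimM" by linarith
    then show "\<Psi> ?a j = ?a j"
    proof cases
      case 1
      then show ?thesis using \<Psi>e[OF a' 1] by (simp add: a0)
    next
      case 2
      then show ?thesis using \<Psi>t[OF a'] by simp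
    next
      case 3
      then show ?thesis using \<Psi>c[OF a'] a by (simp add: cube_iff euc_iff)
    qed
  qed
  have main: "inverse_point C w (\<Psi> w)"
    if w0: "w \<in> cube (Suc dimM) ?a (min r r2)" for w
  proof -
    have w: "w \<in> cube (Suc dimM) ?a r" "w \<in> cube (Suc dimM) ?a r2" using w0 cube_mono by auto
    let ?u = "\<Psi> w" and ?t = "w dimM"
    have ut: "?u dimM = ?t" by (rule \<Psi>t[OF w(1)])
    have t: "\<bar>?t\<bar> < e" using r2(2) split(1)[OF w(2)] by blast
    have u: "?u \<in> cube (Suc dimM) ?a r1" "?u \<in> cube (Suc dimM) ?a r2" using \<Psi>c[OF w(1)] cube_mono by auto
    define x' where "x' = chart_inv C (?u(dimM := 0))"
    have hu: "x' \<in> fst C" "snd C x' = ?u(dimM := 0)" "\<phi> ?t x' \<in> fst C"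
      using h[OF split[OF u(2)]] by (auto simp: x'_def ut)
    have hw: "chart_inv C (w(dimM := 0)) \<in> fst C" "snd C (chart_inv C (w(dimM := 0))) = w(dimM := 0)"
      using h[OF split[OF w(2)]] by auto
    have "snd C (\<phi> ?t x') = w(dimM := 0)"
    proof
      fix j
      show "snd C (\<phi> ?t x') j = (w(dimM := 0)) j"
      proof (cases "j < dimM")
        case True
        have "snd C (\<phi> ?t x') j = ?F j ?u" by (simp add: flow_expr_def x'_def ut)
        also have "\<dots> = ?u j + ?t * S j ?u" using F1[OF True u(1)] by (simp add: ut)
        also have "\<dots> = w j" using \<Psi>e[OF w(1) True] by simp
        finally show ?thesis using True by simp
      next
        case False
        have "w \<in> euc (Suc dimM)" using w(1) by (simp add: cube_iff)
        then show ?thesis using chart_euc[OF C(1) hu(3)] False by (auto simp: euc_iff)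
      qed
    qed
    then have eq: "\<phi> ?t x' = chart_inv C (w(dimM := 0))" using chart_inv_chart[OF C(1) hu(3)] by simp
    \<comment> \<open>Injectivity of \<open>\<phi> t\<close> on the carrier, rather than uniqueness
      of the fixed point, identifies the constructed preimage with the value of
      \<open>\<psi>\<close>.\<close>
    moreover have "\<psi> ?t (\<phi> ?t x') = x'" by (rule inverse_flow[OF t chart_carrier[OF C(1) hu(1)]])
    ultimately show ?thesis using t ut hu hw unfolding x'_def inverse_point_def by simp
  qed
  show thesis
  proof (rule that[OF _ \<Psi> \<Psi>a _ main])
    fix w assume "w \<in> cube (Suc dimM) ?a (min r r2)"
    then have "w \<in> cube (Suc dimM) ?a r" using cube_mono by auto
    from \<Psi>c[OF this] show "\<Psi> w \<in> euc (Suc dimM)" by (simp add: cube_iff)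
  qed (use r r2 in auto)
qed

text \<open>The velocity at \<open>y\<close> is the time derivative of the flow taken at the
  preimage of \<open>y\<close>. In coordinates it is therefore the composition of a partial
  derivative of \<open>flow_expr\<close> with the solution \<open>\<Psi>\<close>.\<close>

lemma velocity_expr_analytic:
  assumes C: "C \<in> atlas M" "x \<in> fst C" and i: "i < dimM"
  shows "real_analytic_at (Suc dimM) (velocity_expr C i) (snd C x)"
proof -
  let ?a = "snd C x" and ?g = "\<lambda>y. snd C y i"
  have x: "x \<in> carrier" by (rule chart_carrier[OF C])
  have a: "?a \<in> euc dimM" by (rule chart_euc[OF C])
  have a': "?a \<in> euc (Suc dimM)" using a by (simp add: euc_iff)
  obtain \<Psi> r where r: "r > 0" and \<Psi>: "\<And>j. j \<le> dimM \<Longrightarrow> real_analytic_at (Suc dimM) (\<lambda>w. \<Psi> w j) ?a"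
    and \<Psi>a: "\<Psi> ?a = ?a" and \<Psi>c: "\<And>w. w \<in> cube (Suc dimM) ?a r \<Longrightarrow> \<Psi> w \<in> euc (Suc dimM)"
    and main: "\<And>w. w \<in> cube (Suc dimM) ?a r \<Longrightarrow> inverse_point C w (\<Psi> w)"
    using C by (rule inverse_flow_solution) (rule that)
  have "real_analytic_at (Suc dimM) (flow_expr C ?g) (?a(dimM := 0))"
    by (rule flow_expr_analytic[OF C e_0]) (simp add: phi_zero[OF x] analytic_at_coord[OF C i])
  then have "real_analytic_at (Suc dimM) (flow_expr C ?g) ?a" by (simp only: euc_upd_last[OF a])
  then have G: "real_analytic_at (Suc dimM) (partial_deriv dimM (flow_expr C ?g)) (\<Psi> ?a)"
    unfolding \<Psi>a by (rule real_analytic_at_partial[OF _ a' lessI])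
  have "real_analytic_at (Suc dimM) (\<lambda>w. partial_deriv dimM (flow_expr C ?g) (\<Psi> w)) ?a"
    by (rule real_analytic_at_compose[where f = \<Psi>, OF G _ a' r \<Psi>c]) (auto intro: \<Psi>)
  then show ?thesis
  proof (rule real_analytic_at_cong[OF _ r])
    fix w assume w: "w \<in> cube (Suc dimM) ?a r"
    note m = main[OF w, unfolded inverse_point_def]
    let ?x' = "chart_inv C ((\<Psi> w)(dimM := 0))" and ?t = "w dimM"
    have t: "\<bar>?t\<bar> < e" and x': "?x' \<in> fst C" using m by auto
    have g: "analytic_at ?g (\<phi> ?t ?x')" using m by (intro analytic_at_coord[OF C(1) _ i]) simp
    have "(snd C ?x')(dimM := ?t) = \<Psi> w" using m by auto
    with velocity_eq_partial[OF C(1) x' t g]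
    have "partial_deriv dimM (flow_expr C ?g) (\<Psi> w) = \<xi> ?t (\<phi> ?t ?x') ?g" by simp
    also have "\<dots> = velocity_expr C i w" using m by (simp add: velocity_expr_def field_component_def)
    finally show "partial_deriv dimM (flow_expr C ?g) (\<Psi> w) = velocity_expr C i w" .
  qed
qed

lemma inverse_expr_analytic:
  assumes C: "C \<in> atlas M" "x \<in> fst C" and i: "i < dimM"
  shows "real_analytic_at (Suc dimM) (inverse_expr C (\<lambda>y. snd C y i)) (snd C x)"
proof -
  let ?a = "snd C x"
  obtain \<Psi> r where r: "r > 0" and \<Psi>: "\<And>j. j \<le> dimM \<Longrightarrow> real_analytic_at (Suc dimM) (\<lambda>w. \<Psi> w j) ?a"
    and "\<Psi> ?a = ?a" and "\<And>w. w \<in> cube (Suc dimM) ?a r \<Longrightarrow> \<Psi> w \<in> euc (Suc dimM)"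
    and main: "\<And>w. w \<in> cube (Suc dimM) ?a r \<Longrightarrow> inverse_point C w (\<Psi> w)"
    using C by (rule inverse_flow_solution) (rule that)
  show ?thesis
  proof (rule real_analytic_at_cong[OF \<Psi>[of i] r])
    fix w assume "w \<in> cube (Suc dimM) ?a r"
    from main[OF this, unfolded inverse_point_def] show "\<Psi> w i = inverse_expr C (\<lambda>y. snd C y i) w" using i by (simp add: inverse_expr_def)
  qed (use i in simp)
qed

lemma insert_last_upd:
  assumes "a \<in> euc n" "k < n"
  shows "(a(n := t, k := s))(n := 0) = a(k := s)"
  using assms by (auto simp: fun_eq_iff euc_iff)

lemma inverse_expr_partial:
  assumes C: "C \<in> atlas M" "x \<in> fst C" and k: "k < dimM"
  shows "partial_deriv k (inverse_expr C g) ((snd C x)(dimM := t)) = chart_partial C k (\<lambda>y. g (\<psi> t y)) x"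
  using insert_last_upd[OF chart_euc[OF C] k] k
  by (simp add: partial_deriv_def chart_partial_def inverse_expr_def del: fun_upd_apply) simp

lemma velocity_expr_partial:
  assumes C: "C \<in> atlas M" "x \<in> fst C" and k: "k < dimM"
  shows "partial_deriv k (velocity_expr C i) ((snd C x)(dimM := t)) = chart_partial C k (field_component C (\<xi> t) i) x"
  using insert_last_upd[OF chart_euc[OF C] k] k
  by (simp add: partial_deriv_def chart_partial_def velocity_expr_def del: fun_upd_apply) simp

lemma velocity_expr_at:
  assumes "C \<in> atlas M" "x \<in> fst C"
  shows "velocity_expr C i ((snd C x)(dimM := t)) = field_component C (\<xi> t) i x"
  using assms chart_euc[OF assms] by (simp add: velocity_expr_def euc_upd_last)

section \<open>Analyticity in time of transported vectors and covectors\<close>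

lemma near_zero:
  assumes C: "C \<in> atlas M" "x \<in> fst C"
  shows "\<forall>\<^sub>F t in nhds 0. \<bar>t\<bar> < e \<and> \<phi> t x \<in> fst C"
  by (rule flow_near[OF chart_carrier[OF C] e_0 atlas_facts(1)[OF C(1)]])
     (use C phi_zero[OF chart_carrier[OF C]] in simp)

text \<open>The point moves with time \<open>z i\<close>, while \<open>z j\<close> fills the time
  slot of \<open>H\<close>. Equal indices serve transported covectors; different ones serve the
  two-variable function \<open>G\<close>. The truncation keeps the argument in Euclidean space even
  when the moving point has left the chart.\<close>

lemma analytic_along_flow_expr:
  assumes C: "C \<in> atlas M" "x \<in> fst C" and H: "real_analytic_at (Suc dimM) H (snd C x)" and i: "i < m" "j < m"
  shows "real_analytic_at m (\<lambda>z. H ((\<lambda>l. if l < dimM then snd C (\<phi> (z i) x) l else 0)(dimM := z j))) (\<lambda>_. 0)"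
proof (rule real_analytic_at_compose[where g = H and k = "Suc dimM"
    and f = "\<lambda>z. (\<lambda>l. if l < dimM then snd C (\<phi> (z i) x) l else 0)(dimM := z j)", OF _ _ zero_euc zero_less_one])
  have "(\<lambda>l. if l < dimM then snd C (\<phi> 0 x) l else 0)(dimM := 0) = snd C x"
    using chart_euc[OF C] by (auto simp: fun_eq_iff euc_iff phi_zero[OF chart_carrier[OF C]])
  then show "real_analytic_at (Suc dimM) H ((\<lambda>l. if l < dimM then snd C (\<phi> 0 x) l else 0)(dimM := 0))"
    using H by simp
  fix l assume l: "l < Suc dimM"
  show "real_analytic_at m (\<lambda>z. ((\<lambda>l. if l < dimM then snd C (\<phi> (z i) x) l else 0)(dimM := z j)) l) (\<lambda>_. 0)"
  proof (cases "l = dimM")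
    case True
    then show ?thesis using i by (simp add: real_analytic_at_coord)
  next
    case False
    then have l': "l < dimM" using l by simp
    from analytic_at_0_embed[OF analytic_along_flow[OF C analytic_at_coord[OF C l']] i(1)] l'
    show ?thesis by simp
  qed
qed (simp add: euc_iff)

lemma truncated_chart:
  assumes "C \<in> atlas M" "y \<in> fst C"
  shows "(\<lambda>l. if l < dimM then snd C y l else 0) = snd C y"
  using chart_euc[OF assms] by (auto simp: fun_eq_iff euc_iff)

lemma push_vec_component_analytic:
  assumes C: "C \<in> atlas M" "x \<in> fst C" and v: "v \<in> T x" and i: "i < dimM"
  shows "analytic_at_0 (\<lambda>t. push_vec M (\<phi> t) x v (\<lambda>y. snd C y i))"
proof -
  let ?g = "\<lambda>y. snd C y i"
  have x: "x \<in> carrier" by (rule chart_carrier[OF C])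
  have a: "snd C x \<in> euc dimM" by (rule chart_euc[OF C])
  have a': "snd C x \<in> euc (Suc dimM)" using a by (simp add: euc_iff)
  have "real_analytic_at (Suc dimM) (flow_expr C ?g) ((snd C x)(dimM := 0))"
    by (rule flow_expr_analytic[OF C e_0]) (simp add: phi_zero[OF x] analytic_at_coord[OF C i])
  then have F: "real_analytic_at (Suc dimM) (flow_expr C ?g) (snd C x)" by (simp only: euc_upd_last[OF a])
  have "analytic_at_0 (\<lambda>t. chart_partial C k (\<lambda>y. ?g (\<phi> t y)) x)" if k: "k < dimM" for k
    using analytic_at_0_line[OF real_analytic_at_partial[OF F a' less_SucI[OF k]] a]
    by (simp only: flow_expr_partial[OF C k])
  then have "analytic_at_0 (\<lambda>t. \<Sum>k<dimM. v (\<lambda>y. snd C y k) * chart_partial C k (\<lambda>y. ?g (\<phi> t y)) x)"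
    by (intro real_analytic_at_sum real_analytic_at_mult real_analytic_at_const) auto
  then show ?thesis
  proof (rule analytic_at_0_cong)
    show "\<forall>\<^sub>F t in nhds 0. (\<Sum>k<dimM. v (\<lambda>y. snd C y k) * chart_partial C k (\<lambda>y. ?g (\<phi> t y)) x) = push_vec M (\<phi> t) x v ?g"
      using near_zero[OF C]
    proof eventually_elim
      case (elim t)
      then have t: "\<bar>t\<bar> < e" and g: "analytic_at ?g (\<phi> t x)" by (auto intro: analytic_at_coord[OF C(1) _ i])
      from tangent_expand[OF v C analytic_at_compose_map[OF flow_maps(2)[OF t] x g]] g
      show ?case by (simp add: push_vec_def)
    qed
  qed
qed

text \<open>The components of the transported covector are those of \<open>\<omega>\<close>
  multiplied by the Jacobian of the inverse map at time \<open>t\<close>, taken at the moving point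
  \<open>\<phi> t x\<close>. Time enters twice, so joint analyticity of the inverse flow is
  required.\<close>

lemma push_covec_component_analytic:
  assumes C: "C \<in> atlas M" "x \<in> fst C" and w: "\<omega> \<in> T' x" and j: "j < dimM"
  shows "analytic_at_0 (\<lambda>t. push_covec M (\<phi> t) x \<omega> (frame C j (\<phi> t x)))"
proof -
  have x: "x \<in> carrier" by (rule chart_carrier[OF C])
  have a': "snd C x \<in> euc (Suc dimM)" using chart_euc[OF C] by (simp add: euc_iff)
  let ?H = "\<lambda>k. partial_deriv j (inverse_expr C (\<lambda>y. snd C y k))"
  have H: "real_analytic_at (Suc dimM) (?H k) (snd C x)" if "k < dimM" for k
    by (rule real_analytic_at_partial[OF inverse_expr_analytic[OF C that] a']) (use j in simp)
  have an: "analytic_at_0 (\<lambda>t. ?H k ((\<lambda>l. if l < dimM then snd C (\<phi> t x) l else 0)(dimM := t)))" if "k < dimM" for k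
    by (rule analytic_along_flow_expr[OF C H[OF that]]) auto
  have "analytic_at_0 (\<lambda>t. \<Sum>k<dimM. ?H k ((\<lambda>l. if l < dimM then snd C (\<phi> t x) l else 0)(dimM := t)) * \<omega> (frame C k x))"
    by (rule analytic_at_0_linear) (rule an, simp)
  then show ?thesis
  proof (rule analytic_at_0_cong)
    show "\<forall>\<^sub>F t in nhds 0. (\<Sum>k<dimM. ?H k ((\<lambda>l. if l < dimM then snd C (\<phi> t x) l else 0)(dimM := t)) * \<omega> (frame C k x)) =
        push_covec M (\<phi> t) x \<omega> (frame C j (\<phi> t x))"
      using near_zero[OF C]
    proof eventually_elim
      case (elim t)
      then have t: "\<bar>t\<bar> < e" and Ct: "\<phi> t x \<in> fst C" by auto
      have fx: "\<phi> t x \<in> carrier" by (rule flow_carrier[OF t x])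
      have fr: "frame C j (\<phi> t x) \<in> T (\<phi> t x)" by (rule coord_vec_tangent[OF C(1) Ct j])
      let ?u = "push_vec M (\<psi> t) (\<phi> t x) (frame C j (\<phi> t x))"
      have u: "?u \<in> T x" by (rule push_push_inverse(1)[OF t x fr])
      have uk: "?u (\<lambda>y. snd C y k) = ?H k ((snd C (\<phi> t x))(dimM := t))" if k: "k < dimM" for k
      proof -
        have g: "analytic_at (\<lambda>y. snd C y k) (\<psi> t (\<phi> t x))" using analytic_at_coord[OF C k] by (simp only: inverse_flow[OF t x])
        from analytic_at_compose_map[OF flow_maps(3)[OF t] fx this]
        have "?u (\<lambda>y. snd C y k) = chart_partial C j (\<lambda>y. snd C (\<psi> t y) k) (\<phi> t x)"
          using g by (simp add: push_vec_def coord_vec_eq)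
        then show ?thesis using inverse_expr_partial[OF C(1) Ct j, of "\<lambda>y. snd C y k" t] by simp
      qed
      have "push_covec M (\<phi> t) x \<omega> (frame C j (\<phi> t x)) = \<omega> ?u" by (rule push_covec_eq[OF t x fr])
      also have "\<dots> = (\<Sum>k<dimM. ?u (\<lambda>y. snd C y k) * \<omega> (frame C k x))" by (rule cotangent_expand[OF w C u])
      finally show ?case by (simp add: uk truncated_chart[OF C(1) Ct])
    qed
  qed
qed

text \<open>The preimage is the ordinary pullback of the covector, set to 0 outside the tangent
  space as \<open>cotangent_space\<close> demands.\<close>

lemma push_covec_surjective:
  assumes t: "\<bar>t\<bar> < e" and x: "x \<in> carrier" and w: "\<theta> \<in> T' (\<phi> t x)"
  obtains \<omega> where "\<omega> \<in> T' x" "push_covec M (\<phi> t) x \<omega> = \<theta>"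
proof -
  define \<omega> where "\<omega> v = (if v \<in> T x then \<theta> (push_vec M (\<phi> t) x v) else 0)" for v
  have 1: "\<omega> \<in> T' x"
  proof (rule cotangentI)
    fix u v a b assume uv: "u \<in> T x" "v \<in> T x"
    show "\<omega> (\<lambda>f. a * u f + b * v f) = a * \<omega> u + b * \<omega> v"
      using cotangentD[OF w push_vec_flow_tangent[OF t x uv(1)] push_vec_flow_tangent[OF t x uv(2)]] uv
      by (simp add: \<omega>_def tangent_lincomb push_vec_lincomb)
  qed (simp add: \<omega>_def)
  have 2: "push_covec M (\<phi> t) x \<omega> = \<theta>"
  proof
    fix v
    show "push_covec M (\<phi> t) x \<omega> v = \<theta> v"
    proof (cases "v \<in> T (\<phi> t x)")
      case True
      then show ?thesis using push_push_inverse[OF t x True] by (simp add: push_covec_eq[OF t x True] \<omega>_def)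
    next
      case False
      then show ?thesis by (simp add: push_covec_def cotangent_outside[OF w])
    qed
  qed
  from 1 2 show thesis by (rule that)
qed

text \<open>Both charts compute the same derivative of the same pullback.\<close>

lemma lie_form_velocity_chart_independent:
  assumes C: "C \<in> atlas M" "y \<in> fst C" and D: "D \<in> atlas M" "y \<in> fst D" and t: "\<bar>t\<bar> < e"
    and \<beta>: "analytic_tensor_field M p q \<beta>" and a: "(vs, ws) \<in> tensor_args M p q y"
  shows "lie_form C (\<xi> t) \<beta> y vs ws = lie_form D (\<xi> t) \<beta> y vs ws"
proof -
  define x where "x = \<psi> t y"
  have y: "y \<in> carrier" by (rule chart_carrier[OF C])
  have x: "x \<in> carrier" unfolding x_def by (rule inverse_carrier[OF t y])
  have xy: "\<phi> t x = y" unfolding x_def by (rule flow_inverse[OF t y])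
  have vs: "set vs \<subseteq> T (\<phi> t x)" "length vs = p" and ws: "set ws \<subseteq> T' (\<phi> t x)" "length ws = q"
    using a by (auto simp: tensor_args_def xy)
  \<comment> \<open>Every argument at \<open>y\<close> is transported from one at \<open>x\<close>,
    so the pullbacks at \<open>x\<close> test the two forms on all arguments.\<close>
  define vs' where "vs' = map (push_vec M (\<psi> t) (\<phi> t x)) vs"
  have v1: "map (push_vec M (\<phi> t) x) vs' = vs"
    unfolding vs'_def map_map by (rule map_idI) (use push_push_inverse(2)[OF t x] vs in auto)
  have v2: "set vs' \<subseteq> T x" using push_push_inverse(1)[OF t x] vs by (auto simp: vs'_def)
  define \<sigma> where "\<sigma> w = (SOME \<omega>. \<omega> \<in> T' x \<and> push_covec M (\<phi> t) x \<omega> = w)" for w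
  have \<sigma>: "\<sigma> w \<in> T' x \<and> push_covec M (\<phi> t) x (\<sigma> w) = w" if w: "w \<in> T' (\<phi> t x)" for w
  proof -
    obtain \<omega> where "\<omega> \<in> T' x" "push_covec M (\<phi> t) x \<omega> = w"
      using t x w by (rule push_covec_surjective) (rule that)
    then have "\<exists>\<omega>. \<omega> \<in> T' x \<and> push_covec M (\<phi> t) x \<omega> = w" by blast
    then show ?thesis unfolding \<sigma>_def by (rule someI_ex)
  qed
  define ws' where "ws' = map \<sigma> ws"
  have w1: "map (push_covec M (\<phi> t) x) ws' = ws"
    unfolding ws'_def map_map by (rule map_idI) (use \<sigma> ws in auto)
  have w2: "set ws' \<subseteq> T' x" using \<sigma> ws by (auto simp: ws'_def)
  have args: "(vs', ws') \<in> tensor_args M p q x"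
    by (rule tensor_argsI) (use v2 w2 vs(2) ws(2) in \<open>auto simp: vs'_def ws'_def\<close>)
  have "((\<lambda>t. pullback M (\<phi> t) \<beta> x vs' ws') has_real_derivative lie_form C (\<xi> t) \<beta> y vs ws) (at t)"
    using pullback_derivative[OF x t C(1) _ \<beta> args] C(2) by (simp only: xy v1 w1)
  moreover have "((\<lambda>t. pullback M (\<phi> t) \<beta> x vs' ws') has_real_derivative lie_form D (\<xi> t) \<beta> y vs ws) (at t)"
    using pullback_derivative[OF x t D(1) _ \<beta> args] D(2) by (simp only: xy v1 w1)
  ultimately show ?thesis by (rule DERIV_unique)
qed

end

section \<open>Taylor coefficients of the velocity as vector fields\<close>

lemma taylor_coeff_diff:
  assumes "analytic_at_0 f" "analytic_at_0 g"
  shows "taylor_coeff k (\<lambda>t. f t - g t) = taylor_coeff k f - taylor_coeff k g"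
proof -
  have "analytic_at_0 (\<lambda>t. (-1) * g t)" by (intro real_analytic_at_mult real_analytic_at_const assms(2))
  from taylor_coeff_add[OF assms(1) this, of k] taylor_coeff_cmult[OF assms(2), of k "-1"] show ?thesis by simp
qed

lemma taylor_coeff_Suc: "real (Suc k) * taylor_coeff (Suc k) F = taylor_coeff k (deriv F)"
proof -
  have "(deriv ^^ Suc k) F = (deriv ^^ k) (deriv F)" by (simp only: funpow_Suc_right comp_apply)
  then show ?thesis by (simp add: taylor_coeff_def)
qed

lemma prod_list_update_slot:
  assumes "i < length us"
  shows "(\<Prod>r<length us. h r (us[i := u] ! r)) = h i u * (\<Prod>r\<in>{..<length us} - {i}. h r (us ! r) :: real)"
proof -
  have "(\<Prod>r<length us. h r (us[i := u] ! r)) = h i (us[i := u] ! i) * (\<Prod>r\<in>{..<length us} - {i}. h r (us[i := u] ! r))"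
    using assms by (subst prod.remove[of _ i]) auto
  also have "(\<Prod>r\<in>{..<length us} - {i}. h r (us[i := u] ! r)) = (\<Prod>r\<in>{..<length us} - {i}. h r (us ! r))"
    by (rule prod.cong) auto
  finally show ?thesis using assms by simp
qed

text \<open>Each slot occurs in exactly one factor and enters it by evaluation at a fixed argument,
  which is linear in the slot.\<close>

lemma multilinear_at_contraction:
  assumes F: "\<And>vs ws. length vs = p \<Longrightarrow> length ws = q \<Longrightarrow> F vs ws =
    (\<Sum>I\<in>A. \<Sum>J\<in>B. K I J * (\<Prod>r<length vs. (vs ! r) (f I r)) * (\<Prod>s<length ws. (ws ! s) (g J s)))"
  shows "multilinear_at M p q x F"
  unfolding multilinear_at_def
proof (intro ballI, clarify, intro conjI allI impI ballI)
  fix vs ws assume "(vs, ws) \<in> tensor_args M p q x"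
  then have len: "length vs = p" "length ws = q" by (auto simp: tensor_args_def)
  {
    fix i u v a b assume i: "i < p"
    have i': "i < length vs" using i len by simp
    have eq: "F (vs[i := X]) ws = (\<Sum>I\<in>A. \<Sum>J\<in>B. K I J * (X (f I i) * (\<Prod>r\<in>{..<length vs} - {i}. (vs ! r) (f I r))) *
        (\<Prod>s<length ws. (ws ! s) (g J s)))" for X
      using F[of "vs[i := X]" ws] len prod_list_update_slot[OF i', where u = X and h = "\<lambda>r v. v (f _ r)"] by simp
    show "F (vs[i := \<lambda>f. a * u f + b * v f]) ws = a * F (vs[i := u]) ws + b * F (vs[i := v]) ws"
      unfolding eq sum_distrib_left sum.distrib[symmetric]
      by (intro sum.cong refl) (simp add: algebra_simps)
  }
  {
    fix j u v a b assume j: "j < q"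
    have j': "j < length ws" using j len by simp
    have eq: "F vs (ws[j := X]) = (\<Sum>I\<in>A. \<Sum>J\<in>B. K I J * (\<Prod>r<length vs. (vs ! r) (f I r)) *
        (X (g J j) * (\<Prod>s\<in>{..<length ws} - {j}. (ws ! s) (g J s))))" for X
      using F[of vs "ws[j := X]"] len prod_list_update_slot[OF j', where u = X and h = "\<lambda>r v. v (g _ r)"] by simp
    show "F vs (ws[j := \<lambda>w. a * u w + b * v w]) = a * F vs (ws[j := u]) + b * F vs (ws[j := v])"
      unfolding eq sum_distrib_left sum.distrib[symmetric]
      by (intro sum.cong refl) (simp add: algebra_simps)
  }
qed

lemma prod_if_eq_list:
  assumes "length I = n" "length I' = n"
  shows "(\<Prod>r<n. if I ! r = I' ! r then 1 else 0 :: real) = (if I = I' then 1 else 0)"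
proof (cases "I = I'")
  case False
  then obtain r where "r < n" "I ! r \<noteq> I' ! r" using assms nth_equalityI by metis
  then show ?thesis using False by (auto intro!: prod_zero)
qed simp

context analytic_manifold
begin

lemma chart_partial_cmult:
  assumes "C \<in> atlas M" "x \<in> fst C" "analytic_at f x" "i < dimM"
  shows "chart_partial C i (\<lambda>y. b * f y) x = b * chart_partial C i f x"
  by (rule chart_partialI) (rule DERIV_cmult[OF chart_has_partial[OF assms]])

lemma lie_component_scale:
  assumes C: "C \<in> atlas M" "x \<in> fst C" and \<eta>: "\<And>k. k < dimM \<Longrightarrow> analytic_at (field_component C \<eta> k) x"
    and I: "I \<in> multi_indices dimM p" and J: "J \<in> multi_indices dimM q"
  shows "lie_component M C (scale_field b \<eta>) \<beta> I J x = b * lie_component M C \<eta> \<beta> I J x"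
proof -
  have f: "field_component C (scale_field b \<eta>) k = (\<lambda>y. b * field_component C \<eta> k y)" for k
    by (simp add: fun_eq_iff field_component_def scale_field_def)
  have p: "chart_partial C l (field_component C (scale_field b \<eta>) k) x = b * chart_partial C l (field_component C \<eta> k) x"
    if "l < dimM" "k < dimM" for l k
    unfolding f by (rule chart_partial_cmult[OF C \<eta>[OF that(2)] that(1)])
  have I': "I ! r < dimM" if "r < length I" for r using I that by (auto simp: multi_indices_def subset_iff)
  have J': "J ! s < dimM" if "s < length J" for s using J that by (auto simp: multi_indices_def subset_iff)
  have 1: "(\<Sum>k<dimM. field_component C (scale_field b \<eta>) k x * A k) = b * (\<Sum>k<dimM. field_component C \<eta> k x * A k)" for A
    by (simp add: f sum_distrib_left mult.assoc)
  have 2: "(\<Sum>r<length I. \<Sum>k<dimM. chart_partial C (I ! r) (field_component C (scale_field b \<eta>) k) x * A r k) =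
      b * (\<Sum>r<length I. \<Sum>k<dimM. chart_partial C (I ! r) (field_component C \<eta> k) x * A r k)" for A
    unfolding sum_distrib_left by (intro sum.cong refl) (simp add: p I' mult.assoc)
  have 3: "(\<Sum>s<length J. \<Sum>k<dimM. chart_partial C k (field_component C (scale_field b \<eta>) (J ! s)) x * A s k) =
      b * (\<Sum>s<length J. \<Sum>k<dimM. chart_partial C k (field_component C \<eta> (J ! s)) x * A s k)" for A
    unfolding sum_distrib_left by (intro sum.cong refl) (simp add: p J' mult.assoc)
  show ?thesis unfolding lie_component_def 1 2 3 by (simp add: algebra_simps)
qed

end

context analytic_flow
begin

section \<open>The coefficient fields of the velocity\<close>

abbreviation "\<xi>c i \<equiv> velocity_coeff M \<phi> i"

lemma field_component_velocity_coeff: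
  "field_component C (\<xi>c i) k y = taylor_coeff i (\<lambda>t. field_component C (\<xi> t) k y)"
  by (simp add: field_component_def velocity_coeff_def taylor_coeff_def)

lemma velocity_component_in_time:
  assumes C: "C \<in> atlas M" "y \<in> fst C" and k: "k < dimM"
  shows "analytic_at_0 (\<lambda>t. field_component C (\<xi> t) k y)"
  using analytic_at_0_line[OF velocity_expr_analytic[OF C k] chart_euc[OF C]] by (simp only: velocity_expr_at[OF C])

lemma velocity_partial_in_time:
  assumes C: "C \<in> atlas M" "y \<in> fst C" and k: "k < dimM" and l: "l < dimM"
  shows "analytic_at_0 (\<lambda>t. chart_partial C l (field_component C (\<xi> t) k) y)"
proof -
  have "snd C y \<in> euc (Suc dimM)" using chart_euc[OF C] by (simp add: euc_iff)
  from analytic_at_0_line[OF real_analytic_at_partial[OF velocity_expr_analytic[OF C k] this less_SucI[OF l]] chart_euc[OF C]]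
  show ?thesis by (simp only: velocity_expr_partial[OF C l])
qed

text \<open>Reading the Taylor coefficient as an iterated derivative in the time slot of a jointly
  analytic function gives access to its dependence on the point.\<close>

lemma velocity_coeff_expr:
  assumes C: "C \<in> atlas M" "y \<in> fst C"
  shows "field_component C (\<xi>c i) k y = (partial_deriv dimM ^^ i) (velocity_expr C k) (snd C y) / fact i"
proof -
  have "snd C y dimM = 0" using chart_euc[OF C] by (simp add: euc_iff)
  then show ?thesis
    unfolding field_component_velocity_coeff taylor_coeff_def partial_deriv_funpow velocity_expr_at[OF C] by simp
qed

lemma velocity_coeff_analytic:
  assumes C: "C \<in> atlas M" "y \<in> fst C" and k: "k < dimM"
  shows "analytic_at (field_component C (\<xi>c i) k) y"
proof (rule analytic_at_chart[OF C])
  let ?a = "snd C y" and ?h = "\<lambda>w. (partial_deriv dimM ^^ i) (velocity_expr C k) w * (1 / fact i)"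
  have a: "?a \<in> euc dimM" and a': "?a \<in> euc (Suc dimM)" using chart_euc[OF C] by (auto simp: euc_iff)
  obtain s where s: "s > 0" and hs: "\<And>z. z \<in> cube dimM ?a s \<Longrightarrow>
    z \<in> snd C ` fst C \<and> chart_inv C z \<in> fst C \<and> chart_inv C z \<in> fst C \<and> snd C (chart_inv C z) = z"
    using C atlas_facts(1)[OF C(1)] C(2) by (rule chart_nbhd) (rule that)
  have "real_analytic_at (Suc dimM) ?h ?a"
    by (intro real_analytic_at_mult real_analytic_at_const real_analytic_at_funpow velocity_expr_analytic C k a' lessI)
  then have "real_analytic_at (Suc dimM) ?h (?a(dimM := 0))" by (simp only: euc_upd_last[OF a])
  from real_analytic_at_insert_last[OF this a]
  show "real_analytic_at dimM (\<lambda>z. field_component C (\<xi>c i) k (chart_inv C z)) ?a"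
  proof (rule real_analytic_at_cong[OF _ s])
    fix z assume z: "z \<in> cube dimM ?a s"
    then have zz: "z(dimM := 0) = z" by (intro euc_upd_last) (simp add: cube_iff)
    have "chart_inv C z \<in> fst C" "snd C (chart_inv C z) = z" using hs[OF z] by auto
    then show "?h (z(dimM := 0)) = field_component C (\<xi>c i) k (chart_inv C z)"
      unfolding zz using velocity_coeff_expr[OF C(1), of "chart_inv C z" i k] by simp
  qed
qed

text \<open>Partial derivatives of the jointly analytic velocity commute, so Taylor coefficients in
  time may be exchanged with space derivatives.\<close>

lemma velocity_coeff_partial:
  assumes C: "C \<in> atlas M" "y \<in> fst C" and k: "k < dimM" and l: "l < dimM"
  shows "chart_partial C l (field_component C (\<xi>c i) k) y = taylor_coeff i (\<lambda>t. chart_partial C l (field_component C (\<xi> t) k) y)"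
proof -
  let ?a = "snd C y" and ?H = "velocity_expr C k"
  have a: "?a \<in> euc dimM" and a': "?a \<in> euc (Suc dimM)" using chart_euc[OF C] by (auto simp: euc_iff)
  have a0: "?a dimM = 0" using a by (simp add: euc_iff)
  have l': "l < Suc dimM" using l by simp
  have H: "real_analytic_at (Suc dimM) ?H ?a" by (rule velocity_expr_analytic[OF C k])
  obtain s where s: "s > 0" and hs: "\<And>z. z \<in> cube dimM ?a s \<Longrightarrow>
    z \<in> snd C ` fst C \<and> chart_inv C z \<in> fst C \<and> chart_inv C z \<in> fst C \<and> snd C (chart_inv C z) = z"
    using C atlas_facts(1)[OF C(1)] C(2) by (rule chart_nbhd) (rule that)
  have "chart_partial C l (field_component C (\<xi>c i) k) y =
      partial_deriv l (\<lambda>w. (partial_deriv dimM ^^ i) ?H w / fact i) ?a"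
    unfolding chart_partial_def
  proof (rule partial_deriv_cong[OF a l s])
    fix z assume "z \<in> cube dimM ?a s"
    then have "chart_inv C z \<in> fst C" "snd C (chart_inv C z) = z" using hs by auto
    then show "field_component C (\<xi>c i) k (chart_inv C z) = (partial_deriv dimM ^^ i) ?H z / fact i"
      using velocity_coeff_expr[OF C(1), of "chart_inv C z" i k] by simp
  qed
  also have "\<dots> = partial_deriv l ((partial_deriv dimM ^^ i) ?H) ?a / fact i"
    by (rule partial_deriv_cdivide[OF real_analytic_at_funpow[OF H a' lessI] a' l'])
  also have "partial_deriv l ((partial_deriv dimM ^^ i) ?H) ?a = (partial_deriv dimM ^^ i) (partial_deriv l ?H) ?a"
    by (rule partial_deriv_funpow_commute[OF H a' lessI l'])
  also have "\<dots> = (deriv ^^ i) (\<lambda>t. chart_partial C l (field_component C (\<xi> t) k) y) 0"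
    unfolding partial_deriv_funpow velocity_expr_partial[OF C l] a0 ..
  finally show ?thesis by (simp only: taylor_coeff_def)
qed

text \<open>The component is linear in the field and its first derivatives, with factors that do not
  depend on \<open>t\<close>. Taylor coefficients can be taken inside.\<close>

lemma lie_component_taylor:
  assumes C: "C \<in> atlas M" "y \<in> fst C" and I: "I \<in> multi_indices dimM p" and J: "J \<in> multi_indices dimM q"
  shows "analytic_at_0 (\<lambda>t. lie_component M C (\<xi> t) \<beta> I J y)"
    "taylor_coeff i (\<lambda>t. lie_component M C (\<xi> t) \<beta> I J y) = lie_component M C (\<xi>c i) \<beta> I J y"
proof -
  have I': "I ! r < dimM" if "r < length I" for r using I that by (auto simp: multi_indices_def subset_iff)
  have J': "J ! s < dimM" if "s < length J" for s using J that by (auto simp: multi_indices_def subset_iff)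
  define f1 where "f1 t = (\<Sum>k<dimM. field_component C (\<xi> t) k y * chart_partial C k (tensor_component M C \<beta> I J) y)" for t
  define f2 where "f2 r t = (\<Sum>k<dimM. chart_partial C (I ! r) (field_component C (\<xi> t) k) y * tensor_component M C \<beta> (I[r := k]) J y)" for r t
  define f3 where "f3 s t = (\<Sum>k<dimM. chart_partial C k (field_component C (\<xi> t) (J ! s)) y * tensor_component M C \<beta> I (J[s := k]) y)" for s t
  have eq: "(\<lambda>t. lie_component M C (\<xi> t) \<beta> I J y) = (\<lambda>t. (f1 t + (\<Sum>r<length I. f2 r t)) - (\<Sum>s<length J. f3 s t))"
    by (simp add: fun_eq_iff lie_component_def f1_def f2_def f3_def)
  have a1: "analytic_at_0 f1" unfolding f1_def
    by (rule analytic_at_0_linear) (simp add: velocity_component_in_time[OF C] del: One_nat_def)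
  have a2: "analytic_at_0 (f2 r)" if "r < length I" for r unfolding f2_def
    by (rule analytic_at_0_linear) (simp add: velocity_partial_in_time[OF C] I'[OF that] del: One_nat_def)
  have a3: "analytic_at_0 (f3 s)" if "s < length J" for s unfolding f3_def
    by (rule analytic_at_0_linear) (simp add: velocity_partial_in_time[OF C] J'[OF that] del: One_nat_def)
  have s2: "analytic_at_0 (\<lambda>t. \<Sum>r<length I. f2 r t)" by (rule real_analytic_at_sum) (simp add: a2 del: One_nat_def)
  have s3: "analytic_at_0 (\<lambda>t. \<Sum>s<length J. f3 s t)" by (rule real_analytic_at_sum) (simp add: a3 del: One_nat_def)
  show "analytic_at_0 (\<lambda>t. lie_component M C (\<xi> t) \<beta> I J y)"
    unfolding fun_cong[OF eq] by (intro real_analytic_at_diff real_analytic_at_add a1 s2 s3)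
  have t1: "taylor_coeff i f1 = (\<Sum>k<dimM. field_component C (\<xi>c i) k y * chart_partial C k (tensor_component M C \<beta> I J) y)"
    unfolding f1_def field_component_velocity_coeff
    by (rule taylor_coeff_linear) (simp_all add: velocity_component_in_time[OF C] del: One_nat_def)
  have t2: "taylor_coeff i (f2 r) = (\<Sum>k<dimM. chart_partial C (I ! r) (field_component C (\<xi>c i) k) y * tensor_component M C \<beta> (I[r := k]) J y)"
    if "r < length I" for r
  proof -
    have "taylor_coeff i (f2 r) = (\<Sum>k<dimM. taylor_coeff i (\<lambda>t. chart_partial C (I ! r) (field_component C (\<xi> t) k) y) * tensor_component M C \<beta> (I[r := k]) J y)"
      unfolding f2_def
      by (rule taylor_coeff_linear) (simp_all add: velocity_partial_in_time[OF C] I'[OF that] del: One_nat_def)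
    then show ?thesis by (simp add: velocity_coeff_partial[OF C] I'[OF that])
  qed
  have t3: "taylor_coeff i (f3 s) = (\<Sum>k<dimM. chart_partial C k (field_component C (\<xi>c i) (J ! s)) y * tensor_component M C \<beta> I (J[s := k]) y)"
    if "s < length J" for s
  proof -
    have "taylor_coeff i (f3 s) = (\<Sum>k<dimM. taylor_coeff i (\<lambda>t. chart_partial C k (field_component C (\<xi> t) (J ! s)) y) * tensor_component M C \<beta> I (J[s := k]) y)"
      unfolding f3_def
      by (rule taylor_coeff_linear) (simp_all add: velocity_partial_in_time[OF C] J'[OF that] del: One_nat_def)
    then show ?thesis by (simp add: velocity_coeff_partial[OF C] J'[OF that])
  qed
  have "taylor_coeff i (\<lambda>t. lie_component M C (\<xi> t) \<beta> I J y) =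
      taylor_coeff i f1 + (\<Sum>r<length I. taylor_coeff i (f2 r)) - (\<Sum>s<length J. taylor_coeff i (f3 s))"
  proof -
    have 2: "taylor_coeff i (\<lambda>t. \<Sum>r<length I. f2 r t) = (\<Sum>r<length I. taylor_coeff i (f2 r))"
      by (rule taylor_coeff_sum) (simp_all add: a2 del: One_nat_def)
    have 3: "taylor_coeff i (\<lambda>t. \<Sum>s<length J. f3 s t) = (\<Sum>s<length J. taylor_coeff i (f3 s))"
      by (rule taylor_coeff_sum) (simp_all add: a3 del: One_nat_def)
    show ?thesis
      unfolding eq taylor_coeff_diff[OF real_analytic_at_add[OF a1 s2] s3] taylor_coeff_add[OF a1 s2] 2 3 ..
  qed
  then show "taylor_coeff i (\<lambda>t. lie_component M C (\<xi> t) \<beta> I J y) = lie_component M C (\<xi>c i) \<beta> I J y"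
    by (simp add: lie_component_def t1 t2 t3)
qed

lemma lie_form_taylor:
  assumes C: "C \<in> atlas M" "y \<in> fst C"
  shows "taylor_coeff i (\<lambda>t. lie_form C (\<xi> t) \<beta> y vs ws) = lie_form C (\<xi>c i) \<beta> y vs ws"
proof -
  let ?A = "multi_indices dimM (length vs)" and ?B = "multi_indices dimM (length ws)"
  let ?P = "\<lambda>I J. (\<Prod>r<length vs. (vs ! r) (\<lambda>y. snd C y (I ! r))) * (\<Prod>s<length ws. (ws ! s) (frame C (J ! s) y))"
  have eq: "lie_form C \<eta> \<beta> y vs ws = (\<Sum>I\<in>?A. \<Sum>J\<in>?B. lie_component M C \<eta> \<beta> I J y * ?P I J)" for \<eta>
    by (simp add: lie_form_def mult.assoc)
  have an: "analytic_at_0 (\<lambda>t. \<Sum>J\<in>?B. lie_component M C (\<xi> t) \<beta> I J y * ?P I J)" if "I \<in> ?A" for I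
    by (rule analytic_at_0_linear) (rule lie_component_taylor(1)[OF C that])
  have "taylor_coeff i (\<lambda>t. lie_form C (\<xi> t) \<beta> y vs ws) =
      (\<Sum>I\<in>?A. taylor_coeff i (\<lambda>t. \<Sum>J\<in>?B. lie_component M C (\<xi> t) \<beta> I J y * ?P I J))"
    unfolding eq by (rule taylor_coeff_sum[OF finite_multi_indices an])
  also have "\<dots> = (\<Sum>I\<in>?A. \<Sum>J\<in>?B. lie_component M C (\<xi>c i) \<beta> I J y * ?P I J)"
  proof (rule sum.cong[OF refl])
    fix I assume I: "I \<in> ?A"
    have "taylor_coeff i (\<lambda>t. \<Sum>J\<in>?B. lie_component M C (\<xi> t) \<beta> I J y * ?P I J) =
        (\<Sum>J\<in>?B. taylor_coeff i (\<lambda>t. lie_component M C (\<xi> t) \<beta> I J y) * ?P I J)"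
      by (rule taylor_coeff_linear[OF finite_multi_indices lie_component_taylor(1)[OF C I]])
    also have "\<dots> = (\<Sum>J\<in>?B. lie_component M C (\<xi>c i) \<beta> I J y * ?P I J)"
      by (rule sum.cong[OF refl]) (simp only: lie_component_taylor(2)[OF C I])
    finally show "taylor_coeff i (\<lambda>t. \<Sum>J\<in>?B. lie_component M C (\<xi> t) \<beta> I J y * ?P I J) =
        (\<Sum>J\<in>?B. lie_component M C (\<xi>c i) \<beta> I J y * ?P I J)" .
  qed
  finally show ?thesis by (simp only: eq)
qed

text \<open>A coefficient field need not be the velocity of the given family at any time. Chart
  independence is inherited instead: both sides are Taylor coefficients of functions of
  \<open>t\<close> that agree for \<open>\<bar>t\<bar> < e\<close>.\<close>

lemma lie_form_chart_independent:
  assumes C: "C \<in> atlas M" "y \<in> fst C" and D: "D \<in> atlas M" "y \<in> fst D"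
    and \<beta>: "analytic_tensor_field M p q \<beta>" and a: "(vs, ws) \<in> tensor_args M p q y"
  shows "lie_form C (\<xi>c i) \<beta> y vs ws = lie_form D (\<xi>c i) \<beta> y vs ws"
proof -
  have "\<forall>\<^sub>F t in nhds 0. lie_form C (\<xi> t) \<beta> y vs ws = lie_form D (\<xi> t) \<beta> y vs ws"
    unfolding eventually_nhds_metric
  proof (intro exI[of _ e] conjI allI impI e_pos)
    fix t :: real assume "dist t 0 < e"
    then have "\<bar>t\<bar> < e" by (simp add: dist_real_def)
    then show "lie_form C (\<xi> t) \<beta> y vs ws = lie_form D (\<xi> t) \<beta> y vs ws"
      by (rule lie_form_velocity_chart_independent[OF C D _ \<beta> a])
  qed
  from taylor_coeff_cong[OF this, of i] show ?thesis by (simp only: lie_form_taylor[OF C] lie_form_taylor[OF D])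
qed

text \<open>The chart chosen by \<open>SOME\<close> may change from point to point; here it is
  exchanged for any chart around \<open>y\<close>, and the scalar is taken out of the field.\<close>

lemma lie_deriv_eq_lie_form:
  assumes C: "C \<in> atlas M" "y \<in> fst C"
    and \<beta>: "analytic_tensor_field M p q \<beta>" and a: "(vs, ws) \<in> tensor_args M p q y"
  shows "lie_deriv M (scale_field b (\<xi>c i)) \<beta> y vs ws = b * lie_form C (\<xi>c i) \<beta> y vs ws"
proof -
  define D where "D = (SOME C. C \<in> atlas M \<and> y \<in> fst C)"
  have D: "D \<in> atlas M" "y \<in> fst D"
    using someI[of "\<lambda>C. C \<in> atlas M \<and> y \<in> fst C" C] C by (auto simp: D_def)
  have "lie_deriv M (scale_field b (\<xi>c i)) \<beta> y vs ws =
    (\<Sum>I \<in> multi_indices dimM (length vs). \<Sum>J \<in> multi_indices dimM (length ws).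
       lie_component M D (scale_field b (\<xi>c i)) \<beta> I J y *
       (\<Prod>r<length vs. (vs ! r) (\<lambda>y. snd D y (I ! r))) * (\<Prod>s<length ws. (ws ! s) (frame D (J ! s) y)))"
    by (simp add: lie_deriv_def D_def Let_def)
  also have "\<dots> = b * lie_form D (\<xi>c i) \<beta> y vs ws"
    unfolding lie_form_def sum_distrib_left
    by (intro sum.cong refl) (simp add: lie_component_scale[OF D velocity_coeff_analytic[OF D]] mult.assoc)
  also have "lie_form D (\<xi>c i) \<beta> y vs ws = lie_form C (\<xi>c i) \<beta> y vs ws"
    by (rule lie_form_chart_independent[OF D C \<beta> a])
  finally show ?thesis .
qed

lemma frame_args:
  assumes "C \<in> atlas M" "y \<in> fst C" "I \<in> multi_indices dimM p" "J \<in> multi_indices dimM q"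
  shows "(map (\<lambda>i. frame C i y) I, map (\<lambda>j. coframe C j y) J) \<in> tensor_args M p q y"
  using assms(3,4) coord_vec_tangent[OF assms(1,2)] coord_covec_cotangent[of C _ y]
  by (auto simp: tensor_args_def multi_indices_def)

lemma lie_form_frame:
  assumes C: "C \<in> atlas M" "y \<in> fst C" and I: "I \<in> multi_indices dimM p" and J: "J \<in> multi_indices dimM q"
  shows "lie_form C \<eta> \<beta> y (map (\<lambda>i. frame C i y) I) (map (\<lambda>j. coframe C j y) J) = lie_component M C \<eta> \<beta> I J y"
proof -
  have len: "length I = p" "length J = q" using I J by (auto simp: multi_indices_def)
  have P: "(\<Prod>r<p. (map (\<lambda>i. frame C i y) I ! r) (\<lambda>y. snd C y (I' ! r))) = (if I = I' then 1 else 0)"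
    if I': "I' \<in> multi_indices dimM p" for I'
  proof -
    have "(\<Prod>r<p. (map (\<lambda>i. frame C i y) I ! r) (\<lambda>y. snd C y (I' ! r))) = (\<Prod>r<p. if I ! r = I' ! r then 1 else 0)"
      by (rule prod.cong) (use coord_vec_coord[OF C] multi_indices_nth[OF I] multi_indices_nth[OF I'] len in auto)
    also have "\<dots> = (if I = I' then 1 else 0)" using I' len by (intro prod_if_eq_list) (auto simp: multi_indices_def)
    finally show ?thesis .
  qed
  have Q: "(\<Prod>s<q. (map (\<lambda>j. coframe C j y) J ! s) (frame C (J' ! s) y)) = (if J = J' then 1 else 0)"
    if J': "J' \<in> multi_indices dimM q" for J'
  proof -
    have "(\<Prod>s<q. (map (\<lambda>j. coframe C j y) J ! s) (frame C (J' ! s) y)) = (\<Prod>s<q. if J ! s = J' ! s then 1 else 0)"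
      by (rule prod.cong) (use coord_covec_coord_vec[OF C] multi_indices_nth[OF J] multi_indices_nth[OF J'] len in auto)
    also have "\<dots> = (if J = J' then 1 else 0)" using J' len by (intro prod_if_eq_list) (auto simp: multi_indices_def)
    finally show ?thesis .
  qed
  have "lie_form C \<eta> \<beta> y (map (\<lambda>i. frame C i y) I) (map (\<lambda>j. coframe C j y) J) =
      (\<Sum>I'\<in>multi_indices dimM p. \<Sum>J'\<in>multi_indices dimM q.
        lie_component M C \<eta> \<beta> I' J' y * (if I = I' then 1 else 0) * (if J = J' then 1 else 0))"
    unfolding lie_form_def length_map len
    by (intro sum.cong refl) (simp only: P Q)
  also have "\<dots> = (\<Sum>I'\<in>multi_indices dimM p. if I = I' then lie_component M C \<eta> \<beta> I' J y else 0)"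
  proof (rule sum.cong[OF refl])
    fix I' assume "I' \<in> multi_indices dimM p"
    have "(\<Sum>J'\<in>multi_indices dimM q. lie_component M C \<eta> \<beta> I' J' y * (if I = I' then 1 else 0) * (if J = J' then 1 else 0)) =
        (\<Sum>J'\<in>multi_indices dimM q. if J = J' then lie_component M C \<eta> \<beta> I' J' y * (if I = I' then 1 else 0) else 0)"
      by (rule sum.cong) auto
    then show "(\<Sum>J'\<in>multi_indices dimM q. lie_component M C \<eta> \<beta> I' J' y * (if I = I' then 1 else 0) * (if J = J' then 1 else 0)) =
        (if I = I' then lie_component M C \<eta> \<beta> I' J y else 0)"
      using J finite_multi_indices by (simp add: sum.delta')
  qed
  also have "\<dots> = lie_component M C \<eta> \<beta> I J y" using I finite_multi_indices by (simp add: sum.delta')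
  finally show ?thesis .
qed

text \<open>Multilinearity concerns one point and one chosen chart. For analyticity the components
  near \<open>x\<close> are rewritten in the single chart \<open>C\<close>, where they are
  polynomial expressions in analytic functions.\<close>

lemma lie_deriv_analytic:
  assumes \<beta>: "analytic_tensor_field M p q \<beta>"
  shows "analytic_tensor_field M p q (lie_deriv M (scale_field b (\<xi>c i)) \<beta>)"
  unfolding analytic_tensor_field_def
proof (intro conjI ballI)
  fix x assume "x \<in> carrier"
  define D where "D = (SOME C. C \<in> atlas M \<and> x \<in> fst C)"
  show "multilinear_at M p q x (lie_deriv M (scale_field b (\<xi>c i)) \<beta> x)"
    by (rule multilinear_at_contraction[where A = "multi_indices dimM p" and B = "multi_indices dimM q"
        and K = "\<lambda>I J. lie_component M D (scale_field b (\<xi>c i)) \<beta> I J x"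
        and f = "\<lambda>I r y. snd D y (I ! r)" and g = "\<lambda>J s. frame D (J ! s) x"])
       (simp add: lie_deriv_def D_def Let_def)
next
  fix C x I J assume C: "C \<in> atlas M" "x \<in> fst C" and I: "I \<in> multi_indices dimM p" and J: "J \<in> multi_indices dimM q"
  have comp: "analytic_at (tensor_component M C \<beta> I' J') x"
    if "I' \<in> multi_indices dimM p" "J' \<in> multi_indices dimM q" for I' J'
    using \<beta> C that unfolding analytic_tensor_field_def by blast
  have len: "length I = p" "length J = q" using I J by (auto simp: multi_indices_def)
  have "analytic_at (\<lambda>y. b * lie_component M C (\<xi>c i) \<beta> I J y) x"
    unfolding lie_component_def len
    by (intro analytic_at_mult analytic_at_const analytic_at_diff analytic_at_add analytic_at_sum
        velocity_coeff_analytic chart_partial_analytic comp C I J multi_indices_update)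
       (use multi_indices_nth[OF I] multi_indices_nth[OF J] in auto)
  then show "analytic_at (tensor_component M C (lie_deriv M (scale_field b (\<xi>c i)) \<beta>) I J) x"
  proof (rule analytic_at_local[OF _ atlas_facts(1)[OF C(1)] C(2)])
    fix y assume y: "y \<in> fst C"
    show "b * lie_component M C (\<xi>c i) \<beta> I J y = tensor_component M C (lie_deriv M (scale_field b (\<xi>c i)) \<beta>) I J y"
      unfolding tensor_component_def lie_deriv_eq_lie_form[OF C(1) y \<beta> frame_args[OF C(1) y I J]]
        lie_form_frame[OF C(1) y I J] ..
  qed
qed

end

section \<open>The expansion\<close>

lemma compositions_0: "compositions 0 = {[]}"
proof
  show "compositions 0 \<subseteq> {[]}"
  proof
    fix l assume "l \<in> compositions 0"
    then show "l \<in> {[]}" by (cases l) (auto simp: compositions_def)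
  qed
qed (simp add: compositions_def)

text \<open>The last entry is split off because its partial sum is the total \<open>Suc k\<close>,
  whatever the other entries are. Writing it as \<open>Suc i\<close> matches the index shift in the
  velocity coefficients.\<close>

lemma sum_compositions_Suc:
  fixes f :: "nat list \<Rightarrow> real"
  shows "(\<Sum>l\<in>compositions (Suc k). f l) = (\<Sum>i\<le>k. \<Sum>l\<in>compositions (k - i). f (l @ [Suc i]))"
proof -
  have "(\<Sum>l\<in>compositions (Suc k). f l) = (\<Sum>(i, l)\<in>Sigma {..k} (\<lambda>i. compositions (k - i)). f (l @ [Suc i]))"
  proof (rule sum.reindex_bij_witness[where i = "\<lambda>(i, l). l @ [Suc i]" and j = "\<lambda>l. (last l - 1, butlast l)"])
    fix l assume l: "l \<in> compositions (Suc k)"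
    then have ne: "l \<noteq> []" by (auto simp: compositions_def)
    obtain l' m where lm: "l = l' @ [m]" using ne by (cases l rule: rev_cases) auto
    have m: "m > 0" "sum_list l' + m = Suc k" "\<forall>m\<in>set l'. 0 < m" using l by (auto simp: lm compositions_def)
    show "(\<lambda>(i, l). l @ [Suc i]) (last l - 1, butlast l) = l" using m(1) by (simp add: lm)
    then show "(case (last l - 1, butlast l) of (i, l) \<Rightarrow> f (l @ [Suc i])) = f l" by simp
    show "(last l - 1, butlast l) \<in> Sigma {..k} (\<lambda>i. compositions (k - i))"
      using m by (auto simp: lm compositions_def)
  next
    fix x assume x: "x \<in> Sigma {..k} (\<lambda>i. compositions (k - i))"
    obtain i l where il: "x = (i, l)" by (cases x)
    have "i \<le> k" "\<forall>m\<in>set l. 0 < m" "sum_list l = k - i" using x by (auto simp: il compositions_def)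
    then show "(\<lambda>(i, l). l @ [Suc i]) x \<in> compositions (Suc k)" by (auto simp: il compositions_def)
    show "(last ((\<lambda>(i, l). l @ [Suc i]) x) - 1, butlast ((\<lambda>(i, l). l @ [Suc i]) x)) = x" by (simp add: il)
  qed
  then show ?thesis by (simp add: sum.Sigma finite_compositions)
qed

text \<open>The appended entry sits at the innermost position of the \<open>foldr\<close>, so its
  operator acts first.\<close>

lemma lie_product_snoc:
  "lie_product M \<phi> (l @ [m]) \<beta> =
   lie_product M \<phi> l (lie_deriv M (scale_field (inverse (real (sum_list (l @ [m])))) (velocity_coeff M \<phi> (m - 1))) \<beta>)"
proof -
  let ?op = "\<lambda>l j. lie_deriv M (scale_field (inverse (real (sum_list (take (Suc j) l)))) (velocity_coeff M \<phi> (l ! j - 1)))"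
  have "foldr (?op (l @ [m])) [0..<length (l @ [m])] \<beta> = foldr (?op (l @ [m])) [0..<length l] (?op (l @ [m]) (length l) \<beta>)"
    by simp
  \<comment> \<open>The partial sums at earlier positions do not see the appended entry.\<close>
  also have "\<dots> = foldr (?op l) [0..<length l] (?op (l @ [m]) (length l) \<beta>)"
    by (rule foldr_cong) (auto simp: nth_append)
  finally show ?thesis by (simp add: lie_product_def nth_append)
qed

context analytic_flow
begin

section \<open>The pullback as an analytic function of time and the recursion for its
  coefficients\<close>

lemma pullback_expand:
  assumes C: "C \<in> atlas M" "\<phi> t x \<in> fst C" and x: "x \<in> carrier" and t: "\<bar>t\<bar> < e"
    and \<beta>: "analytic_tensor_field M p q \<beta>" and a: "(vs, ws) \<in> tensor_args M p q x"
  shows "pullback M (\<phi> t) \<beta> x vs ws = (\<Sum>I\<in>multi_indices dimM p. \<Sum>J\<in>multi_indices dimM q.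
    tensor_component M C \<beta> I J (\<phi> t x) * (\<Prod>r<p. push_vec M (\<phi> t) x (vs ! r) (\<lambda>y. snd C y (I ! r))) *
    (\<Prod>s<q. push_covec M (\<phi> t) x (ws ! s) (frame C (J ! s) (\<phi> t x))))"
proof -
  have len: "length vs = p" "length ws = q" using a by (auto simp: tensor_args_def)
  have "multilinear_at M p q (\<phi> t x) (\<beta> (\<phi> t x))"
    using \<beta> flow_carrier[OF t x] unfolding analytic_tensor_field_def by blast
  from multilinear_at_expand[OF this C tensor_args_push[OF t x a]]
  show ?thesis by (simp add: pullback_def tensor_component_def len)
qed

lemma component_analytic:
  assumes "analytic_tensor_field M p q \<beta>" "C \<in> atlas M" "x \<in> fst C" "I \<in> multi_indices dimM p" "J \<in> multi_indices dimM q"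
  shows "analytic_at (tensor_component M C \<beta> I J) x"
  using assms unfolding analytic_tensor_field_def by blast

lemma push_product_analytic:
  assumes C: "C \<in> atlas M" "x \<in> fst C" and a: "(vs, ws) \<in> tensor_args M p q x"
    and I: "I \<in> multi_indices dimM p" and J: "J \<in> multi_indices dimM q"
  shows "analytic_at_0 (\<lambda>t. (\<Prod>r<p. push_vec M (\<phi> t) x (vs ! r) (\<lambda>y. snd C y (I ! r))) *
    (\<Prod>s<q. push_covec M (\<phi> t) x (ws ! s) (frame C (J ! s) (\<phi> t x))))"
proof (intro real_analytic_at_mult real_analytic_at_prod)
  fix r assume "r \<in> {..<p}"
  then have "vs ! r \<in> T x" "I ! r < dimM" using a multi_indices_nth[OF I] by (auto simp: tensor_args_def)
  then show "analytic_at_0 (\<lambda>t. push_vec M (\<phi> t) x (vs ! r) (\<lambda>y. snd C y (I ! r)))"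
    by (rule push_vec_component_analytic[OF C])
next
  fix s assume "s \<in> {..<q}"
  then have "ws ! s \<in> T' x" "J ! s < dimM" using a multi_indices_nth[OF J] by (auto simp: tensor_args_def)
  then show "analytic_at_0 (\<lambda>t. push_covec M (\<phi> t) x (ws ! s) (frame C (J ! s) (\<phi> t x)))"
    by (rule push_covec_component_analytic[OF C])
qed

lemma pullback_analytic:
  assumes x: "x \<in> carrier" and \<beta>: "analytic_tensor_field M p q \<beta>" and a: "(vs, ws) \<in> tensor_args M p q x"
  shows "analytic_at_0 (\<lambda>t. pullback M (\<phi> t) \<beta> x vs ws)"
proof -
  obtain C where C: "C \<in> atlas M" "x \<in> fst C" using chart_exists[OF x] by blast
  have "analytic_at_0 (\<lambda>t. \<Sum>I\<in>multi_indices dimM p. \<Sum>J\<in>multi_indices dimM q.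
    tensor_component M C \<beta> I J (\<phi> t x) * ((\<Prod>r<p. push_vec M (\<phi> t) x (vs ! r) (\<lambda>y. snd C y (I ! r))) *
    (\<Prod>s<q. push_covec M (\<phi> t) x (ws ! s) (frame C (J ! s) (\<phi> t x)))))"
    by (rule real_analytic_at_sum, rule real_analytic_at_sum, rule real_analytic_at_mult,
        rule analytic_along_flow[OF C], rule component_analytic[OF \<beta> C], assumption, assumption,
        rule push_product_analytic[OF C a])
  then show ?thesis
  proof (rule analytic_at_0_cong)
    show "\<forall>\<^sub>F t in nhds 0. (\<Sum>I\<in>multi_indices dimM p. \<Sum>J\<in>multi_indices dimM q.
      tensor_component M C \<beta> I J (\<phi> t x) * ((\<Prod>r<p. push_vec M (\<phi> t) x (vs ! r) (\<lambda>y. snd C y (I ! r))) *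
      (\<Prod>s<q. push_covec M (\<phi> t) x (ws ! s) (frame C (J ! s) (\<phi> t x))))) = pullback M (\<phi> t) \<beta> x vs ws"
      using near_zero[OF C]
    proof eventually_elim
      case (elim t)
      then show ?case using pullback_expand[OF C(1) _ x _ \<beta> a, of t] by (simp only: mult.assoc)
    qed
  qed
qed

text \<open>The field is taken at time \<open>z 0\<close>, while base point and arguments are
  transported by time \<open>z 1\<close>. Separating the two times allows a Taylor expansion of the
  field alone.\<close>

lemma lie_form_joint_analytic:
  assumes C: "C \<in> atlas M" "x \<in> fst C" and \<beta>: "analytic_tensor_field M p q \<beta>" and a: "(vs, ws) \<in> tensor_args M p q x"
  shows "real_analytic_at 2 (\<lambda>z. lie_form C (\<xi> (z 0)) \<beta> (\<phi> (z 1) x)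
    (map (push_vec M (\<phi> (z 1)) x) vs) (map (push_covec M (\<phi> (z 1)) x) ws)) (\<lambda>_. 0)"
proof -
  let ?A = "multi_indices dimM p" and ?B = "multi_indices dimM q"
  \<comment> \<open>The point moved by time \<open>z 1\<close>, with \<open>z 0\<close> in the time
    slot of \<open>velocity_expr\<close>.\<close>
  define pt where "pt z = (\<lambda>l. if l < dimM then snd C (\<phi> (z (1::nat)) x) l else 0)(dimM := z (0::nat))" for z :: "nat \<Rightarrow> real"
  define L where "L I J z = (\<Sum>k<dimM. velocity_expr C k (pt z) * chart_partial C k (tensor_component M C \<beta> I J) (\<phi> (z 1) x))
   + (\<Sum>r<p. \<Sum>k<dimM. partial_deriv (I ! r) (velocity_expr C k) (pt z) * tensor_component M C \<beta> (I[r := k]) J (\<phi> (z 1) x))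
   - (\<Sum>s<q. \<Sum>k<dimM. partial_deriv k (velocity_expr C (J ! s)) (pt z) * tensor_component M C \<beta> I (J[s := k]) (\<phi> (z 1) x))" for I J z
  define Q where "Q I J t = (\<Prod>r<p. push_vec M (\<phi> t) x (vs ! r) (\<lambda>y. snd C y (I ! r))) *
    (\<Prod>s<q. push_covec M (\<phi> t) x (ws ! s) (frame C (J ! s) (\<phi> t x)))" for I J t
  have x: "x \<in> carrier" by (rule chart_carrier[OF C])
  have a': "snd C x \<in> euc (Suc dimM)" using chart_euc[OF C] by (simp add: euc_iff)
  have len: "length vs = p" "length ws = q" using a by (auto simp: tensor_args_def)
  have E: "real_analytic_at 2 (\<lambda>z. H (pt z)) (\<lambda>_. 0)" if "real_analytic_at (Suc dimM) H (snd C x)" for H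
    unfolding pt_def by (rule analytic_along_flow_expr[OF C that]) auto
  have V: "real_analytic_at 2 (\<lambda>z. velocity_expr C k (pt z)) (\<lambda>_. 0)" if "k < dimM" for k
    by (rule E[OF velocity_expr_analytic[OF C that]])
  have dV: "real_analytic_at 2 (\<lambda>z. partial_deriv l (velocity_expr C k) (pt z)) (\<lambda>_. 0)" if "k < dimM" "l < dimM" for k l
    by (rule E[OF real_analytic_at_partial[OF velocity_expr_analytic[OF C that(1)] a' less_SucI[OF that(2)]]])
  have emb: "real_analytic_at 2 (\<lambda>z. h (z 1)) (\<lambda>_. 0)" if "analytic_at_0 h" for h
    by (rule analytic_at_0_embed[OF that]) simp
  have c: "real_analytic_at 2 (\<lambda>z. tensor_component M C \<beta> I J (\<phi> (z 1) x)) (\<lambda>_. 0)" if "I \<in> ?A" "J \<in> ?B" for I J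
    by (rule emb[OF analytic_along_flow[OF C component_analytic[OF \<beta> C that]]])
  have dc: "real_analytic_at 2 (\<lambda>z. chart_partial C k (tensor_component M C \<beta> I J) (\<phi> (z 1) x)) (\<lambda>_. 0)"
    if "I \<in> ?A" "J \<in> ?B" "k < dimM" for I J k
    by (rule emb[OF analytic_along_flow[OF C chart_partial_analytic[OF C component_analytic[OF \<beta> C that(1,2)] that(3)]]])
  have LA: "real_analytic_at 2 (L I J) (\<lambda>_. 0)" if I: "I \<in> ?A" and J: "J \<in> ?B" for I J
    unfolding L_def
    by (intro real_analytic_at_diff real_analytic_at_add real_analytic_at_sum real_analytic_at_mult V dV c dc I J multi_indices_update)
       (use multi_indices_nth[OF I] multi_indices_nth[OF J] in auto)
  have QA: "real_analytic_at 2 (\<lambda>z. Q I J (z 1)) (\<lambda>_. 0)" if I: "I \<in> ?A" and J: "J \<in> ?B" for I J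
    unfolding Q_def by (rule emb[OF push_product_analytic[OF C a I J]])
  have an: "real_analytic_at 2 (\<lambda>z. \<Sum>I\<in>?A. \<Sum>J\<in>?B. L I J z * Q I J (z 1)) (\<lambda>_. 0)"
    by (intro real_analytic_at_sum real_analytic_at_mult LA QA)
  obtain r where r: "r > 0" "\<And>t. \<bar>t\<bar> \<le> r \<Longrightarrow> \<bar>t\<bar> < e \<and> \<phi> t x \<in> fst C"
    using near_zero[OF C] by (rule eventually_cube_one) (rule that)
  show ?thesis
  proof (rule real_analytic_at_cong[OF an r(1)])
    fix z assume z: "z \<in> cube 2 (\<lambda>_. 0) r"
    then have y: "\<phi> (z 1) x \<in> fst C" using r(2)[of "z 1"] by (simp add: cube_iff)
    have pt: "pt z = (snd C (\<phi> (z 1) x))(dimM := z 0)" unfolding pt_def truncated_chart[OF C(1) y] ..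
    have "lie_component M C (\<xi> (z 0)) \<beta> I J (\<phi> (z 1) x) = L I J z" if I: "I \<in> ?A" and J: "J \<in> ?B" for I J
    proof -
      have lenIJ: "length I = p" "length J = q" using I J by (auto simp: multi_indices_def)
      show ?thesis unfolding L_def lie_component_def pt lenIJ velocity_expr_at[OF C(1) y]
        by (intro arg_cong2[where f = "(-)"] arg_cong2[where f = "(+)"] sum.cong refl)
           (simp_all add: velocity_expr_partial[OF C(1) y] multi_indices_nth[OF I] multi_indices_nth[OF J] del: One_nat_def)
    qed
    then show "(\<Sum>I\<in>?A. \<Sum>J\<in>?B. L I J z * Q I J (z 1)) = lie_form C (\<xi> (z 0)) \<beta> (\<phi> (z 1) x)
        (map (push_vec M (\<phi> (z 1)) x) vs) (map (push_covec M (\<phi> (z 1)) x) ws)"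
      by (simp add: lie_form_def len Q_def mult.assoc)
  qed
qed

text \<open>The factor \<open>Suc k\<close> produced by differentiation is absorbed into the vector
  field, where its inverse becomes the weight of the last factor in
  \<open>lie_product\<close>.\<close>

lemma pullback_taylor_recursion:
  assumes x: "x \<in> carrier" and \<beta>: "analytic_tensor_field M p q \<beta>" and a: "(vs, ws) \<in> tensor_args M p q x"
  shows "taylor_coeff (Suc k) (\<lambda>t. pullback M (\<phi> t) \<beta> x vs ws) = (\<Sum>i\<le>k. taylor_coeff (k - i)
    (\<lambda>t. pullback M (\<phi> t) (lie_deriv M (scale_field (inverse (real (Suc k))) (\<xi>c i)) \<beta>) x vs ws))"
proof -
  obtain C where C: "C \<in> atlas M" "x \<in> fst C" using chart_exists[OF x] by blast
  let ?F = "\<lambda>\<beta> t. pullback M (\<phi> t) \<beta> x vs ws" and ?b = "inverse (real (Suc k))"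
  define G where "G s t = lie_form C (\<xi> s) \<beta> (\<phi> t x) (map (push_vec M (\<phi> t) x) vs) (map (push_covec M (\<phi> t) x) ws)" for s t
  have "real (Suc k) * taylor_coeff (Suc k) (?F \<beta>) = taylor_coeff k (deriv (?F \<beta>))" by (rule taylor_coeff_Suc)
  also have "\<dots> = taylor_coeff k (\<lambda>t. G t t)"
  proof (rule taylor_coeff_cong)
    show "\<forall>\<^sub>F t in nhds 0. deriv (?F \<beta>) t = G t t"
      using near_zero[OF C]
    proof eventually_elim
      case (elim t)
      then show ?case unfolding G_def by (intro DERIV_imp_deriv pullback_derivative[OF x _ C(1) _ \<beta> a]) auto
    qed
  qed
  also have "\<dots> = (\<Sum>i\<le>k. taylor_coeff (k - i) (\<lambda>t. taylor_coeff i (\<lambda>s. G s t)))"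
    by (rule taylor_coeff_diagonal) (use lie_form_joint_analytic[OF C \<beta> a] in \<open>simp only: G_def\<close>)
  also have "\<dots> = (\<Sum>i\<le>k. real (Suc k) * taylor_coeff (k - i) (?F (lie_deriv M (scale_field ?b (\<xi>c i)) \<beta>)))"
  proof (rule sum.cong[OF refl])
    fix i
    let ?\<gamma> = "lie_deriv M (scale_field ?b (\<xi>c i)) \<beta>"
    have "\<forall>\<^sub>F t in nhds 0. taylor_coeff i (\<lambda>s. G s t) = real (Suc k) * ?F ?\<gamma> t"
      using near_zero[OF C]
    proof eventually_elim
      case (elim t)
      then have t: "\<bar>t\<bar> < e" and y: "\<phi> t x \<in> fst C" by auto
      \<comment> \<open>The coefficient in \<open>s\<close> is taken with \<open>t\<close>, hence
        point and arguments, held fixed, so only the field is expanded.\<close>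
      have "?F ?\<gamma> t = ?b * taylor_coeff i (\<lambda>s. G s t)"
        unfolding pullback_def G_def lie_form_taylor[OF C(1) y]
        by (rule lie_deriv_eq_lie_form[OF C(1) y \<beta> tensor_args_push[OF t x a]])
      then show ?case by (simp del: of_nat_Suc)
    qed
    then have "taylor_coeff (k - i) (\<lambda>t. taylor_coeff i (\<lambda>s. G s t)) = taylor_coeff (k - i) (\<lambda>t. real (Suc k) * ?F ?\<gamma> t)"
      by (rule taylor_coeff_cong)
    also have "\<dots> = real (Suc k) * taylor_coeff (k - i) (?F ?\<gamma>)"
      by (rule taylor_coeff_cmult[OF pullback_analytic[OF x lie_deriv_analytic[OF \<beta>] a]])
    finally show "taylor_coeff (k - i) (\<lambda>t. taylor_coeff i (\<lambda>s. G s t)) = real (Suc k) * taylor_coeff (k - i) (?F ?\<gamma>)" .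
  qed
  finally have "real (Suc k) * taylor_coeff (Suc k) (?F \<beta>) =
      real (Suc k) * (\<Sum>i\<le>k. taylor_coeff (k - i) (?F (lie_deriv M (scale_field ?b (\<xi>c i)) \<beta>)))"
    by (simp only: sum_distrib_left)
  then show ?thesis by (simp del: of_nat_Suc)
qed

lemma push_zero:
  assumes x: "x \<in> carrier"
  shows "v \<in> T x \<Longrightarrow> push_vec M (\<phi> 0) x v = v" "\<omega> \<in> T' x \<Longrightarrow> push_covec M (\<phi> 0) x \<omega> = \<omega>"
proof -
  have V: "push_vec M (\<phi> 0) x v = v" if v: "v \<in> T x" for v
  proof
    fix g
    show "push_vec M (\<phi> 0) x v g = v g"
    proof (cases "analytic_at g x")
      case True
      have "v g = v (\<lambda>y. g (\<phi> 0 y))"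
        by (rule tangent_local[OF v True openin_topspace x]) (simp add: phi_zero)
      then show ?thesis using True by (simp add: push_vec_def phi_zero[OF x])
    next
      case False
      then show ?thesis by (simp add: push_vec_def phi_zero[OF x] tangent_nonanalytic[OF v])
    qed
  qed
  show "v \<in> T x \<Longrightarrow> push_vec M (\<phi> 0) x v = v" by (rule V)
  assume w: "\<omega> \<in> T' x"
  show "push_covec M (\<phi> 0) x \<omega> = \<omega>"
  proof
    fix u
    show "push_covec M (\<phi> 0) x \<omega> u = \<omega> u"
    proof (cases "u \<in> T x")
      case True
      from push_covec_push_vec[OF e_0 x True, of \<omega>] show ?thesis by (simp only: V[OF True])
    next
      case False
      then show ?thesis by (simp add: push_covec_def phi_zero[OF x] cotangent_outside[OF w])
    qed
  qed
qed

lemma pullback_zero: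
  assumes x: "x \<in> carrier" and a: "(vs, ws) \<in> tensor_args M p q x"
  shows "pullback M (\<phi> 0) \<beta> x vs ws = \<beta> x vs ws"
proof -
  have "map (push_vec M (\<phi> 0) x) vs = vs" "map (push_covec M (\<phi> 0) x) ws = ws"
    using a push_zero[OF x] by (auto simp: tensor_args_def intro!: map_idI)
  then show ?thesis by (simp add: pullback_def phi_zero[OF x])
qed

text \<open>Induction on the degree, for all tensor fields at once, because the recursion replaces
  \<open>\<beta>\<close> by its Lie derivatives.\<close>

lemma pullback_taylor_coeff:
  assumes x: "x \<in> carrier" and a: "(vs, ws) \<in> tensor_args M p q x" and \<beta>: "analytic_tensor_field M p q \<beta>"
  shows "taylor_coeff k (\<lambda>t. pullback M (\<phi> t) \<beta> x vs ws) = (\<Sum>l\<in>compositions k. lie_product M \<phi> l \<beta> x vs ws)"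
  using \<beta>
proof (induction k arbitrary: \<beta> rule: less_induct)
  case (less k)
  show ?case
  proof (cases k)
    case 0
    then show ?thesis using pullback_zero[OF x a] by (simp add: taylor_coeff_def compositions_0 lie_product_def)
  next
    case (Suc m)
    let ?\<gamma> = "\<lambda>i. lie_deriv M (scale_field (inverse (real (Suc m))) (\<xi>c i)) \<beta>"
    have "taylor_coeff k (\<lambda>t. pullback M (\<phi> t) \<beta> x vs ws) = (\<Sum>i\<le>m. taylor_coeff (m - i) (\<lambda>t. pullback M (\<phi> t) (?\<gamma> i) x vs ws))"
      unfolding Suc by (rule pullback_taylor_recursion[OF x less.prems a])
    also have "\<dots> = (\<Sum>i\<le>m. \<Sum>l\<in>compositions (m - i). lie_product M \<phi> (l @ [Suc i]) \<beta> x vs ws)"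
    proof (rule sum.cong[OF refl])
      fix i assume "i \<in> {..m}"
      then have i: "i \<le> m" by simp
      have "taylor_coeff (m - i) (\<lambda>t. pullback M (\<phi> t) (?\<gamma> i) x vs ws) = (\<Sum>l\<in>compositions (m - i). lie_product M \<phi> l (?\<gamma> i) x vs ws)"
        by (rule less.IH[OF _ lie_deriv_analytic[OF less.prems]]) (simp add: Suc)
      also have "\<dots> = (\<Sum>l\<in>compositions (m - i). lie_product M \<phi> (l @ [Suc i]) \<beta> x vs ws)"
      proof (rule sum.cong[OF refl])
        fix l assume "l \<in> compositions (m - i)"
        \<comment> \<open>The full sum agrees with the scaling \<open>inverse (Suc m)\<close> from
          the recursion.\<close>
        then have "sum_list (l @ [Suc i]) = Suc m" using i by (simp add: compositions_def)
        then show "lie_product M \<phi> l (?\<gamma> i) x vs ws = lie_product M \<phi> (l @ [Suc i]) \<beta> x vs ws"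
          unfolding lie_product_snoc by (simp only: diff_Suc_1)
      qed
      finally show "taylor_coeff (m - i) (\<lambda>t. pullback M (\<phi> t) (?\<gamma> i) x vs ws) =
          (\<Sum>l\<in>compositions (m - i). lie_product M \<phi> (l @ [Suc i]) \<beta> x vs ws)" .
    qed
    also have "\<dots> = (\<Sum>l\<in>compositions k. lie_product M \<phi> l \<beta> x vs ws)"
      unfolding Suc by (rule sum_compositions_Suc[symmetric])
    finally show ?thesis .
  qed
qed

section \<open>Multilinearity of the pullback and convergence of its series\<close>

lemma push_covec_lincomb:
  "push_covec M f x (\<lambda>v. a * \<omega> v + b * \<theta> v) = (\<lambda>v. a * push_covec M f x \<omega> v + b * push_covec M f x \<theta> v)"
  by (auto simp: push_covec_def fun_eq_iff)

lemma pullback_multilinear: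
  assumes x: "x \<in> carrier" and t: "\<bar>t\<bar> < e" and \<beta>: "analytic_tensor_field M p q \<beta>"
  shows "multilinear_at M p q x (pullback M (\<phi> t) \<beta> x)"
proof -
  have F: "multilinear_at M p q (\<phi> t x) (\<beta> (\<phi> t x))"
    using \<beta> flow_carrier[OF t x] unfolding analytic_tensor_field_def by blast
  show ?thesis
    unfolding multilinear_at_def
  proof (intro ballI, clarify, intro conjI allI impI ballI)
    fix vs ws assume a: "(vs, ws) \<in> tensor_args M p q x"
    note args = tensor_args_push[OF t x a]
    show "pullback M (\<phi> t) \<beta> x (vs[i := \<lambda>f. c * u f + d * v f]) ws =
        c * pullback M (\<phi> t) \<beta> x (vs[i := u]) ws + d * pullback M (\<phi> t) \<beta> x (vs[i := v]) ws"
      if "i < p" "u \<in> T x" "v \<in> T x" for i u v c d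
      unfolding pullback_def map_update push_vec_lincomb
      by (rule multilinear_atD(1)[OF F args that(1) push_vec_flow_tangent[OF t x that(2)] push_vec_flow_tangent[OF t x that(3)]])
    show "pullback M (\<phi> t) \<beta> x vs (ws[j := \<lambda>v. c * \<omega> v + d * \<theta> v]) =
        c * pullback M (\<phi> t) \<beta> x vs (ws[j := \<omega>]) + d * pullback M (\<phi> t) \<beta> x vs (ws[j := \<theta>])"
      if "j < q" "\<omega> \<in> T' x" "\<theta> \<in> T' x" for j \<omega> \<theta> c d
      unfolding pullback_def map_update push_covec_lincomb
      by (rule multilinear_atD(2)[OF F args that(1) push_covec_cotangent[OF t x that(2)] push_covec_cotangent[OF t x that(3)]])
  qed
qed

text \<open>By multilinearity the radius of convergence needs to be controlled only for the finitely many
  arguments taken from a frame.\<close>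

lemma pullback_series:
  assumes x: "x \<in> carrier" and \<beta>: "analytic_tensor_field M p q \<beta>"
  obtains \<delta> where "\<delta> > 0" "\<delta> \<le> e" "\<And>t vs ws. \<bar>t\<bar> < \<delta> \<Longrightarrow> (vs, ws) \<in> tensor_args M p q x \<Longrightarrow>
    (\<lambda>k. taylor_coeff k (\<lambda>t. pullback M (\<phi> t) \<beta> x vs ws) * t ^ k) sums pullback M (\<phi> t) \<beta> x vs ws"
proof -
  obtain C where C: "C \<in> atlas M" "x \<in> fst C" using chart_exists[OF x] by blast
  let ?K = "multi_indices dimM p \<times> multi_indices dimM q"
  let ?f = "\<lambda>(I, J) t. pullback M (\<phi> t) \<beta> x (map (\<lambda>i. frame C i x) I) (map (\<lambda>j. coframe C j x) J)"
  have "analytic_at_0 (?f j)" if "j \<in> ?K" for j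
    using that pullback_analytic[OF x \<beta> frame_args[OF C]] by (cases j) simp
  with finite_cartesian_product[OF finite_multi_indices finite_multi_indices]
  obtain r N where r: "r > 0" and b: "\<And>j. j \<in> ?K \<Longrightarrow> bseries 1 (\<lambda>_. 0) r (N j) (\<lambda>z. ?f j (z 0))"
    by (rule real_analytic_at_family[where f = "\<lambda>j z. ?f j (z 0)"]) (assumption, rule that)
  \<comment> \<open>\<open>e / 2\<close> keeps the closed interval of radius \<open>\<delta>\<close>
    inside the open interval on which the family is defined.\<close>
  define \<delta> where "\<delta> = min r (e / 2)"
  have \<delta>: "\<delta> > 0" "\<delta> \<le> r" "\<delta> < e" using r e_pos by (auto simp: \<delta>_def)
  have "(\<lambda>k. taylor_coeff k (\<lambda>t. pullback M (\<phi> t) \<beta> x vs ws) * t ^ k) sums pullback M (\<phi> t) \<beta> x vs ws"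
    if t: "\<bar>t\<bar> < \<delta>" and a: "(vs, ws) \<in> tensor_args M p q x" for t vs ws
  proof -
    \<comment> \<open>The coefficients of the arguments in the frame at \<open>x\<close>. They do
      not depend on \<open>t\<close>, so the radius found for the frame serves all
      arguments.\<close>
    define k where "k = (\<lambda>(I, J). (\<Prod>r<p. (vs ! r) (\<lambda>y. snd C y (I ! r))) * (\<Prod>s<q. (ws ! s) (frame C (J ! s) x)))"
    have "bseries 1 (\<lambda>_. 0) \<delta> (\<Sum>j\<in>?K. \<bar>k j\<bar> * N j) (\<lambda>z. \<Sum>j\<in>?K. k j * ?f j (z 0))"
      by (rule bseries_sum[OF \<delta>(1)], rule finite_cartesian_product[OF finite_multi_indices finite_multi_indices],
          rule bseries_cmult, rule bseries_radius_mono[OF b \<delta>(1,2)])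
    then have "bseries 1 (\<lambda>_. 0) \<delta> (\<Sum>j\<in>?K. \<bar>k j\<bar> * N j) (\<lambda>z. pullback M (\<phi> (z 0)) \<beta> x vs ws)"
    proof (rule bseries_cong)
      fix z assume "z \<in> cube 1 (\<lambda>_. 0) \<delta>"
      then have "\<bar>z 0\<bar> \<le> \<delta>" by (simp add: cube_iff)
      then have z: "\<bar>z 0\<bar> < e" using \<delta>(3) by linarith
      have "pullback M (\<phi> (z 0)) \<beta> x vs ws = (\<Sum>I\<in>multi_indices dimM p. \<Sum>J\<in>multi_indices dimM q. k (I, J) * ?f (I, J) (z 0))"
        unfolding multilinear_at_expand[OF pullback_multilinear[OF x z \<beta>] C a]
        by (intro sum.cong refl) (simp add: k_def)
      also have "\<dots> = (\<Sum>j\<in>?K. k j * ?f j (z 0))"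
        unfolding sum.cartesian_product by (rule sum.cong) auto
      finally show "(\<Sum>j\<in>?K. k j * ?f j (z 0)) = pullback M (\<phi> (z 0)) \<beta> x vs ws" by (rule sym)
    qed
    from taylor_has_sum[OF this, of t] t show ?thesis by (intro has_sum_imp_sums) simp
  qed
  then show thesis using that[of \<delta>] \<delta> by auto
qed

end

theorem mainTheorem2:
  fixes M :: "'a manifold" and e :: real and \<phi> :: "real \<Rightarrow> 'a \<Rightarrow> 'a"
    and p q :: nat and \<alpha> :: "'a tensor_field"
  assumes "real_analytic_manifold M"
    and "e > 0"
    and "analytic_family M e \<phi>"
    and "\<forall>x \<in> topspace (mtop M). \<phi> 0 x = x"
    and "analytic_tensor_field M p q \<alpha>"
  shows "(\<forall>k\<ge>1. \<forall>x \<in> topspace (mtop M). \<forall>(vs, ws) \<in> tensor_args M p q x.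
            (deriv ^^ k) (\<lambda>t. pullback M (\<phi> t) \<alpha> x vs ws) 0 / fact k
            = (\<Sum>l \<in> compositions k. lie_product M \<phi> l \<alpha> x vs ws)) \<and>
         (\<forall>x \<in> topspace (mtop M). \<exists>\<delta>>0. \<delta> \<le> e \<and>
            (\<forall>t. \<bar>t\<bar> < \<delta> \<longrightarrow> (\<forall>(vs, ws) \<in> tensor_args M p q x.
               (\<lambda>k. t ^ Suc k * (\<Sum>l \<in> compositions (Suc k). lie_product M \<phi> l \<alpha> x vs ws))
               sums (pullback M (\<phi> t) \<alpha> x vs ws - \<alpha> x vs ws))))"
proof -
  interpret analytic_flow M e \<phi>
    by (intro analytic_flow.intro analytic_manifold.intro analytic_flow_axioms.intro assms(1-4))
  note coeff = pullback_taylor_coeff[OF _ _ assms(5)]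
  show ?thesis
  proof (intro conjI allI impI ballI)
    fix k :: nat and x args assume x: "x \<in> topspace (mtop M)" and a: "args \<in> tensor_args M p q x"
    obtain vs ws where args: "args = (vs, ws)" by (cases args)
    show "case args of (vs, ws) \<Rightarrow> (deriv ^^ k) (\<lambda>t. pullback M (\<phi> t) \<alpha> x vs ws) 0 / fact k
        = (\<Sum>l \<in> compositions k. lie_product M \<phi> l \<alpha> x vs ws)"
      using coeff[OF x a[unfolded args], of k] by (simp add: args taylor_coeff_def)
  next
    fix x assume x: "x \<in> topspace (mtop M)"
    obtain \<delta> where \<delta>: "\<delta> > 0" "\<delta> \<le> e" "\<And>t vs ws. \<bar>t\<bar> < \<delta> \<Longrightarrow> (vs, ws) \<in> tensor_args M p q x \<Longrightarrow>
      (\<lambda>k. taylor_coeff k (\<lambda>t. pullback M (\<phi> t) \<alpha> x vs ws) * t ^ k) sums pullback M (\<phi> t) \<alpha> x vs ws"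
      using x assms(5) by (rule pullback_series) (rule that)
    show "\<exists>\<delta>>0. \<delta> \<le> e \<and> (\<forall>t. \<bar>t\<bar> < \<delta> \<longrightarrow> (\<forall>(vs, ws) \<in> tensor_args M p q x.
       (\<lambda>k. t ^ Suc k * (\<Sum>l \<in> compositions (Suc k). lie_product M \<phi> l \<alpha> x vs ws))
       sums (pullback M (\<phi> t) \<alpha> x vs ws - \<alpha> x vs ws)))"
    proof (intro exI[of _ \<delta>] conjI allI impI ballI \<delta>(1,2))
      fix t :: real and args assume t: "\<bar>t\<bar> < \<delta>" and a: "args \<in> tensor_args M p q x"
      obtain vs ws where args: "args = (vs, ws)" by (cases args)
      note a' = a[unfolded args]
      \<comment> \<open>The only composition of 0 is the empty list, whose product is the identity;
        thus \<open>c 0\<close> is the value of \<open>\<alpha>\<close>, and dropping it leaves the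
        series from degree 1 on.\<close>
      define c where "c k = (\<Sum>l\<in>compositions k. lie_product M \<phi> l \<alpha> x vs ws) * t ^ k" for k
      have "c sums pullback M (\<phi> t) \<alpha> x vs ws"
        unfolding c_def using \<delta>(3)[OF t a'] by (simp only: coeff[OF x a'])
      then have "(\<lambda>k. c (Suc k)) sums (pullback M (\<phi> t) \<alpha> x vs ws - c 0)"
        by (simp add: sums_Suc_iff)
      then show "case args of (vs, ws) \<Rightarrow> (\<lambda>k. t ^ Suc k * (\<Sum>l \<in> compositions (Suc k). lie_product M \<phi> l \<alpha> x vs ws))
         sums (pullback M (\<phi> t) \<alpha> x vs ws - \<alpha> x vs ws)"
        by (simp add: args c_def compositions_0 lie_product_def mult.commute)
    qed
  qed
qed

end
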